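(* Let $\mathcal H=\bigoplus_{\mathbf n\in\mathbb N^\ell}\mathcal H_{\mathbf n}$ be an $\mathbb N^\ell$-graded connected Hopf algebra over $\mathbb Q$ and let $\mathbf k\in(\mathbb N\cup\{\infty\})^\ell$. (1) If $\phi:\mathcal H\to\mathbb Q$ is a $\mathbf k$-odd linear functional with $\phi(1)=1$, then there exists a unique morphism $\Psi:\mathcal H\to\mathrm{QSym}^{(\ell)}$ of $\mathbb N^\ell$-graded coalgebras such that $\zeta_{\mathcal Q}\circ\Psi=\phi$, and the image of $\Psi$ lies in $\mathcal O^{\mathbf k}$. (2) Explicitly, for $\mathbf n\in\mathbb N^\ell$ and $h\in\mathcal H_{\mathbf n}$, $\Psi(h)=\sum_{\mathbf I}\phi^{\mathbf I}(h)M_{\mathbf I}$, summed over vector compositions $\mathbf I$ of $\mathbf n$, where for $\mathbf I=(\mathbf i_1,\dots,\mathbf i_m)$, $\phi^{\mathbf I}$ is the composite $\mathcal H\xrightarrow{\Delta^{(m-1)}}\mathcal H^{\otimes m}\xrightarrow{\text{projection}}\mathcal H_{\mathbf i_1}\otimes\cdots\otimes\mathcal H_{\mathbf i_m}\xrightarrow{\phi^{\otimes m}}\mathbb Q^{\otimes m}\xrightarrow{\text{mult.}}\mathbb Q$. (3) If $\phi$ is moreover a character, then $\Psi$ is a homomorphism of $\mathbb N^\ell$-graded Hopf algebras; that is, $(\mathcal O^{\mathbf k},\zeta_{\mathcal Q})$ is the terminal object of the category of multigraded combinatorial Hopf algebras whose characters are $\mathbf k$-odd.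
   Context: Fix $\ell\ge1$. $\mathbb N^\ell$ consists of column vectors with weight $|\mathbf n|=\sum n_i$, ordered coordinatewise; this extends to $(\mathbb N\cup\{\infty\})^\ell$ with $\infty$ larger than every integer. A vector composition of $\mathbf n$ is a sequence $\mathbf I=(\mathbf i_1,\dots,\mathbf i_m)$ of nonzero elements of $\mathbb N^\ell$ summing to $\mathbf n$ (the empty one for $\mathbf n=\mathbf 0$). $\mathrm{QSym}^{(\ell)}$ is the $\mathbb Q$-span of $M_{\mathbf I}=\sum_{j_1<\dots<j_m}\mathbf x_{j_1}^{\mathbf i_1}\cdots\mathbf x_{j_m}^{\mathbf i_m}$, $M_{()}=1$, in commuting variables $x_j^{(i)}$ ($j\ge1$, $0\le i<\ell$), $\mathbf x_j^{\mathbf n}=\prod_i(x_j^{(i)})^{n_i}$; it is an $\mathbb N^\ell$-graded connected Hopf algebra (degree of $M_{\mathbf I}$ is $\sum\mathbf i_r$; product of power series; coproduct $\Delta M_{\mathbf I}=\sum_{\mathbf I=\mathbf J\mathbf K}M_{\mathbf J}\otimes M_{\mathbf K}$ by deconcatenation). $\zeta_{\mathcal Q}$ is the character with $\zeta_{\mathcal Q}(M_{\mathbf I})=1$ if $\mathbf I$ has length $\le1$ and $0$ otherwise. For linear functionals on a graded connected Hopf algebra, convolution is $\phi\psi=m_{\mathbb Q}\circ(\phi\otimes\psi)\circ\Delta$; $\phi$ is convolution invertible iff $\phi(1)\ne0$, with inverse $\phi^{-1}$. $\phi_{\mathbf n}$ is the restriction of $\phi$ to $\mathcal H_{\mathbf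 n}$, and $\bar\phi(h)=(-1)^{|\mathbf n|}\phi(h)$ for $h\in\mathcal H_{\mathbf n}$. An invertible linear functional $\phi$ is $\mathbf k$-odd if $(\bar\phi)_{\mathbf n}=(\phi^{-1})_{\mathbf n}$ for all $\mathbf n\in\mathbb N^\ell$ with $\mathbf n\le\mathbf k$. For linear functionals $\phi,\psi$, $\mathcal S_{\mathbf k}(\phi,\psi)$ is the largest graded subcoalgebra $C$ with $\phi(h)=\psi(h)$ for all $h\in C\cap\bigoplus_{\mathbf n\le\mathbf k}\mathcal H_{\mathbf n}$. $\mathcal O^{\mathbf k}=\mathcal S_{\mathbf k}(\bar\zeta_{\mathcal Q},\zeta_{\mathcal Q}^{-1})\subseteq\mathrm{QSym}^{(\ell)}$ (the $\mathbf k$-odd subalgebra). A multigraded combinatorial Hopf algebra is a pair $(\mathcal H,\phi)$ with $\phi$ a character; morphisms are graded Hopf maps $\Psi$ with $\phi'\circ\Psi=\phi$. *)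

theory Defs
  imports
    "HOL-Analysis.Finite_Cartesian_Product"
    "HOL-Library.Extended_Nat"
    "HOL-Library.Poly_Mapping"
    "HOL-Library.Function_Algebras"
begin

section \<open>Rational vector spaces\<close>

class rat_vector = ab_group_add +
  fixes scaleQ :: "rat \<Rightarrow> 'a \<Rightarrow> 'a"  (infixr \<open>*\<^sub>Q\<close> 75)
  assumes scaleQ_add_right: "c *\<^sub>Q (x + y) = c *\<^sub>Q x + c *\<^sub>Q y"
    and scaleQ_add_left: "(c + d) *\<^sub>Q x = c *\<^sub>Q x + d *\<^sub>Q x"
    and scaleQ_scaleQ: "c *\<^sub>Q (d *\<^sub>Q x) = (c * d) *\<^sub>Q x"
    and scaleQ_one: "1 *\<^sub>Q x = x"

global_interpretation qvs: vector_space "scaleQ :: rat \<Rightarrow> 'a::rat_vector \<Rightarrow> 'a"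
  by standard (simp_all add: scaleQ_add_right scaleQ_add_left scaleQ_scaleQ scaleQ_one)

global_interpretation qvp: vector_space_pair
  "scaleQ :: rat \<Rightarrow> 'a::rat_vector \<Rightarrow> 'a" "scaleQ :: rat \<Rightarrow> 'b::rat_vector \<Rightarrow> 'b" ..

instantiation rat :: rat_vector
begin
definition scaleQ_rat :: "rat \<Rightarrow> rat \<Rightarrow> rat" where "scaleQ_rat = (*)"
instance by standard (simp_all add: scaleQ_rat_def algebra_simps)
end

instantiation "fun" :: (type, rat_vector) rat_vector
begin
definition scaleQ_fun :: "rat \<Rightarrow> ('a \<Rightarrow> 'b) \<Rightarrow> 'a \<Rightarrow> 'b"
  where "scaleQ_fun c f = (\<lambda>x. c *\<^sub>Q f x)"
instance
  by standard (auto simp: scaleQ_fun_def fun_eq_iff qvs.scale_right_distrib qvs.scale_left_distrib)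
end

instantiation poly_mapping :: (type, rat_vector) rat_vector
begin
definition scaleQ_poly_mapping :: "rat \<Rightarrow> ('a \<Rightarrow>\<^sub>0 'b) \<Rightarrow> 'a \<Rightarrow>\<^sub>0 'b"
  where "scaleQ_poly_mapping c = Poly_Mapping.map (scaleQ c)"

lemma lookup_scaleQ:
  "Poly_Mapping.lookup (c *\<^sub>Q p) x = c *\<^sub>Q Poly_Mapping.lookup p x"
  unfolding scaleQ_poly_mapping_def by (simp add: Poly_Mapping.map.rep_eq when_def)

instance
  by standard (auto intro!: poly_mapping_eqI
      simp: lookup_scaleQ lookup_add qvs.scale_right_distrib qvs.scale_left_distrib)
end

definition linear_onQ :: "'a::rat_vector set \<Rightarrow> ('a \<Rightarrow> 'b::rat_vector) \<Rightarrow> bool" where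
  "linear_onQ S f \<longleftrightarrow> (\<forall>x\<in>S. \<forall>y\<in>S. f (x + y) = f x + f y) \<and>
                     (\<forall>c. \<forall>x\<in>S. f (c *\<^sub>Q x) = c *\<^sub>Q f x)"

section \<open>Tensor powers\<close>

text \<open>
  All tensor powers of a rational vector space live in one type, its tensor algebra: the free
  vector space on finite words modulo multilinearity in every letter.
\<close>

inductive_set tensor_relators :: "('a::rat_vector list \<Rightarrow>\<^sub>0 rat) set" where
  "Poly_Mapping.single (xs @ (a + b) # ys) 1
    - Poly_Mapping.single (xs @ a # ys) 1 - Poly_Mapping.single (xs @ b # ys) 1 \<in> tensor_relators"
| "Poly_Mapping.single (xs @ (c *\<^sub>Q a) # ys) 1
    - c *\<^sub>Q Poly_Mapping.single (xs @ a # ys) 1 \<in> tensor_relators"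

definition tensor_eq :: "('a::rat_vector list \<Rightarrow>\<^sub>0 rat) \<Rightarrow> ('a list \<Rightarrow>\<^sub>0 rat) \<Rightarrow> bool" where
  "tensor_eq p q \<longleftrightarrow> p - q \<in> qvs.span tensor_relators"

lemma equivp_tensor_eq: "equivp (tensor_eq :: ('a::rat_vector list \<Rightarrow>\<^sub>0 rat) \<Rightarrow> _)"
proof (rule equivpI)
  show "reflp (tensor_eq :: ('a list \<Rightarrow>\<^sub>0 rat) \<Rightarrow> _)"
    by (auto intro!: reflpI simp: tensor_eq_def qvs.span_zero)
  show "symp (tensor_eq :: ('a list \<Rightarrow>\<^sub>0 rat) \<Rightarrow> _)"
    unfolding symp_def tensor_eq_def by (metis minus_diff_eq qvs.span_neg)
  show "transp (tensor_eq :: ('a list \<Rightarrow>\<^sub>0 rat) \<Rightarrow> _)"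
  proof (rule transpI)
    fix p q r :: "'a list \<Rightarrow>\<^sub>0 rat"
    assume "tensor_eq p q" "tensor_eq q r"
    then have "(p - q) + (q - r) \<in> qvs.span tensor_relators"
      unfolding tensor_eq_def by (rule qvs.span_add)
    then show "tensor_eq p r" by (simp add: tensor_eq_def)
  qed
qed

quotient_type (overloaded) 'a tensor = "'a::rat_vector list \<Rightarrow>\<^sub>0 rat" / tensor_eq
  by (rule equivp_tensor_eq)

instantiation tensor :: (rat_vector) rat_vector
begin

lift_definition zero_tensor :: "'a tensor" is 0 .

lift_definition plus_tensor :: "'a tensor \<Rightarrow> 'a tensor \<Rightarrow> 'a tensor" is "(+)"
  unfolding tensor_eq_def by (metis add_diff_add qvs.span_add)

lift_definition minus_tensor :: "'a tensor \<Rightarrow> 'a tensor \<Rightarrow> 'a tensor" is "(-)"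
proof -
  fix p1 p2 q1 q2 :: "'a list \<Rightarrow>\<^sub>0 rat"
  assume "tensor_eq p1 p2" "tensor_eq q1 q2"
  then have "(p1 - p2) - (q1 - q2) \<in> qvs.span tensor_relators"
    unfolding tensor_eq_def by (rule qvs.span_diff)
  then show "tensor_eq (p1 - q1) (p2 - q2)"
    unfolding tensor_eq_def by (simp add: algebra_simps)
qed

lift_definition uminus_tensor :: "'a tensor \<Rightarrow> 'a tensor" is uminus
  unfolding tensor_eq_def by (metis minus_diff_minus qvs.span_neg)

lift_definition scaleQ_tensor :: "rat \<Rightarrow> 'a tensor \<Rightarrow> 'a tensor" is scaleQ
  unfolding tensor_eq_def by (metis qvs.scale_right_diff_distrib qvs.span_scale)

instance
proof
  fix a b c :: "'a tensor" and r s :: rat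
  note rfl = equivp_reflp[OF equivp_tensor_eq]
  show "a + b + c = a + (b + c)" by transfer (simp add: add.assoc rfl)
  show "a + b = b + a" by transfer (simp add: add.commute rfl)
  show "0 + a = a" by transfer (simp add: rfl)
  show "- a + a = 0" by transfer (simp add: rfl)
  show "a - b = a + - b" by transfer (simp add: rfl)
  show "r *\<^sub>Q (a + b) = r *\<^sub>Q a + r *\<^sub>Q b" by transfer (simp add: qvs.scale_right_distrib rfl)
  show "(r + s) *\<^sub>Q a = r *\<^sub>Q a + s *\<^sub>Q a" by transfer (simp add: qvs.scale_left_distrib rfl)
  show "r *\<^sub>Q (s *\<^sub>Q a) = (r * s) *\<^sub>Q a" by transfer (simp add: rfl)
  show "1 *\<^sub>Q a = a" by transfer (simp add: rfl)
qed

end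

text \<open>The pure tensor \<open>x\<^sub>1 \<otimes> \<dots> \<otimes> x\<^sub>m\<close>.\<close>

lift_definition tens :: "'a::rat_vector list \<Rightarrow> 'a tensor"
  is "\<lambda>xs. Poly_Mapping.single xs 1" .

text \<open>The square \<open>S \<otimes> S\<close> of a subspace, as a subspace of the tensor square of the whole type.\<close>

definition tensor_square :: "'a::rat_vector set \<Rightarrow> 'a tensor set" where
  "tensor_square S = qvs.span {tens [a, b] | a b. a \<in> S \<and> b \<in> S}"

text \<open>
  The linear map determined on all tensor powers of the subspace \<open>S\<close> by a map \<open>g\<close> on words
  over \<open>S\<close> that is multilinear in each length (universal property; see \<open>tensor_lift_exists\<close>).
  Its values outside the tensor powers of \<open>S\<close> are irrelevant.
\<close>

definition tensor_lift :: "'a::rat_vector set \<Rightarrow> ('a list \<Rightarrow> 'b::rat_vector) \<Rightarrow> 'a tensor \<Rightarrow> 'b" where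
  "tensor_lift S g =
     (SOME F. Vector_Spaces.linear scaleQ scaleQ F \<and> (\<forall>xs. set xs \<subseteq> S \<longrightarrow> F (tens xs) = g xs))"

definition tensor_lift2 :: "'a::rat_vector set \<Rightarrow> ('a \<Rightarrow> 'a \<Rightarrow> 'b::rat_vector) \<Rightarrow> 'a tensor \<Rightarrow> 'b" where
  "tensor_lift2 S g = tensor_lift S (\<lambda>xs. case xs of [a, b] \<Rightarrow> g a b | _ \<Rightarrow> 0)"

definition multilinear_onQ :: "'a::rat_vector set \<Rightarrow> ('a list \<Rightarrow> 'b::rat_vector) \<Rightarrow> bool" where
  "multilinear_onQ S g \<longleftrightarrow>
     (\<forall>xs ys. set xs \<subseteq> S \<longrightarrow> set ys \<subseteq> S \<longrightarrow> linear_onQ S (\<lambda>a. g (xs @ a # ys)))"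

lemma tensor_lift_exists:
  fixes g :: "'a::rat_vector list \<Rightarrow> 'b::rat_vector"
  assumes S: "qvs.subspace S" and g: "multilinear_onQ S g"
  shows "\<exists>F. Vector_Spaces.linear scaleQ scaleQ F \<and> (\<forall>xs. set xs \<subseteq> S \<longrightarrow> F (tens xs) = g xs)"
proof -
  have "Vector_Spaces.linear scaleQ scaleQ (id :: 'a \<Rightarrow> 'a)"
    by (rule qvs.linear_id)
  from qvp.linear_exists_left_inverse_on[OF this S]
  obtain p :: "'a \<Rightarrow> 'a" where p: "range p \<subseteq> S" "Vector_Spaces.linear scaleQ scaleQ p"
      "\<And>v. v \<in> S \<Longrightarrow> p v = v"
    by auto
  interpret p: Vector_Spaces.linear scaleQ scaleQ p by (rule p(2))
  define L where "L q = (\<Sum>xs\<in>Poly_Mapping.keys q. Poly_Mapping.lookup q xs *\<^sub>Q g (map p xs))"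
    for q :: "'a list \<Rightarrow>\<^sub>0 rat"
  have L_sup: "L q = (\<Sum>xs\<in>A. Poly_Mapping.lookup q xs *\<^sub>Q g (map p xs))"
    if "finite A" "Poly_Mapping.keys q \<subseteq> A" for q A
    unfolding L_def using that
    by (intro sum.mono_neutral_left) (auto simp: in_keys_iff)
  have L_add: "L (q + r) = L q + L r" for q r
  proof -
    let ?A = "Poly_Mapping.keys q \<union> Poly_Mapping.keys r"
    have "L (q + r) = (\<Sum>xs\<in>?A. Poly_Mapping.lookup (q + r) xs *\<^sub>Q g (map p xs))"
      by (rule L_sup) (auto simp: Poly_Mapping.keys_add)
    also have "\<dots> = L q + L r"
      by (simp add: L_sup[of ?A q] L_sup[of ?A r] lookup_add qvs.scale_left_distrib sum.distrib)
    finally show ?thesis .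
  qed
  have L_scale: "L (c *\<^sub>Q q) = c *\<^sub>Q L q" for c q
  proof -
    have "L (c *\<^sub>Q q) = (\<Sum>xs\<in>Poly_Mapping.keys q. Poly_Mapping.lookup (c *\<^sub>Q q) xs *\<^sub>Q g (map p xs))"
      by (rule L_sup) (auto simp: in_keys_iff lookup_scaleQ scaleQ_rat_def)
    then show ?thesis
      by (simp add: L_def lookup_scaleQ scaleQ_rat_def qvs.scale_sum_right)
  qed
  have L_lin: "Vector_Spaces.linear scaleQ scaleQ L"
    by (simp add: Vector_Spaces.linear_iff qvs.vector_space_axioms L_add L_scale)
  interpret L: Vector_Spaces.linear scaleQ scaleQ L by (rule L_lin)
  have L_single: "L (Poly_Mapping.single xs 1) = g (map p xs)" for xs
    by (simp add: L_def)
  have in_S: "set (map p xs) \<subseteq> S" "p a \<in> S" for xs a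
    using p(1) by auto
  have L_relator: "L r = 0" if "r \<in> tensor_relators" for r
    using that
  proof cases
    case (1 xs a b ys)
    have "linear_onQ S (\<lambda>a. g (map p xs @ a # map p ys))"
      using g in_S unfolding multilinear_onQ_def by blast
    then show ?thesis
      using in_S(2) unfolding 1 linear_onQ_def by (simp add: L.diff L_single p.add)
  next
    case (2 xs c a ys)
    have "linear_onQ S (\<lambda>a. g (map p xs @ a # map p ys))"
      using g in_S unfolding multilinear_onQ_def by blast
    then show ?thesis
      using in_S(2) unfolding 2 linear_onQ_def by (simp add: L.diff L_scale L_single p.scale)
  qed
  have L_span: "L r = 0" if "r \<in> qvs.span tensor_relators" for r
    using that by (rule L.eq_0_on_span[rotated]) (rule L_relator)
  define F where "F t = L (rep_tensor t)" for t
  have F_abs: "F (abs_tensor q) = L q" for q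
  proof -
    have "tensor_eq (rep_tensor (abs_tensor q)) q"
      by (rule Quotient3_rep_abs[OF Quotient3_tensor]) (rule equivp_reflp[OF equivp_tensor_eq])
    then have "L (rep_tensor (abs_tensor q) - q) = 0"
      unfolding tensor_eq_def by (rule L_span)
    then show ?thesis by (simp add: F_def L.diff)
  qed
  have abs_rep: "\<exists>q. t = abs_tensor q" for t :: "'a tensor"
    by (metis Quotient3_abs_rep[OF Quotient3_tensor])
  have "Vector_Spaces.linear scaleQ scaleQ F"
  proof (simp add: Vector_Spaces.linear_iff qvs.vector_space_axioms, intro conjI allI)
    fix t u :: "'a tensor" and c
    obtain q r where qr: "t = abs_tensor q" "u = abs_tensor r" using abs_rep by metis
    show "F (t + u) = F t + F u"
      by (simp add: qr plus_tensor.abs_eq F_abs L_add)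
    show "F (c *\<^sub>Q t) = c *\<^sub>Q F t"
      by (simp add: qr scaleQ_tensor.abs_eq F_abs L_scale)
  qed
  moreover have "F (tens xs) = g xs" if "set xs \<subseteq> S" for xs
  proof -
    have "map p xs = xs" using that p(3) by (simp add: map_idI subset_iff)
    then show ?thesis by (simp add: tens.abs_eq F_abs L_single)
  qed
  ultimately show ?thesis by blast
qed

section \<open>Multigraded spaces, coalgebras and Hopf algebras\<close>

text \<open>
  A vector space graded by \<open>\<nat>\<^sup>\<ell>\<close> is given by its homogeneous components, subspaces of an ambient
  rational vector space; the space itself is their (direct) sum. The structure maps
  below are only relevant on that sum.
\<close>

record (overloaded) ('h::rat_vector, 'l::finite) gcoalg =
  grade :: "nat ^ 'l \<Rightarrow> 'h set"
  cop :: "'h \<Rightarrow> 'h tensor"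
  counit :: "'h \<Rightarrow> rat"

record (overloaded) ('h::rat_vector, 'l::finite) ghopf = "('h, 'l) gcoalg" +
  mul :: "'h \<Rightarrow> 'h \<Rightarrow> 'h"
  one :: "'h"

definition hspace :: "('h::rat_vector, 'l::finite, 'm) gcoalg_scheme \<Rightarrow> 'h set" where
  "hspace H = qvs.span (\<Union>n. grade H n)"

definition is_decomp ::
  "('h::rat_vector, 'l::finite, 'm) gcoalg_scheme \<Rightarrow> 'h \<Rightarrow> (nat ^ 'l \<Rightarrow> 'h) \<Rightarrow> bool" where
  "is_decomp H h f \<longleftrightarrow>
     (\<forall>n. f n \<in> grade H n) \<and> finite {n. f n \<noteq> 0} \<and> h = (\<Sum>n | f n \<noteq> 0. f n)"

definition component ::
  "('h::rat_vector, 'l::finite, 'm) gcoalg_scheme \<Rightarrow> nat ^ 'l \<Rightarrow> 'h \<Rightarrow> 'h" where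
  "component H n h = (THE f. is_decomp H h f) n"

definition graded_space :: "('h::rat_vector, 'l::finite, 'm) gcoalg_scheme \<Rightarrow> bool" where
  "graded_space H \<longleftrightarrow> (\<forall>n. qvs.subspace (grade H n)) \<and> (\<forall>h\<in>hspace H. \<exists>!f. is_decomp H h f)"

definition graded_coalgebra :: "('h::rat_vector, 'l::finite, 'm) gcoalg_scheme \<Rightarrow> bool" where
  "graded_coalgebra H \<longleftrightarrow>
     graded_space H \<and>
     linear_onQ (hspace H) (cop H) \<and>
     (\<forall>n. \<forall>h\<in>grade H n.
        cop H h \<in> qvs.span {tens [a, b] | a b i j. i + j = n \<and> a \<in> grade H i \<and> b \<in> grade H j}) \<and>
     linear_onQ (hspace H) (counit H) \<and>
     (\<forall>n. n \<noteq> 0 \<longrightarrow> (\<forall>h\<in>grade H n. counit H h = 0)) \<and>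
     (\<forall>h\<in>hspace H.
        tensor_lift2 (hspace H) (\<lambda>a b. tensor_lift2 (hspace H) (\<lambda>c d. tens [c, d, b]) (cop H a)) (cop H h) =
        tensor_lift2 (hspace H) (\<lambda>a b. tensor_lift2 (hspace H) (\<lambda>c d. tens [a, c, d]) (cop H b)) (cop H h)) \<and>
     (\<forall>h\<in>hspace H. tensor_lift2 (hspace H) (\<lambda>a b. counit H a *\<^sub>Q b) (cop H h) = h) \<and>
     (\<forall>h\<in>hspace H. tensor_lift2 (hspace H) (\<lambda>a b. counit H b *\<^sub>Q a) (cop H h) = h)"

definition graded_algebra :: "('h::rat_vector, 'l::finite, 'm) ghopf_scheme \<Rightarrow> bool" where
  "graded_algebra H \<longleftrightarrow>
     graded_space H \<and>
     (\<forall>a\<in>hspace H. linear_onQ (hspace H) (mul H a) \<and> linear_onQ (hspace H) (\<lambda>b. mul H b a)) \<and>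
     (\<forall>m n. \<forall>a\<in>grade H m. \<forall>b\<in>grade H n. mul H a b \<in> grade H (m + n)) \<and>
     (\<forall>a\<in>hspace H. \<forall>b\<in>hspace H. \<forall>c\<in>hspace H. mul H (mul H a b) c = mul H a (mul H b c)) \<and>
     one H \<in> grade H 0 \<and>
     (\<forall>a\<in>hspace H. mul H (one H) a = a \<and> mul H a (one H) = a)"

text \<open>The product \<open>(a \<otimes> b)(c \<otimes> d) = ac \<otimes> bd\<close> on the tensor square.\<close>

definition mul2 ::
  "('h::rat_vector, 'l::finite, 'm) ghopf_scheme \<Rightarrow> 'h tensor \<Rightarrow> 'h tensor \<Rightarrow> 'h tensor" where
  "mul2 H t u =
     tensor_lift2 (hspace H)
       (\<lambda>a b. tensor_lift2 (hspace H) (\<lambda>c d. tens [mul H a c, mul H b d]) u) t"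

definition graded_bialgebra :: "('h::rat_vector, 'l::finite, 'm) ghopf_scheme \<Rightarrow> bool" where
  "graded_bialgebra H \<longleftrightarrow>
     graded_algebra H \<and> graded_coalgebra H \<and>
     cop H (one H) = tens [one H, one H] \<and>
     (\<forall>a\<in>hspace H. \<forall>b\<in>hspace H. cop H (mul H a b) = mul2 H (cop H a) (cop H b)) \<and>
     counit H (one H) = 1 \<and>
     (\<forall>a\<in>hspace H. \<forall>b\<in>hspace H. counit H (mul H a b) = counit H a * counit H b)"

definition is_antipode :: "('h::rat_vector, 'l::finite, 'm) ghopf_scheme \<Rightarrow> ('h \<Rightarrow> 'h) \<Rightarrow> bool" where
  "is_antipode H S \<longleftrightarrow>
     linear_onQ (hspace H) S \<and> (\<forall>n. S ` grade H n \<subseteq> grade H n) \<and>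
     (\<forall>h\<in>hspace H.
        tensor_lift2 (hspace H) (\<lambda>a b. mul H (S a) b) (cop H h) = counit H h *\<^sub>Q one H \<and>
        tensor_lift2 (hspace H) (\<lambda>a b. mul H a (S b)) (cop H h) = counit H h *\<^sub>Q one H)"

definition graded_connected_hopf :: "('h::rat_vector, 'l::finite, 'm) ghopf_scheme \<Rightarrow> bool" where
  "graded_connected_hopf H \<longleftrightarrow>
     graded_bialgebra H \<and> (\<exists>S. is_antipode H S) \<and> grade H 0 = range (\<lambda>c. c *\<^sub>Q one H)"

definition graded_coalgebra_hom ::
  "('h::rat_vector, 'l::finite, 'm) gcoalg_scheme \<Rightarrow> ('k::rat_vector, 'l, 'n) gcoalg_scheme \<Rightarrow>
   ('h \<Rightarrow> 'k) \<Rightarrow> bool" where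
  "graded_coalgebra_hom H K \<Psi> \<longleftrightarrow>
     linear_onQ (hspace H) \<Psi> \<and> (\<forall>n. \<Psi> ` grade H n \<subseteq> grade K n) \<and>
     (\<forall>h\<in>hspace H. cop K (\<Psi> h) = tensor_lift2 (hspace H) (\<lambda>a b. tens [\<Psi> a, \<Psi> b]) (cop H h)) \<and>
     (\<forall>h\<in>hspace H. counit K (\<Psi> h) = counit H h)"

definition graded_hopf_hom ::
  "('h::rat_vector, 'l::finite, 'm) ghopf_scheme \<Rightarrow> ('k::rat_vector, 'l, 'n) ghopf_scheme \<Rightarrow>
   ('h \<Rightarrow> 'k) \<Rightarrow> bool" where
  "graded_hopf_hom H K \<Psi> \<longleftrightarrow>
     graded_coalgebra_hom H K \<Psi> \<and>
     \<Psi> (one H) = one K \<and>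
     (\<forall>a\<in>hspace H. \<forall>b\<in>hspace H. \<Psi> (mul H a b) = mul K (\<Psi> a) (\<Psi> b)) \<and>
     (\<forall>S S'. is_antipode H S \<longrightarrow> is_antipode K S' \<longrightarrow> (\<forall>h\<in>hspace H. \<Psi> (S h) = S' (\<Psi> h)))"

section \<open>Linear functionals\<close>

definition conv ::
  "('h::rat_vector, 'l::finite, 'm) gcoalg_scheme \<Rightarrow> ('h \<Rightarrow> rat) \<Rightarrow> ('h \<Rightarrow> rat) \<Rightarrow> 'h \<Rightarrow> rat" where
  "conv H \<phi> \<psi> h = tensor_lift2 (hspace H) (\<lambda>a b. \<phi> a * \<psi> b) (cop H h)"

definition is_conv_inverse ::
  "('h::rat_vector, 'l::finite, 'm) gcoalg_scheme \<Rightarrow> ('h \<Rightarrow> rat) \<Rightarrow> ('h \<Rightarrow> rat) \<Rightarrow> bool" where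
  "is_conv_inverse H \<phi> \<psi> \<longleftrightarrow> linear_onQ (hspace H) \<psi> \<and>
     (\<forall>h\<in>hspace H. conv H \<phi> \<psi> h = counit H h \<and> conv H \<psi> \<phi> h = counit H h)"

text \<open>The convolution inverse; it is unique as a function on \<open>hspace H\<close>.\<close>

definition conv_inverse ::
  "('h::rat_vector, 'l::finite, 'm) gcoalg_scheme \<Rightarrow> ('h \<Rightarrow> rat) \<Rightarrow> 'h \<Rightarrow> rat" where
  "conv_inverse H \<phi> = (SOME \<psi>. is_conv_inverse H \<phi> \<psi>)"

definition weight :: "nat ^ 'l::finite \<Rightarrow> nat" where
  "weight n = (\<Sum>i\<in>UNIV. n $ i)"

definition bar ::
  "('h::rat_vector, 'l::finite, 'm) gcoalg_scheme \<Rightarrow> ('h \<Rightarrow> rat) \<Rightarrow> 'h \<Rightarrow> rat" where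
  "bar H \<phi> h = (\<Sum>n | component H n h \<noteq> 0. (- 1) ^ weight n * \<phi> (component H n h))"

definition below :: "nat ^ 'l::finite \<Rightarrow> enat ^ 'l \<Rightarrow> bool" where
  "below n k \<longleftrightarrow> (\<chi> i. enat (n $ i)) \<le> k"

definition odd_functional ::
  "('h::rat_vector, 'l::finite, 'm) gcoalg_scheme \<Rightarrow> enat ^ 'l \<Rightarrow> ('h \<Rightarrow> rat) \<Rightarrow> bool" where
  "odd_functional H k \<phi> \<longleftrightarrow>
     linear_onQ (hspace H) \<phi> \<and> (\<exists>\<psi>. is_conv_inverse H \<phi> \<psi>) \<and>
     (\<forall>n. below n k \<longrightarrow> (\<forall>h\<in>grade H n. bar H \<phi> h = conv_inverse H \<phi> h))"

definition graded_subcoalgebra ::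
  "('h::rat_vector, 'l::finite, 'm) gcoalg_scheme \<Rightarrow> 'h set \<Rightarrow> bool" where
  "graded_subcoalgebra H C \<longleftrightarrow>
     C \<subseteq> hspace H \<and> C = qvs.span (\<Union>n. C \<inter> grade H n) \<and> cop H ` C \<subseteq> tensor_square C"

definition agreement_subcoalgebra ::
  "('h::rat_vector, 'l::finite, 'm) gcoalg_scheme \<Rightarrow> enat ^ 'l \<Rightarrow> ('h \<Rightarrow> rat) \<Rightarrow> ('h \<Rightarrow> rat) \<Rightarrow> 'h set" where
  "agreement_subcoalgebra H k \<phi> \<psi> =
     (GREATEST C. graded_subcoalgebra H C \<and>
        (\<forall>h \<in> C \<inter> qvs.span (\<Union>n\<in>{n. below n k}. grade H n). \<phi> h = \<psi> h))"

definition character :: "('h::rat_vector, 'l::finite, 'm) ghopf_scheme \<Rightarrow> ('h \<Rightarrow> rat) \<Rightarrow> bool" where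
  "character H \<phi> \<longleftrightarrow>
     linear_onQ (hspace H) \<phi> \<and> \<phi> (one H) = 1 \<and>
     (\<forall>a\<in>hspace H. \<forall>b\<in>hspace H. \<phi> (mul H a b) = \<phi> a * \<phi> b)"

text \<open>
  The iterated coproduct into the \<open>m\<close>-th tensor power, by
  \<open>\<Delta>\<^bsup>(m)\<^esup> = (\<Delta> \<otimes> id \<otimes> \<dots> \<otimes> id) \<circ> \<Delta>\<^bsup>(m - 1)\<^esup>\<close>, starting with the identity at \<open>m = 1\<close>; the value at
  \<open>m = 0\<close> is the counit, with \<open>tens []\<close> spanning the zeroth tensor power \<open>\<rat>\<close>.
\<close>

fun iterated_cop ::
  "('h::rat_vector, 'l::finite, 'm) gcoalg_scheme \<Rightarrow> nat \<Rightarrow> 'h \<Rightarrow> 'h tensor" where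
  "iterated_cop H 0 h = counit H h *\<^sub>Q tens []"
| "iterated_cop H (Suc 0) h = tens [h]"
| "iterated_cop H (Suc (Suc m)) h =
     tensor_lift (hspace H)
       (\<lambda>xs. case xs of [] \<Rightarrow> 0
          | a # ys \<Rightarrow> tensor_lift2 (hspace H) (\<lambda>c d. tens (c # d # ys)) (cop H a))
       (iterated_cop H (Suc m) h)"

definition tensor_component ::
  "('h::rat_vector, 'l::finite, 'm) gcoalg_scheme \<Rightarrow> (nat ^ 'l) list \<Rightarrow> 'h tensor \<Rightarrow> 'h tensor" where
  "tensor_component H I =
     tensor_lift (hspace H)
       (\<lambda>xs. if length xs = length I then tens (map2 (component H) I xs) else 0)"

definition comp_functional ::
  "('h::rat_vector, 'l::finite, 'm) gcoalg_scheme \<Rightarrow> ('h \<Rightarrow> rat) \<Rightarrow> (nat ^ 'l) list \<Rightarrow> 'h \<Rightarrow> rat" where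
  "comp_functional H \<phi> I h =
     tensor_lift UNIV prod_list
       (tensor_lift (hspace H) (\<lambda>xs. tens (map \<phi> xs))
         (tensor_component H I (iterated_cop H (length I) h)))"

section \<open>Quasisymmetric functions of level \<open>\<ell>\<close>\<close>

definition vector_comps :: "nat ^ 'l::finite \<Rightarrow> (nat ^ 'l) list set" where
  "vector_comps n = {I. 0 \<notin> set I \<and> sum_list I = n}"

text \<open>
  Power series in the variables \<open>x\<^sub>j\<^sup>(\<^sup>i\<^sup>)\<close>, as coefficient functions on monomials. The index \<open>j\<close> runs
  over the naturals from \<open>0\<close>; only its order type matters.
\<close>

type_synonym 'l monomial = "nat \<times> 'l \<Rightarrow>\<^sub>0 nat"
type_synonym 'l pseries = "'l monomial \<Rightarrow> rat"

definition pseries_mult :: "'l pseries \<Rightarrow> 'l pseries \<Rightarrow> 'l pseries" where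
  "pseries_mult f g \<mu> = (\<Sum>(\<alpha>, \<beta>) | \<alpha> + \<beta> = \<mu>. f \<alpha> * g \<beta>)"

definition pseries_one :: "'l pseries" where
  "pseries_one \<mu> = (if \<mu> = 0 then 1 else 0)"

definition xpow :: "nat \<Rightarrow> nat ^ 'l::finite \<Rightarrow> 'l monomial" where
  "xpow j n = (\<Sum>i\<in>UNIV. Poly_Mapping.single (j, i) (n $ i))"

definition M :: "(nat ^ 'l::finite) list \<Rightarrow> 'l pseries" where
  "M I \<mu> = of_nat (card {js. length js = length I \<and> sorted_wrt (<) js \<and>
                            (\<Sum>(j, n)\<leftarrow>zip js I. xpow j n) = \<mu>})"

text \<open>
  The \<open>M I\<close> over all vector compositions form a basis of their span; \<open>M_extend g\<close> is the linear
  map with \<open>M I \<mapsto> g I\<close>.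
\<close>

definition M_coeff :: "'l::finite pseries \<Rightarrow> (nat ^ 'l) list \<Rightarrow> rat" where
  "M_coeff f I = qvs.representation (M ` {J. 0 \<notin> set J}) f (M I)"

definition M_extend :: "((nat ^ 'l::finite) list \<Rightarrow> 'b::rat_vector) \<Rightarrow> 'l pseries \<Rightarrow> 'b" where
  "M_extend g f = (\<Sum>I | 0 \<notin> set I \<and> M_coeff f I \<noteq> 0. M_coeff f I *\<^sub>Q g I)"

definition QSym :: "('l::finite pseries, 'l) ghopf" where
  "QSym = \<lparr>grade = (\<lambda>n. qvs.span (M ` vector_comps n)),
           cop = M_extend (\<lambda>I. \<Sum>r\<le>length I. tens [M (take r I), M (drop r I)]),
           counit = M_extend (\<lambda>I. if I = [] then 1 else 0),
           mul = pseries_mult,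
           one = pseries_one\<rparr>"

definition zetaQ :: "'l::finite pseries \<Rightarrow> rat" where
  "zetaQ = M_extend (\<lambda>I. if length I \<le> 1 then 1 else 0)"

definition odd_part :: "enat ^ 'l::finite \<Rightarrow> 'l pseries set" where
  "odd_part k = agreement_subcoalgebra QSym k (bar QSym zetaQ) (conv_inverse QSym zetaQ)"

definition odd_QSym :: "enat ^ 'l::finite \<Rightarrow> ('l pseries, 'l) ghopf" where
  "odd_QSym k = QSym\<lparr>grade := (\<lambda>n. odd_part k \<inter> grade QSym n)\<rparr>"

section \<open>Combinatorial Hopf algebras\<close>

definition comb_hopf :: "('h::rat_vector, 'l::finite, 'm) ghopf_scheme \<Rightarrow> ('h \<Rightarrow> rat) \<Rightarrow> bool" where
  "comb_hopf H \<phi> \<longleftrightarrow> graded_connected_hopf H \<and> character H \<phi>"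

definition comb_hopf_hom ::
  "('h::rat_vector, 'l::finite, 'm) ghopf_scheme \<Rightarrow> ('h \<Rightarrow> rat) \<Rightarrow>
   ('k::rat_vector, 'l, 'n) ghopf_scheme \<Rightarrow> ('k \<Rightarrow> rat) \<Rightarrow> ('h \<Rightarrow> 'k) \<Rightarrow> bool" where
  "comb_hopf_hom H \<phi> K \<psi> \<Psi> \<longleftrightarrow> graded_hopf_hom H K \<Psi> \<and> (\<forall>h\<in>hspace H. \<psi> (\<Psi> h) = \<phi> h)"

end

theory Submission
  imports Defs
begin

text \<open>
  The coefficient of \<open>M (i # I)\<close> in a quasisymmetric function is the convolution product of the
  coefficients of \<open>M [i]\<close> and of \<open>M I\<close>, and the coefficient of \<open>M [i]\<close> is \<open>zetaQ\<close> cut down to degree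
  \<open>i\<close>. A graded coalgebra map \<open>\<Psi>\<close> pulls convolution products back to convolution products, so
  all coefficients of \<open>\<Psi> h\<close> are determined by \<open>zetaQ \<circ> \<Psi> = \<phi>\<close>; this forces both the formula for \<open>\<Psi>\<close>
  and its uniqueness, and coassociativity shows that the formula defines a coalgebra map. The same
  induction on words compares \<open>\<Psi> (a b)\<close> with \<open>\<Psi> a \<Psi> b\<close> when \<open>\<phi>\<close> is a character. Since \<open>zetaQ\<close> and
  its inverse pull back to \<open>\<phi>\<close> and its inverse, the image of \<open>\<Psi>\<close> is a graded subcoalgebra on which the
  defining identity of the odd subalgebra holds, so it lies in the largest one. Finally
  \<open>zetaQ\<^sup>-\<^sup>1 (M I) = (- 1) ^ length I\<close> is again multiplicative, hence products of elements of the odd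
  subalgebra span a subcoalgebra with the same property; the antipode comes for free because the
  bialgebra is connected.
\<close>

section \<open>Linear and multilinear maps on subspaces\<close>

text \<open>A graded space is a family of subspaces of an ambient type, and its structure maps are
  constrained only on \<open>hspace H\<close>; even \<open>tensor_lift\<close> is a choice of some
  extension. Hence the arguments run through Sweedler sums over finite lists of pure tensors, with
  linearity and membership tracked on subspaces. Coefficients of quasisymmetric functions are
  obtained by evaluating the power series at one suitable monomial per word, a functional that is
  linear on all power series, so that statements about the basis become evaluations. Products of
  power series are compared after cutting down to finitely many variables, where they are products
  of polynomials; the quasi-shuffle rule and associativity both come from there. Nonzero letters
  never see \<phi> in degree zero, where \<open>zetaQ\<close> composed with a coalgebra map is
  forced to be the counit. Connectedness together with \<phi>(1) = 1 says that \<phi> is the counit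
  there too.\<close>

lemma linear_onQI:
  assumes "\<And>x y. x \<in> S \<Longrightarrow> y \<in> S \<Longrightarrow> f (x + y) = f x + f y"
    and "\<And>c x. x \<in> S \<Longrightarrow> f (c *\<^sub>Q x) = c *\<^sub>Q f x"
  shows "linear_onQ S f"
  using assms by (simp add: linear_onQ_def)

lemma linear_onQ_add: "linear_onQ S f \<Longrightarrow> x \<in> S \<Longrightarrow> y \<in> S \<Longrightarrow> f (x + y) = f x + f y"
  by (simp add: linear_onQ_def)

lemma linear_onQ_scale: "linear_onQ S f \<Longrightarrow> x \<in> S \<Longrightarrow> f (c *\<^sub>Q x) = c *\<^sub>Q f x"
  by (simp add: linear_onQ_def)

lemma linear_onQ_zero: "linear_onQ S f \<Longrightarrow> qvs.subspace S \<Longrightarrow> f 0 = 0"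
  using linear_onQ_scale[of S f 0 0] by (simp add: qvs.subspace_0)

lemma linear_onQ_sum:
  assumes "linear_onQ S f" "qvs.subspace S" "\<And>i. i \<in> A \<Longrightarrow> g i \<in> S"
  shows "f (\<Sum>i\<in>A. g i) = (\<Sum>i\<in>A. f (g i))"
  using assms(3)
proof (induction A rule: infinite_finite_induct)
  case (insert i A)
  then show ?case
    using linear_onQ_add[OF assms(1)] by (simp add: qvs.subspace_sum[OF assms(2)])
qed (simp_all add: linear_onQ_zero[OF assms(1,2)])

lemma subspace_sum_list:
  assumes "qvs.subspace S" "\<And>i. i \<in> set xs \<Longrightarrow> g i \<in> S"
  shows "(\<Sum>i\<leftarrow>xs. g i) \<in> S"
  using assms(2) by (induction xs) (auto simp: qvs.subspace_0 qvs.subspace_add assms(1))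

lemma linear_onQ_sum_list:
  assumes "linear_onQ S f" "qvs.subspace S" "\<And>i. i \<in> set xs \<Longrightarrow> g i \<in> S"
  shows "f (\<Sum>i\<leftarrow>xs. g i) = (\<Sum>i\<leftarrow>xs. f (g i))"
  using assms(3)
proof (induction xs)
  case (Cons i xs)
  then show ?case
    using linear_onQ_add[OF assms(1)] by (simp add: subspace_sum_list[OF assms(2)])
qed (simp_all add: linear_onQ_zero[OF assms(1,2)])

lemma linear_onQ_sum_list_pairs:
  assumes "linear_onQ S f" "qvs.subspace S" "\<And>a b. (a, b) \<in> set xs \<Longrightarrow> g a b \<in> S"
  shows "f (\<Sum>(a, b)\<leftarrow>xs. g a b) = (\<Sum>(a, b)\<leftarrow>xs. f (g a b))"
proof -
  have "f (\<Sum>p\<leftarrow>xs. g (fst p) (snd p)) = (\<Sum>p\<leftarrow>xs. f (g (fst p) (snd p)))"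
    by (rule linear_onQ_sum_list[OF assms(1,2)]) (use assms(3) in auto)
  then show ?thesis by (simp add: case_prod_beta')
qed

lemma linear_onQ_subset: "linear_onQ T f \<Longrightarrow> S \<subseteq> T \<Longrightarrow> linear_onQ S f"
  unfolding linear_onQ_def by blast

lemma linear_onQ_cong:
  assumes "linear_onQ S f" "qvs.subspace S" "\<And>x. x \<in> S \<Longrightarrow> g x = f x"
  shows "linear_onQ S g"
  using assms by (simp add: linear_onQ_def qvs.subspace_add qvs.subspace_scale)

lemma linear_onQ_const_zero: "linear_onQ S (\<lambda>_. 0)"
  by (simp add: linear_onQ_def)

lemma linear_onQ_id: "linear_onQ S (\<lambda>x. x)"
  by (simp add: linear_onQ_def)

lemma linear_onQ_plus: "linear_onQ S f \<Longrightarrow> linear_onQ S g \<Longrightarrow> linear_onQ S (\<lambda>x. f x + g x)"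
  by (simp add: linear_onQ_def scaleQ_add_right)

lemma linear_onQ_scaleQ: "linear_onQ S f \<Longrightarrow> linear_onQ S (\<lambda>x. c *\<^sub>Q f x)"
  by (simp add: linear_onQ_def scaleQ_add_right mult.commute)

lemma linear_onQ_minus': "linear_onQ S f \<Longrightarrow> linear_onQ S g \<Longrightarrow> linear_onQ S (\<lambda>x. f x - g x)"
  by (simp add: linear_onQ_def qvs.scale_right_diff_distrib)

lemma linear_onQ_scale_left: "linear_onQ S f \<Longrightarrow> linear_onQ S (\<lambda>x. f x *\<^sub>Q v)"
  by (simp add: linear_onQ_def scaleQ_add_left scaleQ_rat_def)

lemma linear_onQ_times_left: "linear_onQ S f \<Longrightarrow> linear_onQ S (\<lambda>x. f x * (c::rat))"
  by (simp add: linear_onQ_def scaleQ_rat_def algebra_simps)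

lemma linear_onQ_times_right: "linear_onQ S f \<Longrightarrow> linear_onQ S (\<lambda>x. (c::rat) * f x)"
  by (simp add: linear_onQ_def scaleQ_rat_def algebra_simps)

lemma linear_onQ_setsum:
  "(\<And>i. i \<in> A \<Longrightarrow> linear_onQ S (f i)) \<Longrightarrow> linear_onQ S (\<lambda>x. \<Sum>i\<in>A. f i x)"
  by (induction A rule: infinite_finite_induct) (auto simp: linear_onQ_const_zero linear_onQ_plus)

lemma linear_onQ_list_sum:
  "(\<And>i. i \<in> set A \<Longrightarrow> linear_onQ S (f i)) \<Longrightarrow> linear_onQ S (\<lambda>x. \<Sum>i\<leftarrow>A. f i x)"
  by (induction A) (auto simp: linear_onQ_const_zero linear_onQ_plus)

lemma linear_onQ_compose:
  assumes "linear_onQ T f" "linear_onQ S g" "\<And>x. x \<in> S \<Longrightarrow> g x \<in> T"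
  shows "linear_onQ S (\<lambda>x. f (g x))"
  using assms by (simp add: linear_onQ_def)

text \<open>Since \<open>f\<close> and \<open>g\<close> are additive only on the span, the induction
  has to carry membership of every partial sum along with the equation.\<close>

lemma linear_onQ_eq_on_span:
  assumes "linear_onQ (qvs.span B) f" "linear_onQ (qvs.span B) g" "\<And>x. x \<in> B \<Longrightarrow> f x = g x"
    and "x \<in> qvs.span B"
  shows "f x = g x"
proof -
  have "x \<in> qvs.span B \<and> f x = g x"
    using assms(4)
  proof (induction rule: qvs.span_induct_alt)
    case base
    show ?case using assms(1,2) by (simp add: linear_onQ_zero qvs.span_zero)
  next
    case (step c x y)
    have "c *\<^sub>Q x \<in> qvs.span B" "x \<in> qvs.span B" "y \<in> qvs.span B"
      using step by (auto intro: qvs.span_base qvs.span_scale)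
    then show ?case
      using step assms(1-3)
      by (simp add: qvs.span_add linear_onQ_add[of "qvs.span B"] linear_onQ_scale[of "qvs.span B"])
  qed
  then show ?thesis ..
qed

lemma linear_onQ_image_span:
  assumes "linear_onQ (qvs.span B) f" "qvs.subspace T" "\<And>x. x \<in> B \<Longrightarrow> f x \<in> T"
    and "x \<in> qvs.span B"
  shows "f x \<in> T"
proof -
  have "x \<in> qvs.span B \<and> f x \<in> T"
    using assms(4)
  proof (induction rule: qvs.span_induct_alt)
    case base
    show ?case using assms(1,2) by (simp add: linear_onQ_zero qvs.subspace_0 qvs.span_zero)
  next
    case (step c x y)
    have "c *\<^sub>Q x \<in> qvs.span B" "x \<in> qvs.span B" "y \<in> qvs.span B"
      using step by (auto intro: qvs.span_base qvs.span_scale)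
    then show ?case
      using step assms
      by (simp add: linear_onQ_add[of "qvs.span B"] linear_onQ_scale[of "qvs.span B"]
          qvs.subspace_add qvs.subspace_scale qvs.span_add)
  qed
  then show ?thesis ..
qed

lemma linear_iff_linear_onQ: "Vector_Spaces.linear scaleQ scaleQ F \<longleftrightarrow> linear_onQ UNIV F"
  by (simp add: Vector_Spaces.linear_iff qvs.vector_space_axioms linear_onQ_def)

section \<open>Bilinear and trilinear maps on a subspace\<close>

definition bilinear_onQ :: "'a::rat_vector set \<Rightarrow> ('a \<Rightarrow> 'a \<Rightarrow> 'b::rat_vector) \<Rightarrow> bool" where
  "bilinear_onQ S g \<longleftrightarrow>
     (\<forall>a\<in>S. linear_onQ S (\<lambda>b. g a b)) \<and> (\<forall>b\<in>S. linear_onQ S (\<lambda>a. g a b))"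

definition trilinear_onQ :: "'a::rat_vector set \<Rightarrow> ('a \<Rightarrow> 'a \<Rightarrow> 'a \<Rightarrow> 'b::rat_vector) \<Rightarrow> bool" where
  "trilinear_onQ S g \<longleftrightarrow>
     (\<forall>a\<in>S. bilinear_onQ S (\<lambda>b c. g a b c)) \<and> (\<forall>b\<in>S. \<forall>c\<in>S. linear_onQ S (\<lambda>a. g a b c))"

lemma bilinear_onQI:
  assumes "\<And>a. a \<in> S \<Longrightarrow> linear_onQ S (\<lambda>b. g a b)" "\<And>b. b \<in> S \<Longrightarrow> linear_onQ S (\<lambda>a. g a b)"
  shows "bilinear_onQ S g"
  using assms by (simp add: bilinear_onQ_def)

lemma bilinear_onQ_left: "bilinear_onQ S g \<Longrightarrow> b \<in> S \<Longrightarrow> linear_onQ S (\<lambda>a. g a b)"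
  and bilinear_onQ_right: "bilinear_onQ S g \<Longrightarrow> a \<in> S \<Longrightarrow> linear_onQ S (\<lambda>b. g a b)"
  by (auto simp: bilinear_onQ_def)

lemma bilinear_onQ_compose:
  assumes "bilinear_onQ S g" "linear_onQ T L" "\<And>a b. a \<in> S \<Longrightarrow> b \<in> S \<Longrightarrow> g a b \<in> T"
  shows "bilinear_onQ S (\<lambda>a b. L (g a b))"
  using assms by (auto intro!: bilinear_onQI linear_onQ_compose[OF assms(2)] simp: bilinear_onQ_def)

lemma bilinear_onQ_args:
  assumes "bilinear_onQ T g" "linear_onQ S f" "linear_onQ S f'" "f ` S \<subseteq> T" "f' ` S \<subseteq> T"
  shows "bilinear_onQ S (\<lambda>a b. g (f a) (f' b))"
  using assms(4,5)
  by (intro bilinear_onQI linear_onQ_compose[OF bilinear_onQ_left[OF assms(1)] assms(2)]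
      linear_onQ_compose[OF bilinear_onQ_right[OF assms(1)] assms(3)]) auto

lemma bilinear_onQ_subset: "bilinear_onQ T g \<Longrightarrow> S \<subseteq> T \<Longrightarrow> bilinear_onQ S g"
  unfolding bilinear_onQ_def by (meson linear_onQ_subset subsetD)

lemma bilinear_onQ_mult:
  assumes "linear_onQ S f" "linear_onQ S g"
  shows "bilinear_onQ S (\<lambda>a b. f a * g b :: rat)"
  by (intro bilinear_onQI linear_onQ_times_right linear_onQ_times_left assms)

lemma bilinear_onQ_eq_on_span:
  assumes "bilinear_onQ (qvs.span B) f" "bilinear_onQ (qvs.span B) g"
    and "\<And>x y. x \<in> B \<Longrightarrow> y \<in> B \<Longrightarrow> f x y = g x y"
    and "x \<in> qvs.span B" "y \<in> qvs.span B"
  shows "f x y = g x y"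
proof -
  have "f x y = g x y" if "x \<in> B" for x
    using linear_onQ_eq_on_span[of B "f x" "g x" y] assms that
    by (simp add: bilinear_onQ_def qvs.span_base)
  then show ?thesis
    using linear_onQ_eq_on_span[of B "\<lambda>x. f x y" "\<lambda>x. g x y" x] assms
    by (simp add: bilinear_onQ_def)
qed

section \<open>Tensors\<close>

lemma tens_add: "tens (xs @ (a + b) # ys) = tens (xs @ a # ys) + tens (xs @ b # ys)"
proof transfer
  fix xs :: "'a list" and a b ys
  have "Poly_Mapping.single (xs @ (a + b) # ys) 1 - Poly_Mapping.single (xs @ a # ys) 1
      - Poly_Mapping.single (xs @ b # ys) 1 \<in> qvs.span (tensor_relators :: ('a list \<Rightarrow>\<^sub>0 rat) set)"
    by (intro qvs.span_base tensor_relators.intros)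
  then show "tensor_eq (Poly_Mapping.single (xs @ (a + b) # ys) 1)
      (Poly_Mapping.single (xs @ a # ys) 1 + Poly_Mapping.single (xs @ b # ys) 1)"
    by (simp add: tensor_eq_def diff_diff_eq)
qed

lemma tens_scale: "tens (xs @ (c *\<^sub>Q a) # ys) = c *\<^sub>Q tens (xs @ a # ys)"
  by transfer (simp add: tensor_eq_def qvs.span_base tensor_relators.intros)

lemma linear_onQ_tens: "linear_onQ S (\<lambda>a. tens (xs @ a # ys))"
  by (simp add: linear_onQ_def tens_add tens_scale)

lemma bilinear_onQ_tens: "bilinear_onQ S (\<lambda>a b. tens [a, b])"
  using linear_onQ_tens[of S "[]"] linear_onQ_tens[of S "[_]" "[]"] by (simp add: bilinear_onQ_def)

lemma tensor_lift:
  assumes "qvs.subspace S" "multilinear_onQ S g"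
  shows linear_onQ_tensor_lift: "linear_onQ UNIV (tensor_lift S g)"
    and tensor_lift_tens: "set xs \<subseteq> S \<Longrightarrow> tensor_lift S g (tens xs) = g xs"
  using someI_ex[OF tensor_lift_exists[OF assms]]
  unfolding tensor_lift_def linear_iff_linear_onQ by blast+

text \<open>The word \<open>xs @ a # ys\<close> has length two exactly when one letter surrounds
  \<open>a\<close>, on the right or on the left. These two cases are the two linearities of
  \<open>g\<close>; in all others the function is constantly 0.\<close>

lemma multilinear_onQ_case2:
  assumes "bilinear_onQ S g"
  shows "multilinear_onQ S (\<lambda>xs. case xs of [a, b] \<Rightarrow> g a b | _ \<Rightarrow> 0)"
  unfolding multilinear_onQ_def
proof (intro allI impI)
  fix xs ys assume xs: "set xs \<subseteq> S" "set ys \<subseteq> S"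
  consider y where "xs = []" "ys = [y]" | x where "xs = [x]" "ys = []"
    | "length xs + length ys \<noteq> 1"
    by (cases xs; cases ys) (auto simp: length_Suc_conv)
  then show "linear_onQ S (\<lambda>a. case xs @ a # ys of [a, b] \<Rightarrow> g a b | _ \<Rightarrow> 0)"
  proof cases
    case 3
    then have "(case xs @ a # ys of [a, b] \<Rightarrow> g a b | _ \<Rightarrow> 0) = 0" for a
      by (auto split: list.split simp: append_eq_Cons_conv)
    then show ?thesis by (simp add: linear_onQ_const_zero)
  qed (use assms xs in \<open>auto simp: bilinear_onQ_def\<close>)
qed

lemma tensor_lift2:
  assumes "qvs.subspace S" "bilinear_onQ S g"
  shows linear_onQ_tensor_lift2: "linear_onQ UNIV (tensor_lift2 S g)"
    and tensor_lift2_tens: "a \<in> S \<Longrightarrow> b \<in> S \<Longrightarrow> tensor_lift2 S g (tens [a, b]) = g a b"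
  using tensor_lift[OF assms(1) multilinear_onQ_case2[OF assms(2)]]
  unfolding tensor_lift2_def by auto

text \<open>The predicates under the two \<open>SOME\<close> operators coincide as soon as
  \<open>g\<close> and \<open>g'\<close> agree on \<open>S\<close>, so the chosen maps are equal as
  functions on the whole type.\<close>

lemma tensor_lift2_cong:
  assumes "\<And>a b. a \<in> S \<Longrightarrow> b \<in> S \<Longrightarrow> g a b = g' a b"
  shows "tensor_lift2 S g = tensor_lift2 S g'"
proof -
  have "(\<forall>xs. set xs \<subseteq> S \<longrightarrow> F (tens xs) = (case xs of [a, b] \<Rightarrow> g a b | _ \<Rightarrow> 0)) \<longleftrightarrow>
      (\<forall>xs. set xs \<subseteq> S \<longrightarrow> F (tens xs) = (case xs of [a, b] \<Rightarrow> g' a b | _ \<Rightarrow> 0))" for F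
    using assms by (intro all_cong1 imp_cong refl) (auto split: list.splits)
  then show ?thesis
    unfolding tensor_lift2_def tensor_lift_def by simp
qed

lemma tensor_lift2_sum_list:
  assumes "qvs.subspace S" "bilinear_onQ S g" "\<And>a b. (a, b) \<in> set xs \<Longrightarrow> a \<in> S \<and> b \<in> S"
  shows "tensor_lift2 S g (\<Sum>(a, b)\<leftarrow>xs. tens [a, b]) = (\<Sum>(a, b)\<leftarrow>xs. g a b)"
proof -
  have "tensor_lift2 S g (\<Sum>(a, b)\<leftarrow>xs. tens [a, b]) = (\<Sum>(a, b)\<leftarrow>xs. tensor_lift2 S g (tens [a, b]))"
    by (rule linear_onQ_sum_list_pairs[OF linear_onQ_tensor_lift2[OF assms(1,2)]]) auto
  also have "\<dots> = (\<Sum>(a, b)\<leftarrow>xs. g a b)"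
    using assms(3) tensor_lift2_tens[OF assms(1,2)]
    by (intro arg_cong[where f = sum_list] map_cong) auto
  finally show ?thesis .
qed

text \<open>Scalars are absorbed into the left factor, so an element of the span becomes a plain
  list of pairs, the form in which coproducts are computed with below. The relation \<open>R\<close>
  is abstract in order to serve both tensor squares of subspaces and sums of bihomogeneous
  pieces.\<close>

lemma span_tens_sum_list:
  assumes "t \<in> qvs.span {tens [a, b] | a b. R a b}" "\<And>c a b. R a b \<Longrightarrow> R (c *\<^sub>Q a) b"
  shows "\<exists>xs. (\<forall>a b. (a, b) \<in> set xs \<longrightarrow> R a b) \<and> t = (\<Sum>(a, b)\<leftarrow>xs. tens [a, b])"
  using assms(1)
proof (induction rule: qvs.span_induct_alt)
  case base
  show ?case by (intro exI[of _ "[]"]) simp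
next
  case (step c x y)
  then obtain a b xs where *: "x = tens [a, b]" "R a b" "\<And>a b. (a, b) \<in> set xs \<Longrightarrow> R a b"
      "y = (\<Sum>(a, b)\<leftarrow>xs. tens [a, b])"
    by blast
  then have "c *\<^sub>Q x + y = (\<Sum>(a, b)\<leftarrow>(c *\<^sub>Q a, b) # xs. tens [a, b])"
    using tens_scale[of "[]" c a "[b]"] by simp
  then show ?case
    using * assms(2) by (intro exI[of _ "(c *\<^sub>Q a, b) # xs"]) auto
qed

lemma tensor_square_sum_list:
  assumes "qvs.subspace S" "t \<in> tensor_square S"
  shows "\<exists>xs. (\<forall>a b. (a, b) \<in> set xs \<longrightarrow> a \<in> S \<and> b \<in> S) \<and> t = (\<Sum>(a, b)\<leftarrow>xs. tens [a, b])"
  using assms(2) unfolding tensor_square_def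
  by (rule span_tens_sum_list) (use assms(1) in \<open>simp add: qvs.subspace_scale\<close>)

lemma tensor_square_mono: "S \<subseteq> T \<Longrightarrow> tensor_square S \<subseteq> tensor_square T"
  unfolding tensor_square_def by (rule qvs.span_mono) blast

lemma tens_in_tensor_square: "a \<in> S \<Longrightarrow> b \<in> S \<Longrightarrow> tens [a, b] \<in> tensor_square S"
  unfolding tensor_square_def by (rule qvs.span_base) blast

lemma subspace_tensor_square: "qvs.subspace (tensor_square S)"
  by (simp add: tensor_square_def)

section \<open>Graded spaces\<close>

lemma subspace_hspace: "qvs.subspace (hspace H)"
  by (simp add: hspace_def)

lemma grade_in_hspace: "h \<in> grade H n \<Longrightarrow> h \<in> hspace H"
  unfolding hspace_def by (rule qvs.span_base) blast

lemma linear_onQ_eq_hspace: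
  assumes "linear_onQ (hspace H) f" "linear_onQ (hspace H) g"
    and "\<And>n x. x \<in> grade H n \<Longrightarrow> f x = g x" and "h \<in> hspace H"
  shows "f h = g h"
  using linear_onQ_eq_on_span[of "\<Union>n. grade H n" f g h] assms by (auto simp: hspace_def)

lemma linear_onQ_image_hspace:
  assumes "linear_onQ (hspace H) f" "qvs.subspace T"
    and "\<And>n x. x \<in> grade H n \<Longrightarrow> f x \<in> T" and "h \<in> hspace H"
  shows "f h \<in> T"
  using linear_onQ_image_span[of "\<Union>n. grade H n" f T h] assms by (auto simp: hspace_def)

lemma sum_superset:
  assumes "finite A" "{n. f n \<noteq> 0} \<subseteq> A"
  shows "(\<Sum>n | f n \<noteq> 0. f n) = (\<Sum>n\<in>A. f n)"
  using assms by (intro sum.mono_neutral_left) auto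

section \<open>Gradings recognised by a family of projections\<close>

context
  fixes H :: "('h::rat_vector, 'l::finite, 'm) gcoalg_scheme" and \<pi> :: "nat ^ 'l \<Rightarrow> 'h \<Rightarrow> 'h"
  assumes sub: "\<And>n. qvs.subspace (grade H n)"
    and lin: "\<And>n. linear_onQ (hspace H) (\<pi> n)"
    and proj_same: "\<And>n h. h \<in> grade H n \<Longrightarrow> \<pi> n h = h"
    and proj_other: "\<And>m n h. h \<in> grade H m \<Longrightarrow> m \<noteq> n \<Longrightarrow> \<pi> n h = 0"
begin

lemma is_decomp_projections:
  assumes "h \<in> hspace H"
  shows "is_decomp H h (\<lambda>n. \<pi> n h)"
proof -
  have "h \<in> hspace H \<and> is_decomp H h (\<lambda>n. \<pi> n h)"
    using assms unfolding hspace_def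
  proof (induction rule: qvs.span_induct_alt)
    case base
    show ?case
      using linear_onQ_zero[OF lin subspace_hspace]
      by (simp add: is_decomp_def qvs.subspace_0[OF sub] qvs.span_zero)
  next
    case (step c x y)
    then obtain m where x: "x \<in> grade H m" by blast
    have y: "y \<in> hspace H" and D: "is_decomp H y (\<lambda>n. \<pi> n y)"
      using step by (auto simp: hspace_def)
    have x': "x \<in> hspace H" "c *\<^sub>Q x \<in> hspace H"
      using x by (auto intro: grade_in_hspace qvs.subspace_scale[OF subspace_hspace])
    have eq: "\<pi> n (c *\<^sub>Q x + y) = (if n = m then c *\<^sub>Q x else 0) + \<pi> n y" for n
      using x proj_same[OF x] proj_other[OF x]
      by (simp add: linear_onQ_add[OF lin x'(2) y] linear_onQ_scale[OF lin x'(1)])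
    let ?A = "insert m {n. \<pi> n y \<noteq> 0}"
    have fin: "finite ?A" and sub': "{n. \<pi> n (c *\<^sub>Q x + y) \<noteq> 0} \<subseteq> ?A"
      using D by (auto simp: is_decomp_def eq)
    have "(\<Sum>n | \<pi> n (c *\<^sub>Q x + y) \<noteq> 0. \<pi> n (c *\<^sub>Q x + y)) = (\<Sum>n\<in>?A. \<pi> n (c *\<^sub>Q x + y))"
      by (rule sum_superset[OF fin sub'])
    also have "\<dots> = c *\<^sub>Q x + (\<Sum>n\<in>?A. \<pi> n y)"
      unfolding eq sum.distrib using fin by (simp add: sum.delta)
    also have "(\<Sum>n\<in>?A. \<pi> n y) = (\<Sum>n | \<pi> n y \<noteq> 0. \<pi> n y)"
      by (rule sum_superset[symmetric, OF fin]) auto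
    also have "\<dots> = y" using D by (simp add: is_decomp_def)
    finally have "is_decomp H (c *\<^sub>Q x + y) (\<lambda>n. \<pi> n (c *\<^sub>Q x + y))"
      unfolding is_decomp_def using finite_subset[OF sub' fin] D x
      by (simp add: eq is_decomp_def qvs.subspace_add[OF sub] qvs.subspace_scale[OF sub])
    then show ?case
      using x'(2) y qvs.subspace_add[OF subspace_hspace] by (auto simp: hspace_def)
  qed
  then show ?thesis ..
qed

lemma is_decomp_projections_unique:
  assumes "is_decomp H h f"
  shows "f n = \<pi> n h"
proof -
  \<comment> \<open>Adding \<open>n\<close> to the support lets the delta sum below return
    \<open>f n\<close> without a case distinction on \<open>f n = 0\<close>.\<close>
  let ?A = "insert n {n. f n \<noteq> 0}"
  have f: "f m \<in> grade H m" for m using assms by (simp add: is_decomp_def)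
  have fin: "finite ?A" using assms by (simp add: is_decomp_def)
  have "h = (\<Sum>m | f m \<noteq> 0. f m)" using assms by (simp add: is_decomp_def)
  also have "\<dots> = (\<Sum>m\<in>?A. f m)" by (rule sum_superset[OF fin]) auto
  finally have "\<pi> n h = (\<Sum>m\<in>?A. \<pi> n (f m))"
    using linear_onQ_sum[OF lin subspace_hspace, of ?A f] grade_in_hspace[OF f] by blast
  also have "\<dots> = (\<Sum>m\<in>?A. if m = n then f m else 0)"
    using f by (intro sum.cong) (auto simp: proj_same proj_other[OF f])
  also have "\<dots> = f n" using fin by (simp add: sum.delta)
  finally show ?thesis by simp
qed

text \<open>The projections both produce a decomposition and read off the terms of any other one,
  which is existence and uniqueness. The criterion is applied to \<open>QSym\<close>, and to graded
  subcoalgebras with the components of the surrounding space.\<close>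

lemma graded_space_projections: "graded_space H"
  unfolding graded_space_def
  using sub is_decomp_projections is_decomp_projections_unique
  by (metis (no_types, lifting) ext)

end

locale graded_vs =
  fixes H :: "('h::rat_vector, 'l::finite, 'm) gcoalg_scheme"
  assumes graded_space: "graded_space H"
begin

lemma subspace_grade: "qvs.subspace (grade H n)"
  using graded_space by (simp add: graded_space_def)

lemma is_decomp_component:
  assumes "h \<in> hspace H"
  shows "is_decomp H h (\<lambda>n. component H n h)"
proof -
  have "\<exists>!f. is_decomp H h f" using graded_space assms by (simp add: graded_space_def)
  then have "is_decomp H h (THE f. is_decomp H h f)" by (rule theI')
  then show ?thesis by (simp add: component_def)
qed

lemma component_unique:
  assumes "h \<in> hspace H" "is_decomp H h f"
  shows "component H n h = f n"
proof -
  have "\<exists>!f. is_decomp H h f" using graded_space assms by (simp add: graded_space_def)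
  then have "(THE f. is_decomp H h f) = f" by (rule the1_equality) (rule assms(2))
  then show ?thesis by (simp add: component_def)
qed

lemma component_in_grade: "h \<in> hspace H \<Longrightarrow> component H n h \<in> grade H n"
  using is_decomp_component by (simp add: is_decomp_def)

lemma finite_components: "h \<in> hspace H \<Longrightarrow> finite {n. component H n h \<noteq> 0}"
  using is_decomp_component by (simp add: is_decomp_def)

lemma sum_components:
  assumes "h \<in> hspace H" "finite A" "{n. component H n h \<noteq> 0} \<subseteq> A"
  shows "(\<Sum>n\<in>A. component H n h) = h"
  using is_decomp_component[OF assms(1)] sum_superset[OF assms(2,3)] by (simp add: is_decomp_def)

lemma component_grade:
  assumes "h \<in> grade H n"
  shows "component H m h = (if m = n then h else 0)"
proof -
  have "{m. (if m = n then h else 0) \<noteq> 0} = (if h = 0 then {} else {n})" by auto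
  then have "is_decomp H h (\<lambda>m. if m = n then h else 0)"
    using assms by (simp add: is_decomp_def qvs.subspace_0[OF subspace_grade])
  then show ?thesis
    using component_unique[OF grade_in_hspace[OF assms]] by blast
qed

lemma linear_component: "linear_onQ (hspace H) (component H n)"
proof (rule linear_onQI)
  fix x y assume xy: "x \<in> hspace H" "y \<in> hspace H"
  let ?f = "\<lambda>n. component H n x + component H n y"
  let ?A = "{n. component H n x \<noteq> 0} \<union> {n. component H n y \<noteq> 0}"
  have A: "finite ?A" using xy by (simp add: finite_components)
  have "(\<Sum>n | ?f n \<noteq> 0. ?f n) = (\<Sum>n\<in>?A. ?f n)"
    by (rule sum_superset[OF A]) auto
  also have "\<dots> = x + y"
    by (simp only: sum.distrib) (use xy A in \<open>simp add: sum_components\<close>)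
  finally have "is_decomp H (x + y) ?f"
    using xy finite_subset[OF _ A, of "{n. ?f n \<noteq> 0}"] unfolding is_decomp_def
    by (force simp: component_in_grade qvs.subspace_add[OF subspace_grade])
  then show "component H n (x + y) = component H n x + component H n y"
    by (rule component_unique[rotated]) (simp add: xy qvs.subspace_add[OF subspace_hspace])
next
  fix c x assume x: "x \<in> hspace H"
  let ?f = "\<lambda>n. c *\<^sub>Q component H n x"
  let ?A = "{n. component H n x \<noteq> 0}"
  have A: "finite ?A" using x by (simp add: finite_components)
  have "(\<Sum>n | ?f n \<noteq> 0. ?f n) = (\<Sum>n\<in>?A. ?f n)"
    by (rule sum_superset[OF A]) auto
  also have "\<dots> = c *\<^sub>Q x"
    unfolding qvs.scale_sum_right[symmetric] using x A by (simp add: sum_components)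
  finally have "is_decomp H (c *\<^sub>Q x) ?f"
    using x A unfolding is_decomp_def
    by (auto simp: component_in_grade qvs.subspace_scale[OF subspace_grade] elim!: finite_subset[rotated])
  then show "component H n (c *\<^sub>Q x) = c *\<^sub>Q component H n x"
    by (rule component_unique[rotated]) (simp add: x qvs.subspace_scale[OF subspace_hspace])
qed

lemma component_in_hspace: "h \<in> hspace H \<Longrightarrow> component H n h \<in> hspace H"
  by (rule grade_in_hspace[OF component_in_grade])

lemma linear_on_component:
  "linear_onQ (hspace H) f \<Longrightarrow> linear_onQ (hspace H) (\<lambda>h. f (component H n h))"
  by (rule linear_onQ_compose[OF _ linear_component]) (auto simp: component_in_hspace)

lemma sum_components_grade:
  assumes "f n 0 = 0" "h \<in> grade H n"
  shows "(\<Sum>m | component H m h \<noteq> 0. f m (component H m h)) = f n h"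
proof -
  \<comment> \<open>For \<open>h = 0\<close> the index set is empty instead of \<open>{n}\<close>;
    the assumption \<open>f n 0 = 0\<close> makes the formula survive this case.\<close>
  have "{m. (if m = n then h else 0) \<noteq> 0} = (if h = 0 then {} else {n})" by auto
  then show ?thesis
    using assms(1) by (simp add: component_grade[OF assms(2)])
qed

text \<open>The index set of the sum depends on the argument. Each \<open>f n\<close> vanishes at 0,
  so all sums involved can be extended to one common finite set of degrees, where linearity is
  termwise.\<close>

lemma linear_sum_components:
  assumes "\<And>n. linear_onQ (hspace H) (f n)"
  shows "linear_onQ (hspace H) (\<lambda>h. \<Sum>n | component H n h \<noteq> 0. f n (component H n h))"
    (is "linear_onQ _ ?F")
proof -
  let ?f = "\<lambda>n h. f n (component H n h)"
  have f: "linear_onQ (hspace H) (?f n)" for n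
    by (intro linear_on_component assms)
  have F: "?F h = (\<Sum>n\<in>A. ?f n h)"
    if "finite A" "{n. component H n h \<noteq> 0} \<subseteq> A" for A h
    using that linear_onQ_zero[OF assms subspace_hspace]
    by (intro sum.mono_neutral_left) auto
  show ?thesis
  proof (rule linear_onQI)
    fix x y assume xy: "x \<in> hspace H" "y \<in> hspace H"
    let ?A = "{n. component H n x \<noteq> 0} \<union> {n. component H n y \<noteq> 0} \<union> {n. component H n (x + y) \<noteq> 0}"
    have A: "finite ?A"
      using xy by (simp add: finite_components qvs.subspace_add[OF subspace_hspace])
    show "?F (x + y) = ?F x + ?F y"
      using linear_onQ_add[OF f xy]
      by (subst (1 2 3) F[OF A]) (auto simp: sum.distrib)
  next
    fix c x assume x: "x \<in> hspace H"
    let ?A = "{n. component H n x \<noteq> 0} \<union> {n. component H n (c *\<^sub>Q x) \<noteq> 0}"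
    have A: "finite ?A"
      using x by (simp add: finite_components qvs.subspace_scale[OF subspace_hspace])
    show "?F (c *\<^sub>Q x) = c *\<^sub>Q ?F x"
      using linear_onQ_scale[OF f x]
      by (subst (1 2) F[OF A]) (auto simp: qvs.scale_sum_right)
  qed
qed

lemma bar_grade:
  assumes "linear_onQ (hspace H) \<phi>" "h \<in> grade H n"
  shows "bar H \<phi> h = (- 1) ^ weight n * \<phi> h"
  unfolding bar_def using linear_onQ_zero[OF assms(1) subspace_hspace] assms(2)
  by (subst sum_components_grade[of "\<lambda>n h. (- 1) ^ weight n * \<phi> h"]) auto

lemma linear_bar:
  assumes "linear_onQ (hspace H) \<phi>"
  shows "linear_onQ (hspace H) (bar H \<phi>)"
  unfolding bar_def[abs_def]
  by (rule linear_sum_components) (intro linear_onQ_times_right assms)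

end

section \<open>Coalgebras and convolution\<close>

text \<open>The Sweedler sum of g(h_1, h_2) over the coproduct of \<open>h\<close>. Convolution, the
  counit laws, coassociativity and the bialgebra axiom are all instances or nestings of it.\<close>

definition cop_lift ::
  "('h::rat_vector, 'l::finite, 'm) gcoalg_scheme \<Rightarrow> ('h \<Rightarrow> 'h \<Rightarrow> 'b::rat_vector) \<Rightarrow> 'h \<Rightarrow> 'b" where
  "cop_lift H g h = tensor_lift2 (hspace H) g (cop H h)"

lemma conv_eq_cop_lift: "conv H \<phi> \<psi> h = cop_lift H (\<lambda>a b. \<phi> a * \<psi> b) h"
  by (simp add: conv_def cop_lift_def)

lemma cop_lift_sum_list:
  assumes "bilinear_onQ (hspace H) g" "cop H h = (\<Sum>(a, b)\<leftarrow>xs. tens [a, b])"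
    and "\<forall>(a, b)\<in>set xs. a \<in> hspace H \<and> b \<in> hspace H"
  shows "cop_lift H g h = (\<Sum>(a, b)\<leftarrow>xs. g a b)"
  unfolding cop_lift_def assms(2)
  by (rule tensor_lift2_sum_list[OF subspace_hspace assms(1)]) (use assms(3) in auto)

lemma cop_lift_cong:
  assumes "\<And>a b. a \<in> hspace H \<Longrightarrow> b \<in> hspace H \<Longrightarrow> g a b = g' a b"
  shows "cop_lift H g h = cop_lift H g' h"
  unfolding cop_lift_def by (simp add: tensor_lift2_cong[OF assms])

lemma conv_cong:
  assumes "\<And>a. a \<in> hspace H \<Longrightarrow> \<phi> a = \<phi>' a" "\<And>a. a \<in> hspace H \<Longrightarrow> \<psi> a = \<psi>' a"
  shows "conv H \<phi> \<psi> h = conv H \<phi>' \<psi>' h"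
  unfolding conv_eq_cop_lift by (rule cop_lift_cong) (simp add: assms)

lemma sum_list_cong_pairs:
  assumes "\<And>a b. (a, b) \<in> set xs \<Longrightarrow> f a b = g a b"
  shows "(\<Sum>(a, b)\<leftarrow>xs. f a b) = (\<Sum>(a, b)\<leftarrow>xs. g a b)"
  using assms by (intro arg_cong[where f = sum_list] map_cong) auto

lemma linear_onQ_list_sum_pairs:
  "(\<And>a b. (a, b) \<in> set A \<Longrightarrow> linear_onQ S (f a b)) \<Longrightarrow> linear_onQ S (\<lambda>x. \<Sum>(a, b)\<leftarrow>A. f a b x)"
  using linear_onQ_list_sum[of A S "\<lambda>p. f (fst p) (snd p)"] by (auto simp: case_prod_beta')

lemma multilinear_onQ_case3:
  assumes "trilinear_onQ S g"
  shows "multilinear_onQ S (\<lambda>xs. case xs of [a, b, c] \<Rightarrow> g a b c | _ \<Rightarrow> 0)"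
  unfolding multilinear_onQ_def
proof (intro allI impI)
  fix xs ys assume xs: "set xs \<subseteq> S" "set ys \<subseteq> S"
  consider y z where "xs = []" "ys = [y, z]" | x y where "xs = [x]" "ys = [y]"
    | x y where "xs = [x, y]" "ys = []" | "length xs + length ys \<noteq> 2"
    by (cases xs; cases ys) (auto simp: length_Suc_conv numeral_2_eq_2)
  then show "linear_onQ S (\<lambda>a. case xs @ a # ys of [a, b, c] \<Rightarrow> g a b c | _ \<Rightarrow> 0)"
  proof cases
    case 4
    then have "(case xs @ a # ys of [a, b, c] \<Rightarrow> g a b c | _ \<Rightarrow> 0) = 0" for a
      by (auto split: list.split simp: append_eq_Cons_conv)
    then show ?thesis by (simp add: linear_onQ_const_zero)
  qed (use assms xs in \<open>auto simp: bilinear_onQ_def trilinear_onQ_def\<close>)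
qed

lemma trilinear_onQ_tens: "trilinear_onQ S (\<lambda>a b c. tens [a, b, c])"
  using linear_onQ_tens[of S "[]"] linear_onQ_tens[of S "[_]"] linear_onQ_tens[of S "[_, _]" "[]"]
  by (simp add: bilinear_onQ_def trilinear_onQ_def)

lemma trilinear_onQI:
  assumes "\<And>b c. b \<in> S \<Longrightarrow> c \<in> S \<Longrightarrow> linear_onQ S (\<lambda>a. g a b c)"
    and "\<And>a c. a \<in> S \<Longrightarrow> c \<in> S \<Longrightarrow> linear_onQ S (\<lambda>b. g a b c)"
    and "\<And>a b. a \<in> S \<Longrightarrow> b \<in> S \<Longrightarrow> linear_onQ S (\<lambda>c. g a b c)"
  shows "trilinear_onQ S g"
  using assms by (auto simp: trilinear_onQ_def bilinear_onQ_def)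

lemma trilinear_onQD:
  assumes "trilinear_onQ S g"
  shows "b \<in> S \<Longrightarrow> c \<in> S \<Longrightarrow> linear_onQ S (\<lambda>a. g a b c)"
    and "a \<in> S \<Longrightarrow> c \<in> S \<Longrightarrow> linear_onQ S (\<lambda>b. g a b c)"
    and "a \<in> S \<Longrightarrow> b \<in> S \<Longrightarrow> linear_onQ S (\<lambda>c. g a b c)"
    and "a \<in> S \<Longrightarrow> bilinear_onQ S (\<lambda>b c. g a b c)"
    and "c \<in> S \<Longrightarrow> bilinear_onQ S (\<lambda>a b. g a b c)"
  using assms by (auto simp: trilinear_onQ_def bilinear_onQ_def)

text \<open>Sweedler sums already make sense for a linear coproduct into the tensor square.
  Separating this layer allows their use for \<open>QSym\<close> while its coalgebra axioms are
  still being proved.\<close>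

locale linear_coproduct =
  fixes H :: "('h::rat_vector, 'l::finite, 'm) gcoalg_scheme"
  assumes linear_cop: "linear_onQ (hspace H) (cop H)"
    and cop_in_tensor_square: "h \<in> hspace H \<Longrightarrow> cop H h \<in> tensor_square (hspace H)"
begin

lemma cop_sum_list:
  assumes "h \<in> hspace H"
  obtains xs where "cop H h = (\<Sum>(a, b)\<leftarrow>xs. tens [a, b])"
    "\<forall>(a, b)\<in>set xs. a \<in> hspace H \<and> b \<in> hspace H"
  using tensor_square_sum_list[OF subspace_hspace cop_in_tensor_square[OF assms]] by blast

lemma linear_cop_lift:
  assumes "bilinear_onQ (hspace H) g"
  shows "linear_onQ (hspace H) (cop_lift H g)"
  unfolding cop_lift_def
  by (rule linear_onQ_compose[OF linear_onQ_tensor_lift2[OF subspace_hspace assms] linear_cop]) simp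

text \<open>The element \<open>h\<close> is fixed while \<open>x\<close> varies, so one list of pure
  tensors representing its coproduct serves for all parameters, and the sum is linear term by
  term.\<close>

lemma linear_cop_lift_param:
  assumes "qvs.subspace X" "\<And>x. x \<in> X \<Longrightarrow> bilinear_onQ (hspace H) (g x)"
    and "\<And>a b. a \<in> hspace H \<Longrightarrow> b \<in> hspace H \<Longrightarrow> linear_onQ X (\<lambda>x. g x a b)"
    and "h \<in> hspace H"
  shows "linear_onQ X (\<lambda>x. cop_lift H (g x) h)"
proof -
  obtain xs where xs: "cop H h = (\<Sum>(a, b)\<leftarrow>xs. tens [a, b])"
    "\<forall>(a, b)\<in>set xs. a \<in> hspace H \<and> b \<in> hspace H"
    by (rule cop_sum_list[OF assms(4)])
  have "linear_onQ X (\<lambda>x. \<Sum>(a, b)\<leftarrow>xs. g x a b)"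
    by (rule linear_onQ_list_sum_pairs) (use xs(2) assms(3) in blast)
  then show ?thesis
    by (rule linear_onQ_cong[OF _ assms(1)]) (rule cop_lift_sum_list[OF assms(2) xs])
qed

lemma cop_lift_compose:
  assumes "bilinear_onQ (hspace H) g" "linear_onQ T L" "qvs.subspace T"
    and "\<And>a b. a \<in> hspace H \<Longrightarrow> b \<in> hspace H \<Longrightarrow> g a b \<in> T" "h \<in> hspace H"
  shows "L (cop_lift H g h) = cop_lift H (\<lambda>a b. L (g a b)) h"
proof -
  obtain xs where xs: "cop H h = (\<Sum>(a, b)\<leftarrow>xs. tens [a, b])"
    "\<forall>(a, b)\<in>set xs. a \<in> hspace H \<and> b \<in> hspace H"
    by (rule cop_sum_list[OF assms(5)])
  have "L (cop_lift H g h) = L (\<Sum>(a, b)\<leftarrow>xs. g a b)"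
    by (simp only: cop_lift_sum_list[OF assms(1) xs])
  also have "\<dots> = (\<Sum>(a, b)\<leftarrow>xs. L (g a b))"
    by (rule linear_onQ_sum_list_pairs[OF assms(2,3)]) (use xs(2) assms(4) in blast)
  also have "\<dots> = cop_lift H (\<lambda>a b. L (g a b)) h"
    by (rule cop_lift_sum_list[symmetric, OF bilinear_onQ_compose[OF assms(1,2,4)] xs])
  finally show ?thesis .
qed

lemma cop_lift_in:
  assumes "bilinear_onQ (hspace H) g" "qvs.subspace T" "h \<in> hspace H"
    and "\<And>a b. a \<in> hspace H \<Longrightarrow> b \<in> hspace H \<Longrightarrow> g a b \<in> T"
  shows "cop_lift H g h \<in> T"
proof -
  obtain xs where xs: "cop H h = (\<Sum>(a, b)\<leftarrow>xs. tens [a, b])"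
    "\<forall>(a, b)\<in>set xs. a \<in> hspace H \<and> b \<in> hspace H"
    by (rule cop_sum_list[OF assms(3)])
  show ?thesis
    unfolding cop_lift_sum_list[OF assms(1) xs]
    by (rule subspace_sum_list[OF assms(2)]) (use xs(2) assms(4) in auto)
qed

lemma bilinear_cop_lift_left:
  assumes "trilinear_onQ (hspace H) G"
  shows "bilinear_onQ (hspace H) (\<lambda>a b. cop_lift H (\<lambda>c d. G c d b) a)"
  using assms
  by (auto intro!: bilinear_onQI linear_cop_lift linear_cop_lift_param subspace_hspace
      intro: trilinear_onQD)

lemma bilinear_cop_lift_right:
  assumes "trilinear_onQ (hspace H) G"
  shows "bilinear_onQ (hspace H) (\<lambda>a b. cop_lift H (\<lambda>c d. G a c d) b)"
  using assms
  by (auto intro!: bilinear_onQI linear_cop_lift linear_cop_lift_param subspace_hspace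
      intro: trilinear_onQD)

end

locale graded_coalg =
  fixes H :: "('h::rat_vector, 'l::finite, 'm) gcoalg_scheme"
  assumes graded_coalgebra: "graded_coalgebra H"
begin

sublocale graded_vs H
  by standard (use graded_coalgebra in \<open>simp add: graded_coalgebra_def\<close>)

lemma linear_counit: "linear_onQ (hspace H) (counit H)"
  and counit_grade: "n \<noteq> 0 \<Longrightarrow> h \<in> grade H n \<Longrightarrow> counit H h = 0"
  using graded_coalgebra by (auto simp: graded_coalgebra_def)

lemma cop_grade_sum_list:
  assumes "h \<in> grade H n"
  obtains xs where "cop H h = (\<Sum>(a, b)\<leftarrow>xs. tens [a, b])"
    "\<forall>(a, b)\<in>set xs. \<exists>i j. i + j = n \<and> a \<in> grade H i \<and> b \<in> grade H j"
proof -
  have "cop H h \<in> qvs.span {tens [a, b] | a b. \<exists>i j. i + j = n \<and> a \<in> grade H i \<and> b \<in> grade H j}"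
    using graded_coalgebra assms unfolding graded_coalgebra_def by (auto elim!: rev_subsetD intro!: qvs.span_mono)
  from span_tens_sum_list[OF this]
  obtain xs where xs: "\<forall>a b. (a, b) \<in> set xs \<longrightarrow> (\<exists>i j. i + j = n \<and> a \<in> grade H i \<and> b \<in> grade H j)"
    "cop H h = (\<Sum>(a, b)\<leftarrow>xs. tens [a, b])"
    using qvs.subspace_scale[OF subspace_grade] by blast
  show thesis
    by (rule that[OF xs(2)]) (use xs(1) in auto)
qed

sublocale linear_coproduct H
proof
  show lin: "linear_onQ (hspace H) (cop H)"
    using graded_coalgebra by (auto simp: graded_coalgebra_def)
  fix h assume "h \<in> hspace H"
  then show "cop H h \<in> tensor_square (hspace H)"
  proof (rule linear_onQ_image_hspace[OF lin subspace_tensor_square, rotated])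
    fix n x assume "x \<in> grade H n"
    then obtain xs where xs: "cop H x = (\<Sum>(a, b)\<leftarrow>xs. tens [a, b])"
      "\<forall>(a, b)\<in>set xs. \<exists>i j. i + j = n \<and> a \<in> grade H i \<and> b \<in> grade H j"
      by (rule cop_grade_sum_list)
    show "cop H x \<in> tensor_square (hspace H)"
      unfolding xs(1)
      by (rule subspace_sum_list[OF subspace_tensor_square])
        (use xs(2) in \<open>auto intro!: tens_in_tensor_square intro: grade_in_hspace\<close>)
  qed
qed

lemma cop_lift_cong_grade:
  assumes "bilinear_onQ (hspace H) g" "bilinear_onQ (hspace H) g'" "h \<in> grade H n"
    and "\<And>i j a b. i + j = n \<Longrightarrow> a \<in> grade H i \<Longrightarrow> b \<in> grade H j \<Longrightarrow> g a b = g' a b"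
  shows "cop_lift H g h = cop_lift H g' h"
proof -
  obtain xs where xs: "cop H h = (\<Sum>(a, b)\<leftarrow>xs. tens [a, b])"
    "\<forall>(a, b)\<in>set xs. \<exists>i j. i + j = n \<and> a \<in> grade H i \<and> b \<in> grade H j"
    using cop_grade_sum_list[OF assms(3)] by blast
  have xs': "\<forall>(a, b)\<in>set xs. a \<in> hspace H \<and> b \<in> hspace H"
    using xs(2) grade_in_hspace by blast
  show ?thesis
    unfolding cop_lift_sum_list[OF assms(1) xs(1) xs'] cop_lift_sum_list[OF assms(2) xs(1) xs']
    by (rule sum_list_cong_pairs) (use xs(2) assms(4) in blast)
qed

lemma cop_lift_in_grade:
  assumes "bilinear_onQ (hspace H) g" "qvs.subspace T" "h \<in> grade H n"
    and "\<And>i j a b. i + j = n \<Longrightarrow> a \<in> grade H i \<Longrightarrow> b \<in> grade H j \<Longrightarrow> g a b \<in> T"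
  shows "cop_lift H g h \<in> T"
proof -
  obtain xs where xs: "cop H h = (\<Sum>(a, b)\<leftarrow>xs. tens [a, b])"
    "\<forall>(a, b)\<in>set xs. \<exists>i j. i + j = n \<and> a \<in> grade H i \<and> b \<in> grade H j"
    using cop_grade_sum_list[OF assms(3)] by blast
  have xs': "\<forall>(a, b)\<in>set xs. a \<in> hspace H \<and> b \<in> hspace H"
    using xs(2) grade_in_hspace by blast
  show ?thesis
    unfolding cop_lift_sum_list[OF assms(1) xs(1) xs']
    by (rule subspace_sum_list[OF assms(2)]) (use xs(2) assms(4) in force)
qed

text \<open>Coassociativity is an equation between sums of tensors of length three. The linear map
  \<open>L\<close> induced by \<open>G\<close> on such tensors commutes with both nested Sweedler
  sums, and applying it to that equation gives the claim for every trilinear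
  \<open>G\<close>.\<close>

lemma cop_lift_coassoc:
  assumes G: "trilinear_onQ (hspace H) G" and h: "h \<in> hspace H"
  shows "cop_lift H (\<lambda>a b. cop_lift H (\<lambda>c d. G c d b) a) h =
         cop_lift H (\<lambda>a b. cop_lift H (\<lambda>c d. G a c d) b) h"
proof -
  define L where "L = tensor_lift (hspace H) (\<lambda>xs. case xs of [a, b, c] \<Rightarrow> G a b c | _ \<Rightarrow> 0)"
  note ml = multilinear_onQ_case3[OF G]
  have L: "linear_onQ UNIV L"
    unfolding L_def by (rule linear_onQ_tensor_lift[OF subspace_hspace ml])
  have L_tens: "L (tens [a, b, c]) = G a b c"
    if "a \<in> hspace H" "b \<in> hspace H" "c \<in> hspace H" for a b c
    unfolding L_def using that by (subst tensor_lift_tens[OF subspace_hspace ml]) auto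
  note T = trilinear_onQ_tens[of "hspace H"]
  have "L (cop_lift H (\<lambda>a b. cop_lift H (\<lambda>c d. tens [c, d, b]) a) h) =
      cop_lift H (\<lambda>a b. L (cop_lift H (\<lambda>c d. tens [c, d, b]) a)) h"
    by (rule cop_lift_compose[OF bilinear_cop_lift_left[OF T] L]) (auto simp: h)
  also have "\<dots> = cop_lift H (\<lambda>a b. cop_lift H (\<lambda>c d. G c d b) a) h"
  proof (rule cop_lift_cong[symmetric])
    fix a b assume ab: "a \<in> hspace H" "b \<in> hspace H"
    have "L (cop_lift H (\<lambda>c d. tens [c, d, b]) a) = cop_lift H (\<lambda>c d. L (tens [c, d, b])) a"
      by (rule cop_lift_compose[OF trilinear_onQD(5)[OF T] L]) (auto simp: ab)
    also have "\<dots> = cop_lift H (\<lambda>c d. G c d b) a"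
      by (rule cop_lift_cong[symmetric]) (auto simp: L_tens ab)
    finally show "cop_lift H (\<lambda>c d. G c d b) a = L (cop_lift H (\<lambda>c d. tens [c, d, b]) a)" ..
  qed
  finally have 1: "L (cop_lift H (\<lambda>a b. cop_lift H (\<lambda>c d. tens [c, d, b]) a) h) =
      cop_lift H (\<lambda>a b. cop_lift H (\<lambda>c d. G c d b) a) h" .
  have "L (cop_lift H (\<lambda>a b. cop_lift H (\<lambda>c d. tens [a, c, d]) b) h) =
      cop_lift H (\<lambda>a b. L (cop_lift H (\<lambda>c d. tens [a, c, d]) b)) h"
    by (rule cop_lift_compose[OF bilinear_cop_lift_right[OF T] L]) (auto simp: h)
  also have "\<dots> = cop_lift H (\<lambda>a b. cop_lift H (\<lambda>c d. G a c d) b) h"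
  proof (rule cop_lift_cong[symmetric])
    fix a b assume ab: "a \<in> hspace H" "b \<in> hspace H"
    have "L (cop_lift H (\<lambda>c d. tens [a, c, d]) b) = cop_lift H (\<lambda>c d. L (tens [a, c, d])) b"
      by (rule cop_lift_compose[OF trilinear_onQD(4)[OF T] L]) (auto simp: ab)
    also have "\<dots> = cop_lift H (\<lambda>c d. G a c d) b"
      by (rule cop_lift_cong[symmetric]) (auto simp: L_tens ab)
    finally show "cop_lift H (\<lambda>c d. G a c d) b = L (cop_lift H (\<lambda>c d. tens [a, c, d]) b)" ..
  qed
  finally have 2: "L (cop_lift H (\<lambda>a b. cop_lift H (\<lambda>c d. tens [a, c, d]) b) h) =
      cop_lift H (\<lambda>a b. cop_lift H (\<lambda>c d. G a c d) b) h" .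
  have "cop_lift H (\<lambda>a b. cop_lift H (\<lambda>c d. tens [c, d, b]) a) h =
      cop_lift H (\<lambda>a b. cop_lift H (\<lambda>c d. tens [a, c, d]) b) h"
    using graded_coalgebra h unfolding graded_coalgebra_def cop_lift_def by simp
  then show ?thesis by (simp only: 1[symmetric] 2[symmetric])
qed

lemma cop_lift_counit_left:
  assumes "linear_onQ (hspace H) f" "h \<in> hspace H"
  shows "cop_lift H (\<lambda>a b. counit H a *\<^sub>Q f b) h = f h"
proof -
  have bl: "bilinear_onQ (hspace H) (\<lambda>a b. counit H a *\<^sub>Q b)"
    by (intro bilinear_onQI linear_onQ_scale_left linear_onQ_scaleQ linear_onQ_id linear_counit)
  have "f h = f (cop_lift H (\<lambda>a b. counit H a *\<^sub>Q b) h)"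
    using graded_coalgebra assms(2) by (simp add: graded_coalgebra_def cop_lift_def)
  also have "\<dots> = cop_lift H (\<lambda>a b. f (counit H a *\<^sub>Q b)) h"
    by (rule cop_lift_compose[OF bl assms(1) subspace_hspace _ assms(2)])
      (simp add: qvs.subspace_scale[OF subspace_hspace])
  also have "\<dots> = cop_lift H (\<lambda>a b. counit H a *\<^sub>Q f b) h"
    by (rule cop_lift_cong)
      (auto simp: qvs.subspace_scale[OF subspace_hspace] linear_onQ_scale[OF assms(1)])
  finally show ?thesis ..
qed

lemma cop_lift_counit_right:
  assumes "linear_onQ (hspace H) f" "h \<in> hspace H"
  shows "cop_lift H (\<lambda>a b. counit H b *\<^sub>Q f a) h = f h"
proof -
  have bl: "bilinear_onQ (hspace H) (\<lambda>a b. counit H b *\<^sub>Q a)"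
    by (intro bilinear_onQI linear_onQ_scale_left linear_onQ_scaleQ linear_onQ_id linear_counit)
  have "f h = f (cop_lift H (\<lambda>a b. counit H b *\<^sub>Q a) h)"
    using graded_coalgebra assms(2) by (simp add: graded_coalgebra_def cop_lift_def)
  also have "\<dots> = cop_lift H (\<lambda>a b. f (counit H b *\<^sub>Q a)) h"
    by (rule cop_lift_compose[OF bl assms(1) subspace_hspace _ assms(2)])
      (simp add: qvs.subspace_scale[OF subspace_hspace])
  also have "\<dots> = cop_lift H (\<lambda>a b. counit H b *\<^sub>Q f a) h"
    by (rule cop_lift_cong)
      (auto simp: qvs.subspace_scale[OF subspace_hspace] linear_onQ_scale[OF assms(1)])
  finally show ?thesis ..
qed

section \<open>Convolution of linear functionals\<close>

lemma linear_conv: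
  assumes "linear_onQ (hspace H) \<phi>" "linear_onQ (hspace H) \<psi>"
  shows "linear_onQ (hspace H) (conv H \<phi> \<psi>)"
  unfolding conv_eq_cop_lift[abs_def] by (intro linear_cop_lift bilinear_onQ_mult assms)

text \<open>Both bracketings are nested Sweedler sums of the same trilinear map, the product of the
  three values, and differ only in which tensor factor is split a second time.\<close>

lemma conv_assoc:
  assumes \<phi>: "linear_onQ (hspace H) \<phi>" and \<psi>: "linear_onQ (hspace H) \<psi>"
    and \<theta>: "linear_onQ (hspace H) \<theta>" and h: "h \<in> hspace H"
  shows "conv H (conv H \<phi> \<psi>) \<theta> h = conv H \<phi> (conv H \<psi> \<theta>) h"
proof -
  let ?G = "\<lambda>a b c. \<phi> a * \<psi> b * \<theta> c"
  have G: "trilinear_onQ (hspace H) ?G"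
    by (intro trilinear_onQI linear_onQ_times_left linear_onQ_times_right assms)
  have "conv H (conv H \<phi> \<psi>) \<theta> h = cop_lift H (\<lambda>a b. cop_lift H (\<lambda>c d. ?G c d b) a) h"
    unfolding conv_eq_cop_lift
  proof (rule cop_lift_cong)
    fix a b assume ab: "a \<in> hspace H" "b \<in> hspace H"
    show "cop_lift H (\<lambda>a b. \<phi> a * \<psi> b) a * \<theta> b = cop_lift H (\<lambda>c d. ?G c d b) a"
      by (rule cop_lift_compose[OF bilinear_onQ_mult[OF \<phi> \<psi>] linear_onQ_times_left[OF linear_onQ_id]
            qvs.subspace_UNIV]) (auto simp: ab)
  qed
  also have "\<dots> = cop_lift H (\<lambda>a b. cop_lift H (\<lambda>c d. ?G a c d) b) h"
    by (rule cop_lift_coassoc[OF G h])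
  also have "\<dots> = conv H \<phi> (conv H \<psi> \<theta>) h"
    unfolding conv_eq_cop_lift
  proof (rule cop_lift_cong[symmetric])
    fix a b assume ab: "a \<in> hspace H" "b \<in> hspace H"
    show "\<phi> a * cop_lift H (\<lambda>a b. \<psi> a * \<theta> b) b = cop_lift H (\<lambda>c d. ?G a c d) b"
      unfolding mult.assoc
      by (rule cop_lift_compose[OF bilinear_onQ_mult[OF \<psi> \<theta>] linear_onQ_times_right[OF linear_onQ_id]
            qvs.subspace_UNIV]) (auto simp: ab)
  qed
  finally show ?thesis .
qed

lemma conv_counit_left: "linear_onQ (hspace H) \<phi> \<Longrightarrow> h \<in> hspace H \<Longrightarrow> conv H (counit H) \<phi> h = \<phi> h"
  using cop_lift_counit_left[of \<phi> h] by (simp add: conv_eq_cop_lift scaleQ_rat_def)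

lemma conv_counit_right: "linear_onQ (hspace H) \<phi> \<Longrightarrow> h \<in> hspace H \<Longrightarrow> conv H \<phi> (counit H) h = \<phi> h"
  using cop_lift_counit_right[of \<phi> h] by (simp add: conv_eq_cop_lift scaleQ_rat_def mult.commute)

lemma conv_inverse_unique:
  assumes \<phi>: "linear_onQ (hspace H) \<phi>"
    and "is_conv_inverse H \<phi> \<psi>" "is_conv_inverse H \<phi> \<psi>'" and h: "h \<in> hspace H"
  shows "\<psi> h = \<psi>' h"
proof -
  have \<psi>: "linear_onQ (hspace H) \<psi>" "linear_onQ (hspace H) \<psi>'"
    and inv: "\<And>h. h \<in> hspace H \<Longrightarrow> conv H \<psi> \<phi> h = counit H h"
      "\<And>h. h \<in> hspace H \<Longrightarrow> conv H \<phi> \<psi>' h = counit H h"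
    using assms by (auto simp: is_conv_inverse_def)
  have "\<psi> h = conv H \<psi> (counit H) h"
    by (simp add: conv_counit_right \<psi> h)
  also have "\<dots> = conv H \<psi> (conv H \<phi> \<psi>') h"
    by (rule conv_cong) (auto simp: \<psi> h linear_counit inv)
  also have "\<dots> = conv H (conv H \<psi> \<phi>) \<psi>' h"
    by (rule conv_assoc[symmetric]) (auto simp: \<psi> h \<phi>)
  also have "\<dots> = conv H (counit H) \<psi>' h"
    by (rule conv_cong) (auto simp: \<psi> \<phi> h linear_conv inv)
  also have "\<dots> = \<psi>' h"
    by (simp add: conv_counit_left \<psi> h)
  finally show ?thesis .
qed

text \<open>Uniqueness of inverses makes the choice in \<open>conv_inverse\<close> computable: any
  explicit inverse may replace it on \<open>hspace H\<close>.\<close>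

lemma conv_inverse_eq:
  assumes "linear_onQ (hspace H) \<phi>" "is_conv_inverse H \<phi> \<psi>" "h \<in> hspace H"
  shows "conv_inverse H \<phi> h = \<psi> h"
proof -
  have "is_conv_inverse H \<phi> (conv_inverse H \<phi>)"
    unfolding conv_inverse_def using assms(2) by (rule someI[of "is_conv_inverse H \<phi>"])
  then show ?thesis
    using conv_inverse_unique assms by blast
qed

end

section \<open>Bialgebras\<close>

lemma bilinear_onQ_image_span:
  assumes "bilinear_onQ (qvs.span B) g" "qvs.subspace T"
    and "\<And>x y. x \<in> B \<Longrightarrow> y \<in> B \<Longrightarrow> g x y \<in> T"
    and "x \<in> qvs.span B" "y \<in> qvs.span B"
  shows "g x y \<in> T"
proof -
  have "g x y \<in> T" if "x \<in> B" for x
    using linear_onQ_image_span[of B "g x" T y] assms that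
    by (simp add: bilinear_onQ_def qvs.span_base)
  then show ?thesis
    using linear_onQ_image_span[of B "\<lambda>x. g x y" T x] assms
    by (simp add: bilinear_onQ_def)
qed

locale graded_alg =
  fixes K :: "('k::rat_vector, 'l::finite, 'n) ghopf_scheme"
  assumes graded_algebra: "graded_algebra K"
begin

sublocale alg: graded_vs K
  by standard (use graded_algebra in \<open>simp add: graded_algebra_def\<close>)

lemma bilinear_mul: "bilinear_onQ (hspace K) (mul K)"
  and mul_in_grade: "a \<in> grade K m \<Longrightarrow> b \<in> grade K n \<Longrightarrow> mul K a b \<in> grade K (m + n)"
  and mul_assoc: "a \<in> hspace K \<Longrightarrow> b \<in> hspace K \<Longrightarrow> c \<in> hspace K \<Longrightarrow>
    mul K (mul K a b) c = mul K a (mul K b c)"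
  and one_in_grade: "one K \<in> grade K 0"
  and mul_one_left: "a \<in> hspace K \<Longrightarrow> mul K (one K) a = a"
  and mul_one_right: "a \<in> hspace K \<Longrightarrow> mul K a (one K) = a"
  using graded_algebra by (auto simp: graded_algebra_def bilinear_onQ_def)

lemma one_in_hspace: "one K \<in> hspace K"
  by (rule grade_in_hspace[OF one_in_grade])

lemma mul_in_hspace:
  assumes "a \<in> hspace K" "b \<in> hspace K"
  shows "mul K a b \<in> hspace K"
proof -
  have "mul K x y \<in> hspace K" if "x \<in> (\<Union>n. grade K n)" "y \<in> (\<Union>n. grade K n)" for x y
    using that mul_in_grade grade_in_hspace by blast
  then show ?thesis
    using bilinear_onQ_image_span[of "\<Union>n. grade K n" "mul K" "hspace K" a b]
      bilinear_mul assms subspace_hspace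
    by (simp add: hspace_def)
qed

lemma linear_mul_left: "a \<in> hspace K \<Longrightarrow> linear_onQ (hspace K) (\<lambda>b. mul K a b)"
  and linear_mul_right: "b \<in> hspace K \<Longrightarrow> linear_onQ (hspace K) (\<lambda>a. mul K a b)"
  using bilinear_mul by (auto simp: bilinear_onQ_def)

end

section \<open>The convolution monoid of linear maps from a coalgebra to an algebra\<close>

definition hom_into ::
  "('h::rat_vector, 'l::finite, 'm) gcoalg_scheme \<Rightarrow> ('k::rat_vector, 'l, 'n) ghopf_scheme \<Rightarrow>
   ('h \<Rightarrow> 'k) \<Rightarrow> bool" where
  "hom_into H K f \<longleftrightarrow> linear_onQ (hspace H) f \<and> f ` hspace H \<subseteq> hspace K"

definition hom_conv ::
  "('h::rat_vector, 'l::finite, 'm) gcoalg_scheme \<Rightarrow> ('k::rat_vector, 'l, 'n) ghopf_scheme \<Rightarrow>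
   ('h \<Rightarrow> 'k) \<Rightarrow> ('h \<Rightarrow> 'k) \<Rightarrow> 'h \<Rightarrow> 'k" where
  "hom_conv H K f g h = cop_lift H (\<lambda>a b. mul K (f a) (g b)) h"

definition hom_unit ::
  "('h::rat_vector, 'l::finite, 'm) gcoalg_scheme \<Rightarrow> ('k::rat_vector, 'l, 'n) ghopf_scheme \<Rightarrow> 'h \<Rightarrow> 'k" where
  "hom_unit H K h = counit H h *\<^sub>Q one K"

locale hom_convolution = graded_coalg H + graded_alg K
  for H :: "('h::rat_vector, 'l::finite, 'm) gcoalg_scheme"
    and K :: "('k::rat_vector, 'l, 'n) ghopf_scheme"
begin

lemma hom_into_in: "hom_into H K f \<Longrightarrow> h \<in> hspace H \<Longrightarrow> f h \<in> hspace K"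
  by (auto simp: hom_into_def)

lemma bilinear_mul_hom:
  assumes "hom_into H K f" "hom_into H K g"
  shows "bilinear_onQ (hspace H) (\<lambda>a b. mul K (f a) (g b))"
  by (rule bilinear_onQ_args[OF bilinear_mul]) (use assms in \<open>auto simp: hom_into_def\<close>)

lemma hom_into_hom_conv:
  assumes "hom_into H K f" "hom_into H K g"
  shows "hom_into H K (hom_conv H K f g)"
  unfolding hom_into_def hom_conv_def[abs_def]
  using assms
  by (auto intro!: linear_cop_lift bilinear_mul_hom cop_lift_in subspace_hspace mul_in_hspace
      intro: hom_into_in)

lemma hom_into_hom_unit: "hom_into H K (hom_unit H K)"
  unfolding hom_into_def hom_unit_def[abs_def]
  by (auto intro!: linear_onQ_scale_left linear_counit qvs.subspace_scale subspace_hspace one_in_hspace)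

lemma hom_conv_cong:
  assumes "\<And>a. a \<in> hspace H \<Longrightarrow> f a = f' a" "\<And>a. a \<in> hspace H \<Longrightarrow> g a = g' a"
  shows "hom_conv H K f g h = hom_conv H K f' g' h"
  unfolding hom_conv_def by (rule cop_lift_cong) (simp add: assms)

lemma hom_conv_unit_left:
  assumes "hom_into H K f" "h \<in> hspace H"
  shows "hom_conv H K (hom_unit H K) f h = f h"
proof -
  have "hom_conv H K (hom_unit H K) f h = cop_lift H (\<lambda>a b. counit H a *\<^sub>Q f b) h"
    unfolding hom_conv_def
  proof (rule cop_lift_cong)
    fix a b assume "b \<in> hspace H"
    then have "f b \<in> hspace K" using assms(1) hom_into_in by blast
    then show "mul K (hom_unit H K a) (f b) = counit H a *\<^sub>Q f b"
      by (simp add: hom_unit_def linear_onQ_scale[OF linear_mul_right] one_in_hspace mul_one_left)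
  qed
  also have "\<dots> = f h" by (rule cop_lift_counit_left) (use assms in \<open>auto simp: hom_into_def\<close>)
  finally show ?thesis .
qed

lemma hom_conv_unit_right:
  assumes "hom_into H K f" "h \<in> hspace H"
  shows "hom_conv H K f (hom_unit H K) h = f h"
proof -
  have "hom_conv H K f (hom_unit H K) h = cop_lift H (\<lambda>a b. counit H b *\<^sub>Q f a) h"
    unfolding hom_conv_def
  proof (rule cop_lift_cong)
    fix a b assume "a \<in> hspace H"
    then have "f a \<in> hspace K" using assms(1) hom_into_in by blast
    then show "mul K (f a) (hom_unit H K b) = counit H b *\<^sub>Q f a"
      by (simp add: hom_unit_def linear_onQ_scale[OF linear_mul_left] one_in_hspace mul_one_right)
  qed
  also have "\<dots> = f h" by (rule cop_lift_counit_right) (use assms in \<open>auto simp: hom_into_def\<close>)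
  finally show ?thesis .
qed

lemma hom_conv_assoc:
  assumes f: "hom_into H K f" and g: "hom_into H K g" and k: "hom_into H K k" and h: "h \<in> hspace H"
  shows "hom_conv H K (hom_conv H K f g) k h = hom_conv H K f (hom_conv H K g k) h"
proof -
  let ?G = "\<lambda>a b c. mul K (mul K (f a) (g b)) (k c)"
  have lin: "linear_onQ (hspace H) f" "linear_onQ (hspace H) g" "linear_onQ (hspace H) k"
    and into: "\<And>x. x \<in> hspace H \<Longrightarrow> f x \<in> hspace K" "\<And>x. x \<in> hspace H \<Longrightarrow> g x \<in> hspace K"
      "\<And>x. x \<in> hspace H \<Longrightarrow> k x \<in> hspace K"
    using f g k by (auto simp: hom_into_def)
  have G: "trilinear_onQ (hspace H) ?G"
    by (intro trilinear_onQI linear_onQ_compose[OF linear_mul_left]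
        linear_onQ_compose[OF linear_mul_right] lin)
      (auto intro: into mul_in_hspace)
  have "hom_conv H K (hom_conv H K f g) k h = cop_lift H (\<lambda>a b. cop_lift H (\<lambda>c d. ?G c d b) a) h"
    unfolding hom_conv_def[of H K "hom_conv H K f g"]
  proof (rule cop_lift_cong)
    fix a b assume ab: "a \<in> hspace H" "b \<in> hspace H"
    show "mul K (hom_conv H K f g a) (k b) = cop_lift H (\<lambda>c d. ?G c d b) a"
      unfolding hom_conv_def
      by (rule cop_lift_compose[OF bilinear_mul_hom[OF f g] linear_mul_right subspace_hspace])
        (auto simp: ab into mul_in_hspace)
  qed
  also have "\<dots> = cop_lift H (\<lambda>a b. cop_lift H (\<lambda>c d. ?G a c d) b) h"
    by (rule cop_lift_coassoc[OF G h])
  also have "\<dots> = hom_conv H K f (hom_conv H K g k) h"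
    unfolding hom_conv_def[of H K f "hom_conv H K g k"]
  proof (rule cop_lift_cong[symmetric])
    fix a b assume ab: "a \<in> hspace H" "b \<in> hspace H"
    have "mul K (f a) (hom_conv H K g k b) = cop_lift H (\<lambda>c d. mul K (f a) (mul K (g c) (k d))) b"
      unfolding hom_conv_def
      by (rule cop_lift_compose[OF bilinear_mul_hom[OF g k] linear_mul_left subspace_hspace])
        (auto simp: ab into mul_in_hspace)
    also have "\<dots> = cop_lift H (\<lambda>c d. ?G a c d) b"
      by (rule cop_lift_cong[symmetric]) (auto simp: ab into mul_assoc)
    finally show "mul K (f a) (hom_conv H K g k b) = cop_lift H (\<lambda>c d. ?G a c d) b" .
  qed
  finally show ?thesis .
qed

text \<open>In any monoid a left inverse equals a right inverse: g = g (f g') = (g f) g' = g'.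
  Applied to a bialgebra map in the role of \<open>f\<close>, this compares the two ways of
  combining it with antipodes.\<close>

lemma hom_conv_inverse_unique:
  assumes "hom_into H K f" "hom_into H K g" "hom_into H K g'" "h \<in> hspace H"
    and inv: "\<And>h. h \<in> hspace H \<Longrightarrow> hom_conv H K g f h = hom_unit H K h"
      "\<And>h. h \<in> hspace H \<Longrightarrow> hom_conv H K f g' h = hom_unit H K h"
  shows "g h = g' h"
proof -
  have "g h = hom_conv H K g (hom_unit H K) h"
    by (simp add: hom_conv_unit_right assms)
  also have "\<dots> = hom_conv H K g (hom_conv H K f g') h"
    by (rule hom_conv_cong) (auto simp: assms hom_into_hom_unit)
  also have "\<dots> = hom_conv H K (hom_conv H K g f) g' h"
    by (rule hom_conv_assoc[symmetric]) (auto simp: assms)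
  also have "\<dots> = hom_conv H K (hom_unit H K) g' h"
    by (rule hom_conv_cong) (auto simp: assms hom_into_hom_conv)
  also have "\<dots> = g' h"
    by (simp add: hom_conv_unit_left assms)
  finally show ?thesis .
qed

end

text \<open>Algebra and coalgebra on the same space, still without compatibility. The bilinearity
  facts collected here are used to prove the compatibility for \<open>QSym\<close>.\<close>

locale alg_coalg = hom_convolution H H
  for H :: "('h::rat_vector, 'l::finite, 'm) ghopf_scheme"
begin

lemma bilinear_mul_args:
  assumes "bilinear_onQ (hspace H) g" "a \<in> hspace H" "b \<in> hspace H"
  shows "bilinear_onQ (hspace H) (\<lambda>c d. g (mul H a c) (mul H b d))"
  by (rule bilinear_onQ_args[OF assms(1)]) (auto simp: linear_mul_left assms(2,3) mul_in_hspace)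

lemma bilinear_cop_lift_mul:
  assumes g: "bilinear_onQ (hspace H) g" and y: "y \<in> hspace H"
  shows "bilinear_onQ (hspace H) (\<lambda>a b. cop_lift H (\<lambda>c d. g (mul H a c) (mul H b d)) y)"
proof (rule bilinear_onQI)
  fix a assume a: "a \<in> hspace H"
  show "linear_onQ (hspace H) (\<lambda>b. cop_lift H (\<lambda>c d. g (mul H a c) (mul H b d)) y)"
  proof (rule linear_cop_lift_param[OF subspace_hspace bilinear_mul_args[OF g a] _ y])
    fix c d assume cd: "c \<in> hspace H" "d \<in> hspace H"
    show "linear_onQ (hspace H) (\<lambda>b. g (mul H a c) (mul H b d))"
      by (rule linear_onQ_compose[OF bilinear_onQ_right[OF g] linear_mul_right])
        (auto simp: a cd mul_in_hspace)
  qed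
next
  fix b assume b: "b \<in> hspace H"
  show "linear_onQ (hspace H) (\<lambda>a. cop_lift H (\<lambda>c d. g (mul H a c) (mul H b d)) y)"
  proof (rule linear_cop_lift_param[OF subspace_hspace bilinear_mul_args[OF g _ b] _ y])
    fix c d assume cd: "c \<in> hspace H" "d \<in> hspace H"
    show "linear_onQ (hspace H) (\<lambda>a. g (mul H a c) (mul H b d))"
      by (rule linear_onQ_compose[OF bilinear_onQ_left[OF g] linear_mul_right])
        (auto simp: b cd mul_in_hspace)
  qed
qed

end

locale graded_bialg =
  fixes H :: "('h::rat_vector, 'l::finite, 'm) ghopf_scheme"
  assumes graded_bialgebra: "graded_bialgebra H"
begin

sublocale alg_coalg H
  using graded_bialgebra
  by (simp add: alg_coalg_def hom_convolution_def graded_coalg_def graded_alg_def graded_bialgebra_def)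

lemma cop_one: "cop H (one H) = tens [one H, one H]"
  and counit_one: "counit H (one H) = 1"
  and counit_mul: "a \<in> hspace H \<Longrightarrow> b \<in> hspace H \<Longrightarrow> counit H (mul H a b) = counit H a * counit H b"
  using graded_bialgebra by (auto simp: graded_bialgebra_def)

lemma cop_mul:
  assumes "a \<in> hspace H" "b \<in> hspace H"
  shows "cop H (mul H a b) =
    cop_lift H (\<lambda>c d. cop_lift H (\<lambda>c' d'. tens [mul H c c', mul H d d']) b) a"
  using graded_bialgebra assms by (simp add: graded_bialgebra_def mul2_def cop_lift_def)

lemma cop_mul_sum_list:
  assumes a: "a \<in> hspace H" and b: "b \<in> hspace H"
    and xs: "cop H a = (\<Sum>(c, d)\<leftarrow>xs. tens [c, d])" "\<forall>(c, d)\<in>set xs. c \<in> hspace H \<and> d \<in> hspace H"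
    and ys: "cop H b = (\<Sum>(c, d)\<leftarrow>ys. tens [c, d])" "\<forall>(c, d)\<in>set ys. c \<in> hspace H \<and> d \<in> hspace H"
  shows "cop H (mul H a b) =
    (\<Sum>(c, d)\<leftarrow>xs. \<Sum>(c', d')\<leftarrow>ys. tens [mul H c c', mul H d d'])"
  unfolding cop_mul[OF a b] cop_lift_sum_list[OF bilinear_cop_lift_mul[OF bilinear_onQ_tens b] xs]
proof (rule sum_list_cong_pairs)
  fix c d assume "(c, d) \<in> set xs"
  then have "c \<in> hspace H" "d \<in> hspace H" using xs(2) by auto
  from cop_lift_sum_list[OF bilinear_mul_args[OF bilinear_onQ_tens this] ys]
  show "cop_lift H (\<lambda>c' d'. tens [mul H c c', mul H d d']) b =
    (\<Sum>(c', d')\<leftarrow>ys. tens [mul H c c', mul H d d'])" .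
qed

text \<open>Multiplicativity of the coproduct tested against a bilinear map: the sum of g((ab)_1,
  (ab)_2) is the double sum of g(a_1 b_1, a_2 b_2).\<close>

lemma cop_lift_mul:
  assumes g: "bilinear_onQ (hspace H) g" and a: "a \<in> hspace H" and b: "b \<in> hspace H"
  shows "cop_lift H g (mul H a b) =
    cop_lift H (\<lambda>c d. cop_lift H (\<lambda>c' d'. g (mul H c c') (mul H d d')) b) a"
proof -
  let ?L = "tensor_lift2 (hspace H) g"
  note L = linear_onQ_tensor_lift2[OF subspace_hspace g]
  have "cop_lift H g (mul H a b) = ?L (cop H (mul H a b))" by (simp add: cop_lift_def)
  also have "\<dots> = cop_lift H (\<lambda>c d. ?L (cop_lift H (\<lambda>c' d'. tens [mul H c c', mul H d d']) b)) a"
    unfolding cop_mul[OF a b]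
    by (rule cop_lift_compose[OF bilinear_cop_lift_mul[OF bilinear_onQ_tens b] L]) (auto simp: a)
  also have "\<dots> = cop_lift H (\<lambda>c d. cop_lift H (\<lambda>c' d'. g (mul H c c') (mul H d d')) b) a"
  proof (rule cop_lift_cong[symmetric])
    fix c d assume cd: "c \<in> hspace H" "d \<in> hspace H"
    have "?L (cop_lift H (\<lambda>c' d'. tens [mul H c c', mul H d d']) b) =
        cop_lift H (\<lambda>c' d'. ?L (tens [mul H c c', mul H d d'])) b"
      by (rule cop_lift_compose[OF bilinear_mul_args[OF bilinear_onQ_tens cd] L]) (auto simp: b)
    also have "\<dots> = cop_lift H (\<lambda>c' d'. g (mul H c c') (mul H d d')) b"
      by (rule cop_lift_cong[symmetric])
        (simp add: tensor_lift2_tens[OF subspace_hspace g] cd mul_in_hspace)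
    finally show "cop_lift H (\<lambda>c' d'. g (mul H c c') (mul H d d')) b =
        ?L (cop_lift H (\<lambda>c' d'. tens [mul H c c', mul H d d']) b)" ..
  qed
  finally show ?thesis .
qed

end

subsection \<open>The antipode of a connected bialgebra\<close>

lemma weight_add: "weight (m + n) = weight m + weight n"
  by (simp add: weight_def sum.distrib)

lemma weight_eq_0_iff: "weight n = 0 \<longleftrightarrow> n = 0"
  by (simp add: weight_def vec_eq_iff)

context graded_bialg
begin

text \<open>The projection onto the kernel of the counit along the line of \<open>one H\<close>. The
  identity is the convolution unit plus \<open>aug\<close>, so its inverse should be the alternating
  sum of the convolution powers of \<open>aug\<close>.\<close>

definition aug :: "'h \<Rightarrow> 'h" where
  "aug h = h - hom_unit H H h"

primrec aug_pow :: "nat \<Rightarrow> 'h \<Rightarrow> 'h" where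
  "aug_pow 0 = hom_unit H H"
| "aug_pow (Suc m) = hom_conv H H aug (aug_pow m)"

lemma hom_into_id: "hom_into H H (\<lambda>h. h)"
  by (simp add: hom_into_def linear_onQ_id)

lemma hom_into_aug: "hom_into H H aug"
  using hom_into_hom_unit hom_into_id unfolding aug_def[abs_def] hom_into_def
  by (auto intro!: linear_onQ_minus' qvs.subspace_diff subspace_hspace)

lemma hom_into_aug_pow: "hom_into H H (aug_pow m)"
  by (induction m) (auto simp: hom_into_hom_unit hom_into_hom_conv hom_into_aug)

text \<open>The recursion multiplies by \<open>aug\<close> on the left, whereas the identity that
  makes the antipode a left inverse produces it on the right. Associativity reconciles the
  two.\<close>

lemma aug_pow_Suc_right:
  "h \<in> hspace H \<Longrightarrow> aug_pow (Suc m) h = hom_conv H H (aug_pow m) aug h"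
proof (induction m arbitrary: h)
  case 0
  then show ?case by (simp add: hom_conv_unit_left hom_conv_unit_right hom_into_aug)
next
  case (Suc m)
  have "aug_pow (Suc (Suc m)) h = hom_conv H H aug (hom_conv H H (aug_pow m) aug) h"
    unfolding aug_pow.simps(2)[of "Suc m"]
    by (rule hom_conv_cong)
      (use Suc in \<open>auto simp: hom_into_aug hom_into_aug_pow simp del: aug_pow.simps\<close>)
  also have "\<dots> = hom_conv H H (aug_pow (Suc m)) aug h"
    using Suc.prems by (simp add: hom_conv_assoc hom_into_aug hom_into_aug_pow)
  finally show ?case .
qed

lemma hom_unit_in_grade: "h \<in> grade H n \<Longrightarrow> hom_unit H H h \<in> grade H n"
  by (cases "n = 0")
    (auto simp: hom_unit_def counit_grade one_in_grade
      qvs.subspace_scale[OF subspace_grade] qvs.subspace_0[OF subspace_grade])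

lemma aug_in_grade: "h \<in> grade H n \<Longrightarrow> aug h \<in> grade H n"
  unfolding aug_def by (rule qvs.subspace_diff[OF subspace_grade]) (auto simp: hom_unit_in_grade)

lemma aug_pow_in_grade: "h \<in> grade H n \<Longrightarrow> aug_pow m h \<in> grade H n"
proof (induction m arbitrary: h n)
  case 0
  then show ?case by (simp add: hom_unit_in_grade)
next
  case (Suc m)
  show ?case
    unfolding aug_pow.simps hom_conv_def
    by (rule cop_lift_in_grade[OF bilinear_mul_hom[OF hom_into_aug hom_into_aug_pow]
          subspace_grade Suc.prems])
      (use Suc.IH aug_in_grade mul_in_grade in blast)
qed

end

locale connected_bialg = graded_bialg H
  for H :: "('h::rat_vector, 'l::finite, 'm) ghopf_scheme" +
  assumes connected: "grade H 0 = range (\<lambda>c. c *\<^sub>Q one H)"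
begin

lemma aug_grade_0: "h \<in> grade H 0 \<Longrightarrow> aug h = 0"
  using connected
  by (auto simp: aug_def hom_unit_def linear_onQ_scale[OF linear_counit one_in_hspace] counit_one
      scaleQ_rat_def)

text \<open>Degrees add up along the coproduct, and \<open>aug\<close> kills degree zero by
  connectedness. Every factor thus consumes weight at least one, and \<open>m\<close> factors cannot
  all be nonzero on weight below \<open>m\<close>.\<close>

lemma aug_pow_eq_0: "h \<in> grade H n \<Longrightarrow> weight n < m \<Longrightarrow> aug_pow m h = 0"
proof (induction m arbitrary: h n)
  case (Suc m)
  have "aug_pow (Suc m) h \<in> {0}"
    unfolding aug_pow.simps hom_conv_def
  proof (rule cop_lift_in_grade[OF bilinear_mul_hom[OF hom_into_aug hom_into_aug_pow]
        qvs.subspace_single_0 Suc.prems(1)])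
    fix i j a b assume ij: "i + j = n" and a: "a \<in> grade H i" and b: "b \<in> grade H j"
    show "mul H (aug a) (aug_pow m b) \<in> {0}"
    proof (cases "i = 0")
      case True
      then have "aug a = 0" using a aug_grade_0 by blast
      moreover have "aug_pow m b \<in> hspace H"
        using b hom_into_in[OF hom_into_aug_pow] grade_in_hspace by blast
      ultimately show ?thesis
        using linear_onQ_zero[OF linear_mul_right subspace_hspace] by simp
    next
      case False
      then have "weight j < m"
        using Suc.prems(2) ij weight_add[of i j] weight_eq_0_iff[of i] by auto
      then have "aug_pow m b = 0" using Suc.IH b by blast
      moreover have "aug a \<in> hspace H"
        using a hom_into_in[OF hom_into_aug] grade_in_hspace by blast
      ultimately show ?thesis
        using linear_onQ_zero[OF linear_mul_left subspace_hspace] by simp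
    qed
  qed
  then show ?case by simp
qed simp

text \<open>For inhomogeneous elements the bound \<open>N\<close> depends on the element, but the
  elements with some bound form a subspace that contains every homogeneous piece.\<close>

lemma aug_pow_eventually_0:
  assumes "h \<in> hspace H"
  shows "\<exists>N. \<forall>m\<ge>N. aug_pow m h = 0"
proof -
  have lin: "linear_onQ (hspace H) (aug_pow m)" for m
    using hom_into_aug_pow by (simp add: hom_into_def)
  define T where "T = {h \<in> hspace H. \<exists>N. \<forall>m\<ge>N. aug_pow m h = 0}"
  have "qvs.subspace T"
  proof (rule qvs.subspaceI)
    show "0 \<in> T"
      using linear_onQ_zero[OF lin subspace_hspace] by (simp add: T_def qvs.subspace_0[OF subspace_hspace])
    fix x y assume "x \<in> T" "y \<in> T"
    then obtain N N' where *: "x \<in> hspace H" "y \<in> hspace H" "\<forall>m\<ge>N. aug_pow m x = 0" "\<forall>m\<ge>N'. aug_pow m y = 0"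
      by (auto simp: T_def)
    then have "\<forall>m\<ge>max N N'. aug_pow m (x + y) = 0"
      by (simp add: linear_onQ_add[OF lin])
    with * show "x + y \<in> T" unfolding T_def by (blast intro: qvs.subspace_add[OF subspace_hspace])
  next
    fix c x assume "x \<in> T"
    then show "c *\<^sub>Q x \<in> T"
      by (auto simp: T_def linear_onQ_scale[OF lin] qvs.subspace_scale[OF subspace_hspace])
  qed
  moreover have "h \<in> T" if "h \<in> grade H n" for h n
  proof -
    have "\<forall>m\<ge>Suc (weight n). aug_pow m h = 0" using aug_pow_eq_0[OF that] by auto
    then show ?thesis using grade_in_hspace[OF that] by (auto simp: T_def)
  qed
  ultimately have "hspace H \<subseteq> T"
    unfolding hspace_def by (intro qvs.span_minimal) auto
  then show ?thesis using assms by (auto simp: T_def)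
qed

text \<open>Takeuchi's formula: the geometric series for the convolution inverse of the identity.\<close>

definition takeuchi :: "'h \<Rightarrow> 'h" where
  "takeuchi h = (\<Sum>m | aug_pow m h \<noteq> 0. (- 1) ^ m *\<^sub>Q aug_pow m h)"

lemma takeuchi_eq:
  assumes "\<forall>m\<ge>N. aug_pow m h = 0"
  shows "takeuchi h = (\<Sum>m<N. (- 1) ^ m *\<^sub>Q aug_pow m h)"
  unfolding takeuchi_def
  by (rule sum.mono_neutral_left) (use assms in \<open>auto simp: not_less[symmetric]\<close>)

lemma hom_into_takeuchi: "hom_into H H takeuchi"
proof -
  have lin: "linear_onQ (hspace H) (aug_pow m)" for m
    using hom_into_aug_pow by (simp add: hom_into_def)
  have "linear_onQ (hspace H) takeuchi"
  proof (rule linear_onQI)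
    fix x y assume xy: "x \<in> hspace H" "y \<in> hspace H"
    then obtain N N' where *: "\<forall>m\<ge>N. aug_pow m x = 0" "\<forall>m\<ge>N'. aug_pow m y = 0"
      using aug_pow_eventually_0 by meson
    let ?N = "max N N'"
    have "\<forall>m\<ge>?N. aug_pow m x = 0" "\<forall>m\<ge>?N. aug_pow m y = 0" "\<forall>m\<ge>?N. aug_pow m (x + y) = 0"
      using * by (auto simp: linear_onQ_add[OF lin xy])
    then show "takeuchi (x + y) = takeuchi x + takeuchi y"
      by (simp add: takeuchi_eq[of ?N] linear_onQ_add[OF lin xy] scaleQ_add_right sum.distrib)
  next
    fix c x assume x: "x \<in> hspace H"
    then obtain N where *: "\<forall>m\<ge>N. aug_pow m x = 0"
      using aug_pow_eventually_0 by meson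
    then have "\<forall>m\<ge>N. aug_pow m (c *\<^sub>Q x) = 0" by (simp add: linear_onQ_scale[OF lin x])
    with * show "takeuchi (c *\<^sub>Q x) = c *\<^sub>Q takeuchi x"
      by (simp add: takeuchi_eq[of N] linear_onQ_scale[OF lin x] qvs.scale_sum_right mult.commute)
  qed
  moreover have "takeuchi h \<in> hspace H" if "h \<in> hspace H" for h
    unfolding takeuchi_def using hom_into_in[OF hom_into_aug_pow that]
    by (auto intro!: qvs.subspace_sum subspace_hspace qvs.subspace_scale)
  ultimately show ?thesis by (auto simp: hom_into_def)
qed

lemma takeuchi_grade:
  assumes "h \<in> grade H n" "weight n < N"
  shows "takeuchi h = (\<Sum>m<N. (- 1) ^ m *\<^sub>Q aug_pow m h)"
  using aug_pow_eq_0[OF assms(1)] assms(2) by (intro takeuchi_eq) auto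

text \<open>The cancellation behind the geometric series for 1/(1 + x); the boundary term at
  \<open>N\<close> disappears once the powers of \<open>aug\<close> vanish.\<close>

lemma telescope_alternating:
  "(\<Sum>m<N. (- 1) ^ m *\<^sub>Q (f (Suc m) + f m)) = f 0 - (- 1) ^ N *\<^sub>Q (f N :: 'v::rat_vector)"
  by (induction N) (simp_all add: scaleQ_add_right)

lemma linear_hom_conv: "hom_into H H f \<Longrightarrow> hom_into H H g \<Longrightarrow> linear_onQ (hspace H) (hom_conv H H f g)"
  using hom_into_hom_conv by (simp add: hom_into_def)

lemma linear_hom_unit: "linear_onQ (hspace H) (hom_unit H H)"
  using hom_into_hom_unit by (simp add: hom_into_def)

lemma hom_conv_takeuchi_id:
  assumes "h \<in> hspace H"
  shows "hom_conv H H takeuchi (\<lambda>h. h) h = hom_unit H H h"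
proof (rule linear_onQ_eq_hspace[OF linear_hom_conv[OF hom_into_takeuchi hom_into_id] linear_hom_unit _ assms])
  fix n h assume h: "h \<in> grade H n"
  have h': "h \<in> hspace H" using h by (rule grade_in_hspace)
  \<comment> \<open>Each left tensor factor of the coproduct has weight at most
    \<open>weight n\<close>, so this one cutoff truncates the series correctly for all of them and
    makes the boundary term at \<open>h\<close> vanish.\<close>
  let ?N = "Suc (weight n)"
  obtain xs where xs: "cop H h = (\<Sum>(a, b)\<leftarrow>xs. tens [a, b])"
    "\<forall>(a, b)\<in>set xs. \<exists>i j. i + j = n \<and> a \<in> grade H i \<and> b \<in> grade H j"
    using cop_grade_sum_list[OF h] .
  have xs': "\<forall>(a, b)\<in>set xs. a \<in> hspace H \<and> b \<in> hspace H" using xs(2) grade_in_hspace by blast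
  note conv = cop_lift_sum_list[OF bilinear_mul_hom xs(1) xs', folded hom_conv_def]
  have "hom_conv H H takeuchi (\<lambda>h. h) h = (\<Sum>(a, b)\<leftarrow>xs. mul H (takeuchi a) b)"
    by (rule conv[OF hom_into_takeuchi hom_into_id])
  also have "\<dots> = (\<Sum>(a, b)\<leftarrow>xs. \<Sum>m<?N. (- 1) ^ m *\<^sub>Q mul H (aug_pow m a) b)"
  proof (rule sum_list_cong_pairs)
    fix a b assume "(a, b) \<in> set xs"
    then obtain i j where ij: "i + j = n" "a \<in> grade H i" "b \<in> grade H j" using xs(2) by blast
    then have ab: "a \<in> hspace H" "b \<in> hspace H" using grade_in_hspace by blast+
    have "mul H (takeuchi a) b = mul H (\<Sum>m<?N. (- 1) ^ m *\<^sub>Q aug_pow m a) b"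
      using ij weight_add[of i j] by (subst takeuchi_grade[of a i ?N]) auto
    also have "\<dots> = (\<Sum>m<?N. mul H ((- 1) ^ m *\<^sub>Q aug_pow m a) b)"
      by (rule linear_onQ_sum[OF linear_mul_right subspace_hspace])
        (auto simp: ab hom_into_in[OF hom_into_aug_pow] intro!: qvs.subspace_scale subspace_hspace)
    also have "\<dots> = (\<Sum>m<?N. (- 1) ^ m *\<^sub>Q mul H (aug_pow m a) b)"
      using ab by (simp add: linear_onQ_scale[OF linear_mul_right] hom_into_in[OF hom_into_aug_pow])
    finally show "mul H (takeuchi a) b = (\<Sum>m<?N. (- 1) ^ m *\<^sub>Q mul H (aug_pow m a) b)" .
  qed
  also have "\<dots> = (\<Sum>m<?N. (- 1) ^ m *\<^sub>Q (\<Sum>(a, b)\<leftarrow>xs. mul H (aug_pow m a) b))"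
    by (induction xs) (auto simp: sum.distrib scaleQ_add_right)
  also have "\<dots> = (\<Sum>m<?N. (- 1) ^ m *\<^sub>Q (aug_pow (Suc m) h + aug_pow m h))"
  proof (intro sum.cong refl arg_cong[where f = "scaleQ _"])
    fix m
    have "(\<Sum>(a, b)\<leftarrow>xs. mul H (aug_pow m a) b) =
        (\<Sum>(a, b)\<leftarrow>xs. mul H (aug_pow m a) (aug b) + mul H (aug_pow m a) (hom_unit H H b))"
    proof (rule sum_list_cong_pairs)
      fix a b assume "(a, b) \<in> set xs"
      then have ab: "a \<in> hspace H" "b \<in> hspace H" using xs' by auto
      show "mul H (aug_pow m a) b = mul H (aug_pow m a) (aug b) + mul H (aug_pow m a) (hom_unit H H b)"
        using ab linear_onQ_add[OF linear_mul_left, of "aug_pow m a" "aug b" "hom_unit H H b"]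
        by (simp add: hom_into_in[OF hom_into_aug_pow] hom_into_in[OF hom_into_aug]
            hom_into_in[OF hom_into_hom_unit]) (simp add: aug_def)
    qed
    also have "\<dots> = hom_conv H H (aug_pow m) aug h + hom_conv H H (aug_pow m) (hom_unit H H) h"
      unfolding conv[OF hom_into_aug_pow hom_into_aug] conv[OF hom_into_aug_pow hom_into_hom_unit]
      by (simp add: sum_list_addf[symmetric] case_prod_beta')
    also have "\<dots> = aug_pow (Suc m) h + aug_pow m h"
      by (simp only: aug_pow_Suc_right[OF h'] hom_conv_unit_right[OF hom_into_aug_pow h'])
    finally show "(\<Sum>(a, b)\<leftarrow>xs. mul H (aug_pow m a) b) = aug_pow (Suc m) h + aug_pow m h" .
  qed
  also have "\<dots> = hom_unit H H h"
    unfolding telescope_alternating[of "\<lambda>m. aug_pow m h"] using aug_pow_eq_0[OF h, of ?N] by simp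
  finally show "hom_conv H H takeuchi (\<lambda>h. h) h = hom_unit H H h" .
qed

text \<open>The mirror image of the previous argument: the left factor is split into
  \<open>aug\<close> and the unit, and the powers appear directly in the shape of the recursion for
  \<open>aug_pow\<close>.\<close>

lemma hom_conv_id_takeuchi:
  assumes "h \<in> hspace H"
  shows "hom_conv H H (\<lambda>h. h) takeuchi h = hom_unit H H h"
proof (rule linear_onQ_eq_hspace[OF linear_hom_conv[OF hom_into_id hom_into_takeuchi] linear_hom_unit _ assms])
  fix n h assume h: "h \<in> grade H n"
  have h': "h \<in> hspace H" using h by (rule grade_in_hspace)
  let ?N = "Suc (weight n)"
  obtain xs where xs: "cop H h = (\<Sum>(a, b)\<leftarrow>xs. tens [a, b])"
    "\<forall>(a, b)\<in>set xs. \<exists>i j. i + j = n \<and> a \<in> grade H i \<and> b \<in> grade H j"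
    using cop_grade_sum_list[OF h] .
  have xs': "\<forall>(a, b)\<in>set xs. a \<in> hspace H \<and> b \<in> hspace H" using xs(2) grade_in_hspace by blast
  note conv = cop_lift_sum_list[OF bilinear_mul_hom xs(1) xs', folded hom_conv_def]
  have "hom_conv H H (\<lambda>h. h) takeuchi h = (\<Sum>(a, b)\<leftarrow>xs. mul H a (takeuchi b))"
    by (rule conv[OF hom_into_id hom_into_takeuchi])
  also have "\<dots> = (\<Sum>(a, b)\<leftarrow>xs. \<Sum>m<?N. (- 1) ^ m *\<^sub>Q mul H a (aug_pow m b))"
  proof (rule sum_list_cong_pairs)
    fix a b assume "(a, b) \<in> set xs"
    then obtain i j where ij: "i + j = n" "a \<in> grade H i" "b \<in> grade H j" using xs(2) by blast
    then have ab: "a \<in> hspace H" "b \<in> hspace H" using grade_in_hspace by blast+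
    have "mul H a (takeuchi b) = mul H a (\<Sum>m<?N. (- 1) ^ m *\<^sub>Q aug_pow m b)"
      using ij weight_add[of i j] by (subst takeuchi_grade[of b j ?N]) auto
    also have "\<dots> = (\<Sum>m<?N. mul H a ((- 1) ^ m *\<^sub>Q aug_pow m b))"
      by (rule linear_onQ_sum[OF linear_mul_left subspace_hspace])
        (auto simp: ab hom_into_in[OF hom_into_aug_pow] intro!: qvs.subspace_scale subspace_hspace)
    also have "\<dots> = (\<Sum>m<?N. (- 1) ^ m *\<^sub>Q mul H a (aug_pow m b))"
      using ab by (simp add: linear_onQ_scale[OF linear_mul_left] hom_into_in[OF hom_into_aug_pow])
    finally show "mul H a (takeuchi b) = (\<Sum>m<?N. (- 1) ^ m *\<^sub>Q mul H a (aug_pow m b))" .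
  qed
  also have "\<dots> = (\<Sum>m<?N. (- 1) ^ m *\<^sub>Q (\<Sum>(a, b)\<leftarrow>xs. mul H a (aug_pow m b)))"
    by (induction xs) (auto simp: sum.distrib scaleQ_add_right)
  also have "\<dots> = (\<Sum>m<?N. (- 1) ^ m *\<^sub>Q (aug_pow (Suc m) h + aug_pow m h))"
  proof (intro sum.cong refl arg_cong[where f = "scaleQ _"])
    fix m
    have "(\<Sum>(a, b)\<leftarrow>xs. mul H a (aug_pow m b)) =
        (\<Sum>(a, b)\<leftarrow>xs. mul H (aug a) (aug_pow m b) + mul H (hom_unit H H a) (aug_pow m b))"
    proof (rule sum_list_cong_pairs)
      fix a b assume "(a, b) \<in> set xs"
      then have ab: "a \<in> hspace H" "b \<in> hspace H" using xs' by auto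
      show "mul H a (aug_pow m b) = mul H (aug a) (aug_pow m b) + mul H (hom_unit H H a) (aug_pow m b)"
        using ab linear_onQ_add[OF linear_mul_right, of "aug_pow m b" "aug a" "hom_unit H H a"]
        by (simp add: hom_into_in[OF hom_into_aug_pow] hom_into_in[OF hom_into_aug]
            hom_into_in[OF hom_into_hom_unit]) (simp add: aug_def)
    qed
    also have "\<dots> = hom_conv H H aug (aug_pow m) h + hom_conv H H (hom_unit H H) (aug_pow m) h"
      unfolding conv[OF hom_into_aug hom_into_aug_pow] conv[OF hom_into_hom_unit hom_into_aug_pow]
      by (simp add: sum_list_addf[symmetric] case_prod_beta')
    also have "\<dots> = aug_pow (Suc m) h + aug_pow m h"
      by (simp add: hom_conv_unit_left[OF hom_into_aug_pow h'])
    finally show "(\<Sum>(a, b)\<leftarrow>xs. mul H a (aug_pow m b)) = aug_pow (Suc m) h + aug_pow m h" .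
  qed
  also have "\<dots> = hom_unit H H h"
    unfolding telescope_alternating[of "\<lambda>m. aug_pow m h"] using aug_pow_eq_0[OF h, of ?N] by simp
  finally show "hom_conv H H (\<lambda>h. h) takeuchi h = hom_unit H H h" .
qed

lemma is_antipode_takeuchi: "is_antipode H takeuchi"
proof -
  have "takeuchi h \<in> grade H n" if "h \<in> grade H n" for h n
    unfolding takeuchi_def using aug_pow_in_grade[OF that]
    by (auto intro!: qvs.subspace_sum subspace_grade qvs.subspace_scale)
  then show ?thesis
    using hom_into_takeuchi hom_conv_takeuchi_id hom_conv_id_takeuchi
    by (auto simp: is_antipode_def hom_into_def hom_conv_def hom_unit_def cop_lift_def)
qed

end

section \<open>Subcoalgebras and morphisms\<close>

lemma finite_vec_le: "finite {v :: nat ^ 'l::finite. \<forall>i. v $ i \<le> n $ i}"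
proof -
  have "finite (PiE (UNIV :: 'l set) (\<lambda>i. {..n $ i}))" by (rule finite_PiE) auto
  moreover have "vec_nth ` {v :: nat ^ 'l. \<forall>i. v $ i \<le> n $ i} \<subseteq> PiE UNIV (\<lambda>i. {..n $ i})"
    by auto
  ultimately have "finite (vec_nth ` {v :: nat ^ 'l. \<forall>i. v $ i \<le> n $ i})"
    by (rule finite_subset[rotated])
  then show ?thesis
    by (rule finite_imageD) (simp add: inj_on_def vec_nth_inject)
qed

lemma finite_vec_pairs: "finite {(i, j). i + j = (n :: nat ^ 'l::finite)}"
proof (rule finite_subset)
  show "{(i, j). i + j = n} \<subseteq> {v. \<forall>i. v $ i \<le> n $ i} \<times> {v. \<forall>i. v $ i \<le> n $ i}"
    by auto
qed (intro finite_cartesian_product finite_vec_le)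

text \<open>Only the homogeneous pieces shrink; coproduct and counit stay the same functions on the
  ambient type. This is also the shape in which \<open>odd_QSym\<close> is given.\<close>

definition restrict_grade ::
  "('h::rat_vector, 'l::finite, 'm) gcoalg_scheme \<Rightarrow> 'h set \<Rightarrow> ('h, 'l, 'm) gcoalg_scheme" where
  "restrict_grade H C = H\<lparr>grade := \<lambda>n. C \<inter> grade H n\<rparr>"

locale graded_subcoalg = graded_coalg H
  for H :: "('h::rat_vector, 'l::finite, 'm) gcoalg_scheme" +
  fixes C :: "'h set"
  assumes graded_subcoalgebra: "graded_subcoalgebra H C"
begin

lemma C_subset: "C \<subseteq> hspace H"
  and C_span: "C = qvs.span (\<Union>n. C \<inter> grade H n)"
  and cop_C: "h \<in> C \<Longrightarrow> cop H h \<in> tensor_square C"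
  using graded_subcoalgebra unfolding graded_subcoalgebra_def by blast+

lemma subspace_C: "qvs.subspace C"
  using qvs.subspace_span[of "\<Union>n. C \<inter> grade H n"] by (simp only: C_span[symmetric])

lemma restrict_grade_simps:
  "hspace (restrict_grade H C) = C"
  "grade (restrict_grade H C) n = C \<inter> grade H n"
  "cop (restrict_grade H C) = cop H"
  "counit (restrict_grade H C) = counit H"
  using C_span[symmetric] by (simp_all add: hspace_def restrict_grade_def)

lemma component_in_C:
  assumes "h \<in> C"
  shows "component H n h \<in> C"
proof -
  have "linear_onQ (qvs.span (\<Union>n. C \<inter> grade H n)) (component H n)"
    using linear_onQ_subset[OF linear_component C_subset] by (simp only: C_span[symmetric])
  then show ?thesis
  proof (rule linear_onQ_image_span[OF _ subspace_C])
    show "component H n x \<in> C" if "x \<in> (\<Union>n. C \<inter> grade H n)" for x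
      using that by (auto simp: component_grade qvs.subspace_0[OF subspace_C])
    show "h \<in> qvs.span (\<Union>n. C \<inter> grade H n)" using assms by (simp only: C_span[symmetric])
  qed
qed

lemma cop_C_sum_list:
  assumes "h \<in> C"
  obtains xs where "cop H h = (\<Sum>(a, b)\<leftarrow>xs. tens [a, b])" "\<forall>(a, b)\<in>set xs. a \<in> C \<and> b \<in> C"
  using tensor_square_sum_list[OF subspace_C cop_C[OF assms]] by blast

text \<open>The lifts over \<open>C\<close> and over \<open>hspace H\<close> are two unrelated
  choices. They agree on the coproduct of an element of \<open>C\<close> because this is a sum of
  pure tensors with entries in \<open>C\<close>, where both choices are constrained.\<close>

lemma cop_lift_restrict_grade:
  assumes g: "bilinear_onQ (hspace H) g" and h: "h \<in> C"
  shows "cop_lift (restrict_grade H C) g h = cop_lift H g h"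
proof -
  obtain xs where xs: "cop H h = (\<Sum>(a, b)\<leftarrow>xs. tens [a, b])" "\<forall>(a, b)\<in>set xs. a \<in> C \<and> b \<in> C"
    by (rule cop_C_sum_list[OF h])
  have "cop_lift H g h = (\<Sum>(a, b)\<leftarrow>xs. g a b)"
    by (rule cop_lift_sum_list[OF g xs(1)]) (use xs(2) C_subset in auto)
  moreover have "cop_lift (restrict_grade H C) g h = (\<Sum>(a, b)\<leftarrow>xs. g a b)"
    by (rule cop_lift_sum_list)
      (use xs bilinear_onQ_subset[OF g C_subset] in \<open>simp_all add: restrict_grade_simps\<close>)
  ultimately show ?thesis by simp
qed

lemma cop_lift_restrict_grade_cong:
  assumes "bilinear_onQ (hspace H) g" "h \<in> C" "\<And>a b. a \<in> C \<Longrightarrow> b \<in> C \<Longrightarrow> g' a b = g a b"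
  shows "cop_lift (restrict_grade H C) g' h = cop_lift H g h"
  using cop_lift_restrict_grade[OF assms(1,2)] tensor_lift2_cong[of C g' g] assms(3)
  by (simp add: cop_lift_def restrict_grade_simps)

text \<open>The coproduct lies in the tensor square of \<open>C\<close> and also in the sum of the
  bihomogeneous pieces of \<open>H\<close>; the claim is that both descriptions hold at once. The
  sum \<open>P\<close> of the projections to bidegrees \<open>(i, j)\<close> with
  \<open>i + j = n\<close> fixes the coproduct by the second description, and sends the first one
  into the desired span because \<open>C\<close> is closed under components.\<close>

lemma cop_grade_C:
  assumes "h \<in> C" "h \<in> grade H n"
  shows "cop H h \<in> qvs.span {tens [a, b] | a b i j. i + j = n \<and>
    a \<in> C \<inter> grade H i \<and> b \<in> C \<inter> grade H j}" (is "_ \<in> ?T")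
proof -
  let ?A = "{(i, j). i + j = n}"
  define P where "P = (\<lambda>a b. \<Sum>(i, j)\<in>?A. tens [component H i a, component H j b])"
  have P: "bilinear_onQ (hspace H) P"
    unfolding P_def case_prod_beta
    by (intro bilinear_onQI linear_onQ_setsum
        linear_onQ_compose[OF bilinear_onQ_left[OF bilinear_onQ_tens[of UNIV]] linear_component]
        linear_onQ_compose[OF bilinear_onQ_right[OF bilinear_onQ_tens[of UNIV]] linear_component]) auto
  have h: "h \<in> hspace H" using assms C_subset by blast
  have "cop_lift H P h = cop_lift H (\<lambda>a b. tens [a, b]) h"
  proof (rule cop_lift_cong_grade[OF P bilinear_onQ_tens assms(2)])
    fix i j a b assume ij: "i + j = n" "a \<in> grade H i" "b \<in> grade H j"
    have "P a b = (\<Sum>p\<in>?A. if p = (i, j) then tens [a, b] else 0)"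
      unfolding P_def
    proof (rule sum.cong[OF refl], clarify)
      fix i' j' assume "n = i' + j'"
      moreover have "tens [0, x] = 0" "tens [x, 0] = 0" for x :: 'h
        using linear_onQ_zero[OF linear_onQ_tens[of UNIV "[]" "[x]"]]
          linear_onQ_zero[OF linear_onQ_tens[of UNIV "[x]" "[]"]] by auto
      ultimately show "tens [component H i' a, component H j' b] =
          (if (i', j') = (i, j) then tens [a, b] else 0)"
        by (auto simp: component_grade[OF ij(2)] component_grade[OF ij(3)])
    qed
    also have "\<dots> = tens [a, b]"
      using ij(1) by (simp add: sum.delta[OF finite_vec_pairs])
    finally show "P a b = tens [a, b]" .
  qed
  also have "\<dots> = cop H h"
    using cop_sum_list[OF h] cop_lift_sum_list[OF bilinear_onQ_tens] by metis
  finally have "cop H h = cop_lift H P h" ..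
  obtain xs where xs: "cop H h = (\<Sum>(a, b)\<leftarrow>xs. tens [a, b])" "\<forall>(a, b)\<in>set xs. a \<in> C \<and> b \<in> C"
    by (rule cop_C_sum_list[OF assms(1)])
  have "cop_lift H P h = (\<Sum>(a, b)\<leftarrow>xs. P a b)"
    by (rule cop_lift_sum_list[OF P xs(1)]) (use xs(2) C_subset in auto)
  also have "\<dots> \<in> ?T"
  proof (rule subspace_sum_list)
    fix p assume "p \<in> set xs"
    then obtain a b where p: "p = (a, b)" "a \<in> C" "b \<in> C" using xs(2) by (cases p) auto
    have "P a b \<in> ?T"
      unfolding P_def
    proof (rule qvs.span_sum, clarify)
      fix i j assume "n = i + j"
      then show "tens [component H i a, component H j b] \<in>
          qvs.span {tens [a, b] | a b i' j'. i' + j' = i + j \<and> a \<in> C \<inter> grade H i' \<and> b \<in> C \<inter> grade H j'}"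
        using p C_subset
        by (intro qvs.span_base) (blast intro: component_in_C component_in_grade)
    qed
    then show "(case p of (a, b) \<Rightarrow> P a b) \<in> ?T" by (simp add: p)
  qed simp
  finally show ?thesis using \<open>cop H h = cop_lift H P h\<close> by simp
qed

lemma graded_space_restrict_grade: "graded_space (restrict_grade H C)"
  and component_restrict_grade: "h \<in> C \<Longrightarrow> component (restrict_grade H C) n h = component H n h"
proof -
  let ?K = "restrict_grade H C"
  have 1: "qvs.subspace (grade ?K n)" for n
    by (simp add: restrict_grade_simps qvs.subspace_inter subspace_C subspace_grade)
  have 2: "linear_onQ (hspace ?K) (component H n)" for n
    using linear_onQ_subset[OF linear_component C_subset] by (simp add: restrict_grade_simps)
  have 3: "component H n h = h" if "h \<in> grade ?K n" for n h
    using that component_grade[of h n n] by (simp add: restrict_grade_simps)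
  have 4: "component H n h = 0" if "h \<in> grade ?K m" "m \<noteq> n" for m n h
    using that component_grade[of h m n] by (simp add: restrict_grade_simps)
  show gs: "graded_space ?K"
    by (rule graded_space_projections[of ?K "component H", OF 1 2 3 4])
  assume "h \<in> C"
  then have "h \<in> hspace ?K" by (simp add: restrict_grade_simps)
  from this is_decomp_projections[of ?K "component H", OF 1 2 3 4 this]
  show "component ?K n h = component H n h"
    by (rule graded_vs.component_unique[OF graded_vs.intro[OF gs]])
qed

lemma graded_coalgebra_restrict_grade: "graded_coalgebra (restrict_grade H C)"
proof -
  let ?K = "restrict_grade H C"
  note T = trilinear_onQ_tens[of "hspace H"]
  have 1: "cop_lift ?K (\<lambda>a b. cop_lift ?K (\<lambda>c d. tens [c, d, b]) a) h =
      cop_lift ?K (\<lambda>a b. cop_lift ?K (\<lambda>c d. tens [a, c, d]) b) h" if h: "h \<in> C" for h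
  proof -
    have "cop_lift ?K (\<lambda>a b. cop_lift ?K (\<lambda>c d. tens [c, d, b]) a) h =
        cop_lift H (\<lambda>a b. cop_lift H (\<lambda>c d. tens [c, d, b]) a) h"
    proof (rule cop_lift_restrict_grade_cong[OF bilinear_cop_lift_left[OF T] h])
      fix a b assume "a \<in> C" "b \<in> C"
      then show "cop_lift ?K (\<lambda>c d. tens [c, d, b]) a = cop_lift H (\<lambda>c d. tens [c, d, b]) a"
        using C_subset by (intro cop_lift_restrict_grade trilinear_onQD[OF T]) auto
    qed
    also have "\<dots> = cop_lift H (\<lambda>a b. cop_lift H (\<lambda>c d. tens [a, c, d]) b) h"
      by (rule cop_lift_coassoc[OF T]) (use h C_subset in auto)
    also have "\<dots> = cop_lift ?K (\<lambda>a b. cop_lift ?K (\<lambda>c d. tens [a, c, d]) b) h"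
    proof (rule cop_lift_restrict_grade_cong[OF bilinear_cop_lift_right[OF T] h, symmetric])
      fix a b assume "a \<in> C" "b \<in> C"
      then show "cop_lift ?K (\<lambda>c d. tens [a, c, d]) b = cop_lift H (\<lambda>c d. tens [a, c, d]) b"
        using C_subset by (intro cop_lift_restrict_grade trilinear_onQD[OF T]) auto
    qed
    finally show ?thesis .
  qed
  have bl: "bilinear_onQ (hspace H) (\<lambda>a b. counit H a *\<^sub>Q b)"
    "bilinear_onQ (hspace H) (\<lambda>a b. counit H b *\<^sub>Q a)"
    by (intro bilinear_onQI linear_onQ_scale_left linear_onQ_scaleQ linear_onQ_id linear_counit)+
  have 2: "cop_lift ?K (\<lambda>a b. counit H a *\<^sub>Q b) h = h" "cop_lift ?K (\<lambda>a b. counit H b *\<^sub>Q a) h = h"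
    if "h \<in> C" for h
    using that C_subset cop_lift_counit_left[OF linear_onQ_id, of h] cop_lift_counit_right[OF linear_onQ_id, of h]
    by (auto simp: cop_lift_restrict_grade bl)
  show ?thesis
    unfolding graded_coalgebra_def restrict_grade_simps
  proof (intro conjI allI ballI impI)
    show "graded_space ?K" by (rule graded_space_restrict_grade)
    show "linear_onQ C (cop H)" "linear_onQ C (counit H)"
      by (rule linear_onQ_subset[OF _ C_subset], rule linear_cop linear_counit)+
    show "cop H h \<in> qvs.span {tens [a, b] | a b i j. i + j = n \<and> a \<in> C \<inter> grade H i \<and> b \<in> C \<inter> grade H j}"
      if "h \<in> C \<inter> grade H n" for n h
      using that by (intro cop_grade_C) auto
    show "counit H h = 0" if "n \<noteq> 0" "h \<in> C \<inter> grade H n" for n h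
      using that counit_grade by blast
  qed (use 1 2 in \<open>simp_all only: cop_lift_def restrict_grade_simps\<close>)
qed

end

subsection \<open>Agreement subcoalgebras\<close>

context graded_coalg
begin

text \<open>An element of the span of the degrees below \<open>k\<close> has no component in any
  other degree, and the components of an element of \<open>C\<close> stay in \<open>C\<close>.
  Agreement may therefore be tested on homogeneous elements.\<close>

lemma agreement_iff:
  assumes \<phi>: "linear_onQ (hspace H) \<phi>" and \<psi>: "linear_onQ (hspace H) \<psi>"
    and C: "graded_subcoalgebra H C"
  shows "(\<forall>h \<in> C \<inter> qvs.span (\<Union>n\<in>{n. below n k}. grade H n). \<phi> h = \<psi> h) \<longleftrightarrow>
    (\<forall>n. below n k \<longrightarrow> (\<forall>h \<in> C \<inter> grade H n. \<phi> h = \<psi> h))" (is "?L \<longleftrightarrow> ?R")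
proof
  assume ?L
  then show ?R by (auto intro!: qvs.span_base)
next
  assume R: ?R
  interpret graded_subcoalg H C by standard (rule C)
  show ?L
  proof
    fix h assume "h \<in> C \<inter> qvs.span (\<Union>n\<in>{n. below n k}. grade H n)"
    then have h: "h \<in> C" "h \<in> qvs.span (\<Union>n\<in>{n. below n k}. grade H n)" by auto
    have sub: "qvs.span (\<Union>n\<in>{n. below n k}. grade H n) \<subseteq> hspace H"
      unfolding hspace_def by (rule qvs.span_mono) auto
    have h': "h \<in> hspace H" using h C_subset by auto
    have z: "component H n h = 0" if "\<not> below n k" for n
    proof -
      have "component H n h \<in> {0}"
        by (rule linear_onQ_image_span[OF linear_onQ_subset[OF linear_component sub] _ _ h(2)])
          (use that in \<open>auto simp: component_grade\<close>)
      then show ?thesis by simp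
    qed
    have eq: "\<phi> (component H n h) = \<psi> (component H n h)" for n
      using R z[of n] component_in_C[OF h(1)] component_in_grade[OF h', of n]
        linear_onQ_zero[OF \<phi> subspace_hspace] linear_onQ_zero[OF \<psi> subspace_hspace]
      by (cases "below n k") auto
    let ?A = "{n. component H n h \<noteq> 0}"
    have "\<phi> (\<Sum>n\<in>?A. component H n h) = \<psi> (\<Sum>n\<in>?A. component H n h)"
      using h' by (simp add: linear_onQ_sum[OF \<phi> subspace_hspace] linear_onQ_sum[OF \<psi> subspace_hspace]
          component_in_hspace eq)
    then show "\<phi> h = \<psi> h"
      using sum_components[OF h' finite_components[OF h']] by simp
  qed
qed

context
  fixes \<phi> \<psi> :: "'h \<Rightarrow> rat" and k :: "enat ^ 'l"
  assumes \<phi>: "linear_onQ (hspace H) \<phi>" and \<psi>: "linear_onQ (hspace H) \<psi>"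
begin

definition agrees :: "'h set \<Rightarrow> bool" where
  "agrees C \<longleftrightarrow> graded_subcoalgebra H C \<and> (\<forall>n. below n k \<longrightarrow> (\<forall>h \<in> C \<inter> grade H n. \<phi> h = \<psi> h))"

text \<open>The sum of all graded subcoalgebras on which the functionals agree is again one of them.
  This is why a largest one exists and \<open>GREATEST\<close> denotes it.\<close>

lemma agrees_span_Union: "agrees (qvs.span (\<Union>{C. agrees C}))" (is "agrees ?U")
proof -
  have C_sub: "C \<subseteq> ?U" if "agrees C" for C
    using that by (auto intro: qvs.span_base)
  have C_hs: "C \<subseteq> hspace H" if "agrees C" for C
    using that unfolding agrees_def graded_subcoalgebra_def by (elim conjE)
  have U: "?U \<subseteq> hspace H"
    by (rule qvs.span_minimal[OF _ subspace_hspace]) (use C_hs in auto)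
  have "graded_subcoalgebra H ?U"
    unfolding graded_subcoalgebra_def
  proof (intro conjI)
    show "?U = qvs.span (\<Union>n. ?U \<inter> grade H n)"
    proof (rule antisym)
      have "C \<subseteq> qvs.span (\<Union>n. ?U \<inter> grade H n)" if "agrees C" for C
      proof -
        have "C = qvs.span (\<Union>n. C \<inter> grade H n)"
          using that unfolding agrees_def graded_subcoalgebra_def by (elim conjE)
        also have "\<dots> \<subseteq> qvs.span (\<Union>n. ?U \<inter> grade H n)"
          by (rule qvs.span_mono) (use C_sub[OF that] in blast)
        finally show ?thesis .
      qed
      then show "?U \<subseteq> qvs.span (\<Union>n. ?U \<inter> grade H n)"
        by (intro qvs.span_minimal) auto
      show "qvs.span (\<Union>n. ?U \<inter> grade H n) \<subseteq> ?U"
        by (rule qvs.span_minimal) auto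
    qed
    have "cop H h \<in> tensor_square ?U" if "h \<in> ?U" for h
    proof (rule linear_onQ_image_span[OF linear_onQ_subset[OF linear_cop U] subspace_tensor_square _ that])
      fix x assume "x \<in> \<Union>{C. agrees C}"
      then obtain C where "x \<in> C" "agrees C" by blast
      then have "cop H x \<in> tensor_square C"
        unfolding agrees_def graded_subcoalgebra_def by blast
      moreover have "tensor_square C \<subseteq> tensor_square ?U"
        using tensor_square_mono[OF C_sub] \<open>agrees C\<close> by blast
      ultimately show "cop H x \<in> tensor_square ?U" by blast
    qed
    then show "cop H ` ?U \<subseteq> tensor_square ?U" by auto
  qed (rule U)
  moreover have "\<phi> h = \<psi> h" if n: "below n k" and h: "h \<in> ?U" "h \<in> grade H n" for n h
  proof -
    \<comment> \<open>An element of \<open>?U\<close> of degree \<open>n\<close> is a combination of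
      elements of various \<open>C\<close> that need not be homogeneous. After projection to degree
      \<open>n\<close> the claim is linear on all of \<open>?U\<close> and can be checked in one
      \<open>C\<close> at a time.\<close>
    have "\<phi> (component H n h) = \<psi> (component H n h)"
    proof (rule linear_onQ_eq_on_span[OF _ _ _ h(1)])
      fix x assume "x \<in> \<Union>{C. agrees C}"
      then obtain C where C: "x \<in> C" "agrees C" by blast
      then interpret graded_subcoalg H C by unfold_locales (simp add: agrees_def)
      have "component H n x \<in> C \<inter> grade H n"
        using C(1) C_subset component_in_C component_in_grade by auto
      then show "\<phi> (component H n x) = \<psi> (component H n x)"
        using C(2) n by (auto simp: agrees_def)
    qed (intro linear_onQ_subset[OF linear_on_component[OF \<phi>] U]
        linear_onQ_subset[OF linear_on_component[OF \<psi>] U])+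
    then show ?thesis using component_grade[OF h(2)] by simp
  qed
  ultimately show ?thesis unfolding agrees_def[of ?U] by blast
qed

lemma agreement_subcoalgebra_eq: "agreement_subcoalgebra H k \<phi> \<psi> = qvs.span (\<Union>{C. agrees C})"
proof -
  have "(\<lambda>C. graded_subcoalgebra H C \<and>
        (\<forall>h \<in> C \<inter> qvs.span (\<Union>n\<in>{n. below n k}. grade H n). \<phi> h = \<psi> h)) = agrees"
    using agreement_iff[OF \<phi> \<psi>] by (auto simp: agrees_def fun_eq_iff)
  then have "agreement_subcoalgebra H k \<phi> \<psi> = (GREATEST C. agrees C)"
    unfolding agreement_subcoalgebra_def by simp
  also have "\<dots> = qvs.span (\<Union>{C. agrees C})"
    by (rule Greatest_equality, rule agrees_span_Union) (auto intro: qvs.span_base)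
  finally show ?thesis .
qed

lemma agreement_subcoalgebra:
  shows graded_subcoalgebra_agreement: "graded_subcoalgebra H (agreement_subcoalgebra H k \<phi> \<psi>)"
    and agreement_subcoalgebra_eqD:
      "below n k \<Longrightarrow> h \<in> agreement_subcoalgebra H k \<phi> \<psi> \<Longrightarrow> h \<in> grade H n \<Longrightarrow> \<phi> h = \<psi> h"
    and subset_agreement_subcoalgebra:
      "graded_subcoalgebra H C \<Longrightarrow> (\<And>n h. below n k \<Longrightarrow> h \<in> C \<Longrightarrow> h \<in> grade H n \<Longrightarrow> \<phi> h = \<psi> h) \<Longrightarrow>
       C \<subseteq> agreement_subcoalgebra H k \<phi> \<psi>"
proof -
  show "graded_subcoalgebra H (agreement_subcoalgebra H k \<phi> \<psi>)"
    using agrees_span_Union unfolding agreement_subcoalgebra_eq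
    by (simp only: agrees_def[of "qvs.span _"])
  show "\<phi> h = \<psi> h" if "below n k" "h \<in> agreement_subcoalgebra H k \<phi> \<psi>" "h \<in> grade H n"
    using agrees_span_Union that unfolding agreement_subcoalgebra_eq agrees_def[of "qvs.span _"] by blast
  assume "graded_subcoalgebra H C" "\<And>n h. below n k \<Longrightarrow> h \<in> C \<Longrightarrow> h \<in> grade H n \<Longrightarrow> \<phi> h = \<psi> h"
  then have "agrees C" by (auto simp: agrees_def)
  then show "C \<subseteq> agreement_subcoalgebra H k \<phi> \<psi>"
    unfolding agreement_subcoalgebra_eq by (auto intro: qvs.span_base)
qed

end

end

subsection \<open>Sub-bialgebras\<close>

context graded_bialg
begin

text \<open>Multiplicativity of the coproduct turns two coproducts with entries in \<open>C\<close>
  into one whose entries are products of elements of \<open>C\<close>. The span is graded because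
  both factors may be taken homogeneous.\<close>

lemma graded_subcoalgebra_products:
  assumes C: "graded_subcoalgebra H C"
  shows "graded_subcoalgebra H (qvs.span {mul H a b | a b. a \<in> C \<and> b \<in> C})"
    (is "graded_subcoalgebra H ?D")
proof -
  interpret C: graded_subcoalg H C by unfold_locales (rule C)
  let ?B = "\<Union>n. C \<inter> grade H n"
  have D: "?D \<subseteq> hspace H"
    by (rule qvs.span_minimal[OF _ subspace_hspace]) (use C.C_subset mul_in_hspace in blast)
  have mul_D: "mul H a b \<in> ?D" if "a \<in> C" "b \<in> C" for a b
    using that by (intro qvs.span_base) blast
  have bil: "bilinear_onQ (qvs.span ?B) (mul H)"
    using bilinear_onQ_subset[OF bilinear_mul C.C_subset] by (simp only: C.C_span[symmetric])
  have "?D \<subseteq> qvs.span (\<Union>n. ?D \<inter> grade H n)"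
  proof (rule qvs.span_minimal)
    have "mul H a b \<in> qvs.span (\<Union>n. ?D \<inter> grade H n)" if "a \<in> C" "b \<in> C" for a b
    proof (rule bilinear_onQ_image_span[OF bil])
      show "a \<in> qvs.span ?B" "b \<in> qvs.span ?B" using that by (simp_all only: C.C_span[symmetric])
      fix x y assume "x \<in> ?B" "y \<in> ?B"
      then obtain m n where *: "x \<in> C" "x \<in> grade H m" "y \<in> C" "y \<in> grade H n" by auto
      then have "mul H x y \<in> ?D \<inter> grade H (m + n)" by (simp add: mul_D mul_in_grade)
      then show "mul H x y \<in> qvs.span (\<Union>n. ?D \<inter> grade H n)" by (blast intro: qvs.span_base)
    qed simp
    then show "{mul H a b | a b. a \<in> C \<and> b \<in> C} \<subseteq> qvs.span (\<Union>n. ?D \<inter> grade H n)" by auto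
  qed simp
  moreover have "qvs.span (\<Union>n. ?D \<inter> grade H n) \<subseteq> ?D"
    by (rule qvs.span_minimal) auto
  moreover have "cop H h \<in> tensor_square ?D" if "h \<in> ?D" for h
  proof (rule linear_onQ_image_span[OF linear_onQ_subset[OF linear_cop D] subspace_tensor_square _ that])
    fix x assume "x \<in> {mul H a b | a b. a \<in> C \<and> b \<in> C}"
    then obtain a b where x: "x = mul H a b" "a \<in> C" "b \<in> C" by blast
    obtain xs where xs: "cop H a = (\<Sum>(a, b)\<leftarrow>xs. tens [a, b])" "\<forall>(a, b)\<in>set xs. a \<in> C \<and> b \<in> C"
      by (rule C.cop_C_sum_list[OF x(2)])
    obtain ys where ys: "cop H b = (\<Sum>(a, b)\<leftarrow>ys. tens [a, b])" "\<forall>(a, b)\<in>set ys. a \<in> C \<and> b \<in> C"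
      by (rule C.cop_C_sum_list[OF x(3)])
    have "cop H x = (\<Sum>(c, d)\<leftarrow>xs. \<Sum>(c', d')\<leftarrow>ys. tens [mul H c c', mul H d d'])"
      unfolding x(1) by (rule cop_mul_sum_list) (use x xs ys C.C_subset in auto)
    also have "\<dots> \<in> tensor_square ?D"
      using xs(2) ys(2)
      by (intro subspace_sum_list[OF subspace_tensor_square])
        (auto intro!: subspace_sum_list[OF subspace_tensor_square] tens_in_tensor_square mul_D)
    finally show "cop H x \<in> tensor_square ?D" .
  qed
  ultimately show ?thesis
    using D unfolding graded_subcoalgebra_def by blast
qed

lemma graded_subcoalgebra_one: "graded_subcoalgebra H (qvs.span {one H})"
proof -
  have D: "qvs.span {one H} \<subseteq> hspace H"
    by (rule qvs.span_minimal[OF _ subspace_hspace]) (simp add: one_in_hspace)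
  have "one H \<in> qvs.span {one H} \<inter> grade H 0" by (simp add: qvs.span_base one_in_grade)
  then have "qvs.span {one H} \<subseteq> qvs.span (\<Union>n. qvs.span {one H} \<inter> grade H n)"
    by (intro qvs.span_mono) blast
  moreover have "qvs.span (\<Union>n. qvs.span {one H} \<inter> grade H n) \<subseteq> qvs.span {one H}"
    by (rule qvs.span_minimal) auto
  moreover have "cop H h \<in> tensor_square (qvs.span {one H})" if "h \<in> qvs.span {one H}" for h
    by (rule linear_onQ_image_span[OF linear_onQ_subset[OF linear_cop D] subspace_tensor_square _ that])
      (auto simp: cop_one intro!: tens_in_tensor_square qvs.span_base)
  ultimately show ?thesis
    using D unfolding graded_subcoalgebra_def by blast
qed

lemma graded_bialgebra_restrict_grade:
  assumes C: "graded_subcoalgebra H C" and one: "one H \<in> C"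
    and mul: "\<And>a b. a \<in> C \<Longrightarrow> b \<in> C \<Longrightarrow> mul H a b \<in> C"
  shows "graded_bialgebra (restrict_grade H C)"
proof -
  interpret C: graded_subcoalg H C by unfold_locales (rule C)
  let ?K = "restrict_grade H C"
  have simps: "mul ?K = mul H" "one ?K = one H" by (simp_all add: restrict_grade_def)
  have alg: "graded_algebra ?K"
    unfolding graded_algebra_def
    using C.graded_space_restrict_grade C.C_subset
    by (auto simp: C.restrict_grade_simps simps one mul mul_in_grade one_in_grade mul_one_left mul_one_right
        subset_iff intro!: mul_assoc linear_onQ_subset[OF linear_mul_left C.C_subset]
        linear_onQ_subset[OF linear_mul_right C.C_subset])
  have "cop H (mul H a b) = mul2 ?K (cop H a) (cop H b)" if ab: "a \<in> C" "b \<in> C" for a b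
  proof -
    have ab': "a \<in> hspace H" "b \<in> hspace H" using ab C.C_subset by auto
    have "cop_lift ?K (\<lambda>c d. cop_lift ?K (\<lambda>c' d'. tens [mul H c c', mul H d d']) b) a =
        cop_lift H (\<lambda>c d. cop_lift H (\<lambda>c' d'. tens [mul H c c', mul H d d']) b) a"
    proof (rule C.cop_lift_restrict_grade_cong[OF bilinear_cop_lift_mul[OF bilinear_onQ_tens ab'(2)] ab(1)])
      fix c d assume "c \<in> C" "d \<in> C"
      then show "cop_lift ?K (\<lambda>c' d'. tens [mul H c c', mul H d d']) b =
          cop_lift H (\<lambda>c' d'. tens [mul H c c', mul H d d']) b"
        using C.C_subset by (intro C.cop_lift_restrict_grade bilinear_mul_args[OF bilinear_onQ_tens] ab) auto
    qed
    then show ?thesis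
      using cop_mul[OF ab'] by (simp add: mul2_def cop_lift_def C.restrict_grade_simps simps)
  qed
  then show ?thesis
    unfolding graded_bialgebra_def
    using alg C.graded_coalgebra_restrict_grade C.C_subset
    by (auto simp: C.restrict_grade_simps simps cop_one counit_one counit_mul subset_iff)
qed

end

subsection \<open>Coalgebra morphisms\<close>

locale coalg_hom = graded_coalg H + K: graded_coalg K
  for H :: "('h::rat_vector, 'l::finite, 'm) gcoalg_scheme"
    and K :: "('k::rat_vector, 'l, 'n) gcoalg_scheme" +
  fixes \<Psi> :: "'h \<Rightarrow> 'k"
  assumes hom: "graded_coalgebra_hom H K \<Psi>"
begin

lemma linear_\<Psi>: "linear_onQ (hspace H) \<Psi>"
  and \<Psi>_grade: "h \<in> grade H n \<Longrightarrow> \<Psi> h \<in> grade K n"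
  and cop_\<Psi>: "h \<in> hspace H \<Longrightarrow> cop K (\<Psi> h) = cop_lift H (\<lambda>a b. tens [\<Psi> a, \<Psi> b]) h"
  and counit_\<Psi>: "h \<in> hspace H \<Longrightarrow> counit K (\<Psi> h) = counit H h"
  using hom by (auto simp: graded_coalgebra_hom_def cop_lift_def)

lemma \<Psi>_hspace: "h \<in> hspace H \<Longrightarrow> \<Psi> h \<in> hspace K"
  by (rule linear_onQ_image_hspace[OF linear_\<Psi> subspace_hspace])
    (auto intro: grade_in_hspace \<Psi>_grade)

lemma bilinear_\<Psi>: "bilinear_onQ (hspace K) g \<Longrightarrow> bilinear_onQ (hspace H) (\<lambda>a b. g (\<Psi> a) (\<Psi> b))"
  by (rule bilinear_onQ_args) (auto simp: linear_\<Psi> \<Psi>_hspace)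

text \<open>Compatibility of \<Psi> with the coproducts, tested against a bilinear map. This is the
  form in which convolution products and the recursion for coefficients are transported along
  \<Psi>.\<close>

lemma cop_lift_\<Psi>:
  assumes g: "bilinear_onQ (hspace K) g" and h: "h \<in> hspace H"
  shows "cop_lift K g (\<Psi> h) = cop_lift H (\<lambda>a b. g (\<Psi> a) (\<Psi> b)) h"
proof -
  let ?L = "tensor_lift2 (hspace K) g"
  have "cop_lift K g (\<Psi> h) = ?L (cop_lift H (\<lambda>a b. tens [\<Psi> a, \<Psi> b]) h)"
    by (simp add: cop_lift_def[of K] cop_\<Psi>[OF h])
  also have "\<dots> = cop_lift H (\<lambda>a b. ?L (tens [\<Psi> a, \<Psi> b])) h"
    by (rule cop_lift_compose[OF bilinear_\<Psi>[OF bilinear_onQ_tens] linear_onQ_tensor_lift2[OF subspace_hspace g]])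
      (auto simp: h)
  also have "\<dots> = cop_lift H (\<lambda>a b. g (\<Psi> a) (\<Psi> b)) h"
    by (rule cop_lift_cong[symmetric])
      (simp add: tensor_lift2_tens[OF subspace_hspace g] \<Psi>_hspace)
  finally show ?thesis .
qed

lemma conv_\<Psi>:
  assumes "linear_onQ (hspace K) \<phi>" "linear_onQ (hspace K) \<psi>" "h \<in> hspace H"
  shows "conv K \<phi> \<psi> (\<Psi> h) = conv H (\<lambda>x. \<phi> (\<Psi> x)) (\<lambda>x. \<psi> (\<Psi> x)) h"
  unfolding conv_eq_cop_lift by (intro cop_lift_\<Psi> bilinear_onQ_mult assms)

lemma linear_comp_\<Psi>: "linear_onQ (hspace K) f \<Longrightarrow> linear_onQ (hspace H) (\<lambda>x. f (\<Psi> x))"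
  by (rule linear_onQ_compose[OF _ linear_\<Psi>]) (auto simp: \<Psi>_hspace)

lemma is_conv_inverse_\<Psi>:
  assumes "linear_onQ (hspace K) \<phi>" "is_conv_inverse K \<phi> \<psi>"
  shows "is_conv_inverse H (\<lambda>x. \<phi> (\<Psi> x)) (\<lambda>x. \<psi> (\<Psi> x))"
  using assms conv_\<Psi>[of \<phi> \<psi>] conv_\<Psi>[of \<psi> \<phi>]
  by (auto simp: is_conv_inverse_def linear_comp_\<Psi> \<Psi>_hspace counit_\<Psi>)

lemma graded_subcoalgebra_image: "graded_subcoalgebra K (\<Psi> ` hspace H)"
proof -
  have sub: "qvs.subspace (\<Psi> ` hspace H)"
  proof (rule qvs.subspaceI)
    show "0 \<in> \<Psi> ` hspace H"
      using linear_onQ_zero[OF linear_\<Psi> subspace_hspace] qvs.subspace_0[OF subspace_hspace] by force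
    fix x y assume "x \<in> \<Psi> ` hspace H" "y \<in> \<Psi> ` hspace H"
    then obtain a b where ab: "a \<in> hspace H" "b \<in> hspace H" "x = \<Psi> a" "y = \<Psi> b" by auto
    then have "x + y = \<Psi> (a + b)" by (simp add: linear_onQ_add[OF linear_\<Psi>])
    then show "x + y \<in> \<Psi> ` hspace H" using ab qvs.subspace_add[OF subspace_hspace] by blast
  next
    fix c x assume "x \<in> \<Psi> ` hspace H"
    then obtain a where a: "a \<in> hspace H" "x = \<Psi> a" by auto
    then have "c *\<^sub>Q x = \<Psi> (c *\<^sub>Q a)" by (simp add: linear_onQ_scale[OF linear_\<Psi>])
    then show "c *\<^sub>Q x \<in> \<Psi> ` hspace H" using a qvs.subspace_scale[OF subspace_hspace] by blast
  qed
  have "\<Psi> h \<in> qvs.span (\<Union>n. \<Psi> ` hspace H \<inter> grade K n)" if "h \<in> hspace H" for h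
  proof (rule linear_onQ_image_hspace[OF linear_\<Psi> _ _ that])
    fix n x assume "x \<in> grade H n"
    then have "\<Psi> x \<in> \<Psi> ` hspace H \<inter> grade K n" by (simp add: \<Psi>_grade grade_in_hspace)
    then show "\<Psi> x \<in> qvs.span (\<Union>n. \<Psi> ` hspace H \<inter> grade K n)" by (blast intro: qvs.span_base)
  qed simp
  moreover have "qvs.span (\<Union>n. \<Psi> ` hspace H \<inter> grade K n) \<subseteq> \<Psi> ` hspace H"
    by (rule qvs.span_minimal[OF _ sub]) auto
  moreover have "cop K (\<Psi> h) \<in> tensor_square (\<Psi> ` hspace H)" if "h \<in> hspace H" for h
    unfolding cop_\<Psi>[OF that]
    by (rule cop_lift_in[OF bilinear_\<Psi>[OF bilinear_onQ_tens] subspace_tensor_square that])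
      (auto intro: tens_in_tensor_square)
  ultimately show ?thesis
    unfolding graded_subcoalgebra_def using \<Psi>_hspace by blast
qed

end

section \<open>Bialgebra maps commute with antipodes\<close>

lemma is_antipode_hom_into:
  assumes "is_antipode H S"
  shows "hom_into H H S"
proof -
  have lin: "linear_onQ (hspace H) S" and "S ` grade H n \<subseteq> grade H n" for n
    using assms by (auto simp: is_antipode_def)
  then have "S h \<in> hspace H" if "h \<in> hspace H" for h
    by (intro linear_onQ_image_hspace[OF lin subspace_hspace _ that]) (auto intro: grade_in_hspace)
  with lin show ?thesis by (auto simp: hom_into_def)
qed

text \<open>In the convolution monoid of maps from \<open>H\<close> to \<open>K\<close>, the map
  \<Psi> after \<open>S\<close> is a left inverse of \<Psi> and the map \<open>S'\<close> after
  \<Psi> is a right inverse, so they coincide.\<close>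

lemma hom_antipode:
  assumes H: "graded_bialgebra H" and K: "graded_bialgebra K" and hom: "graded_coalgebra_hom H K \<Psi>"
    and one: "\<Psi> (one H) = one K"
    and mul: "\<And>a b. a \<in> hspace H \<Longrightarrow> b \<in> hspace H \<Longrightarrow> \<Psi> (mul H a b) = mul K (\<Psi> a) (\<Psi> b)"
    and S: "is_antipode H S" and S': "is_antipode K S'" and h: "h \<in> hspace H"
  shows "\<Psi> (S h) = S' (\<Psi> h)"
proof -
  interpret H: graded_bialg H by unfold_locales (rule H)
  interpret K: graded_bialg K by unfold_locales (rule K)
  interpret \<Psi>: coalg_hom H K \<Psi> by unfold_locales (rule hom)
  interpret HK: hom_convolution H K by unfold_locales
  have S_in: "S x \<in> hspace H" if "x \<in> hspace H" for x
    using is_antipode_hom_into[OF S] that by (auto simp: hom_into_def)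
  have S'_in: "S' x \<in> hspace K" if "x \<in> hspace K" for x
    using is_antipode_hom_into[OF S'] that by (auto simp: hom_into_def)
  have lin_S: "linear_onQ (hspace H) S" "linear_onQ (hspace K) S'"
    using S S' by (auto simp: is_antipode_def)
  have into: "hom_into H K \<Psi>" "hom_into H K (\<lambda>x. \<Psi> (S x))" "hom_into H K (\<lambda>x. S' (\<Psi> x))"
    using S_in S'_in
    by (auto simp: hom_into_def \<Psi>.linear_\<Psi> \<Psi>.\<Psi>_hspace \<Psi>.linear_comp_\<Psi> lin_S
        intro: linear_onQ_compose[OF \<Psi>.linear_\<Psi>])
  show ?thesis
  proof (rule HK.hom_conv_inverse_unique[OF into h])
    fix x assume x: "x \<in> hspace H"
    have bl: "bilinear_onQ (hspace H) (\<lambda>a b. mul H (S a) b)"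
      by (rule H.bilinear_mul_hom[OF is_antipode_hom_into[OF S] H.hom_into_id])
    have "hom_conv H K (\<lambda>x. \<Psi> (S x)) \<Psi> x = cop_lift H (\<lambda>a b. \<Psi> (mul H (S a) b)) x"
      unfolding hom_conv_def
      by (rule cop_lift_cong) (simp add: mul S_in)
    also have "\<dots> = \<Psi> (cop_lift H (\<lambda>a b. mul H (S a) b) x)"
      by (rule H.cop_lift_compose[symmetric, OF bl \<Psi>.linear_\<Psi> subspace_hspace _ x])
        (simp add: S_in H.mul_in_hspace)
    also have "\<dots> = \<Psi> (counit H x *\<^sub>Q one H)"
      using S x by (simp add: is_antipode_def cop_lift_def)
    also have "\<dots> = hom_unit H K x"
      by (simp add: hom_unit_def linear_onQ_scale[OF \<Psi>.linear_\<Psi> H.one_in_hspace] one)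
    finally show "hom_conv H K (\<lambda>x. \<Psi> (S x)) \<Psi> x = hom_unit H K x" .
    have bl: "bilinear_onQ (hspace K) (\<lambda>a b. mul K a (S' b))"
      by (rule K.bilinear_mul_hom[OF K.hom_into_id is_antipode_hom_into[OF S']])
    have "hom_conv H K \<Psi> (\<lambda>x. S' (\<Psi> x)) x = cop_lift K (\<lambda>a b. mul K a (S' b)) (\<Psi> x)"
      unfolding hom_conv_def by (rule \<Psi>.cop_lift_\<Psi>[symmetric, OF bl x])
    also have "\<dots> = counit K (\<Psi> x) *\<^sub>Q one K"
      using S' \<Psi>.\<Psi>_hspace[OF x] by (simp add: is_antipode_def cop_lift_def)
    also have "\<dots> = hom_unit H K x"
      by (simp add: hom_unit_def \<Psi>.counit_\<Psi>[OF x])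
    finally show "hom_conv H K \<Psi> (\<lambda>x. S' (\<Psi> x)) x = hom_unit H K x" .
  qed
qed

section \<open>Quasi-shuffles and deconcatenation\<close>

text \<open>The quasi-shuffle, or overlapping shuffle, of two words: the last branch merges the two
  leading letters. A list of words is returned because multiplicities are the coefficients of the
  product of two \<open>M\<close>.\<close>

fun qshuffle :: "'a::plus list \<Rightarrow> 'a list \<Rightarrow> 'a list list" where
  "qshuffle [] J = [J]"
| "qshuffle (a # I) [] = [a # I]"
| "qshuffle (a # I) (b # J) =
     map ((#) a) (qshuffle I (b # J)) @ map ((#) b) (qshuffle (a # I) J) @
     map ((#) (a + b)) (qshuffle I J)"

text \<open>All deconcatenations, by recursion on the word; \<open>sum_splits\<close> matches them
  with the indexed sum in the coproduct of \<open>QSym\<close>, while inductions use this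
  form.\<close>

fun splits :: "'a list \<Rightarrow> ('a list \<times> 'a list) list" where
  "splits [] = [([], [])]"
| "splits (a # I) = ([], a # I) # map (\<lambda>(A, B). (a # A, B)) (splits I)"

lemma qshuffle_Nil_right [simp]: "qshuffle I [] = [I]"
  by (cases I) auto

lemma set_splits: "(A, B) \<in> set (splits I) \<longleftrightarrow> A @ B = I"
  by (induction I arbitrary: A B) (auto simp: append_eq_Cons_conv)

lemma sum_splits: "(\<Sum>(A, B)\<leftarrow>splits I. f A B) = (\<Sum>r\<le>length I. f (take r I) (drop r I))"
proof (induction I arbitrary: f)
  case (Cons a I)
  from Cons[of "\<lambda>A. f (a # A)"] show ?case
    by (simp add: sum.atMost_Suc_shift o_def case_prod_beta' del: sum.atMost_Suc)
qed simp

lemma sum_splits_coassoc: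
  "(\<Sum>(A, B)\<leftarrow>splits I. \<Sum>(C, D)\<leftarrow>splits A. f C D B) =
   (\<Sum>(A, B)\<leftarrow>splits I. \<Sum>(C, D)\<leftarrow>splits B. (f A C D :: 'b::comm_monoid_add))"
proof (induction I arbitrary: f)
  case (Cons a I)
  from Cons[of "\<lambda>A. f (a # A)"] show ?case
    by (simp add: o_def case_prod_beta' sum_list_addf add.assoc)
qed simp

text \<open>The combinatorial core of the bialgebra axiom. A deconcatenation of \<open>c # K\<close>
  either has an empty prefix or puts \<open>c\<close> in front of a prefix of \<open>K\<close>, so
  the induction uses \<open>f\<close> with the leading letter \<open>a\<close>, \<open>b\<close> or
  \<open>a + b\<close> absorbed into its first argument.\<close>

lemma sum_qshuffle_splits:
  "(\<Sum>K\<leftarrow>qshuffle I J. \<Sum>(X, Y)\<leftarrow>splits K. f X Y) =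
   (\<Sum>(A, B)\<leftarrow>splits I. \<Sum>(C, D)\<leftarrow>splits J. \<Sum>X\<leftarrow>qshuffle A C. \<Sum>Y\<leftarrow>qshuffle B D.
      (f X Y :: 'b::comm_monoid_add))"
proof (induction I J arbitrary: f rule: qshuffle.induct)
  case (3 a I b J)
  show ?case
    using 3(1)[of "\<lambda>X. f (a # X)"] 3(2)[of "\<lambda>X. f (b # X)"] 3(3)[of "\<lambda>X. f ((a + b) # X)"]
    by (simp add: o_def case_prod_beta' sum_list_addf ac_simps)
qed (simp_all add: case_prod_beta')

lemma sum_list_qshuffle: "K \<in> set (qshuffle I J) \<Longrightarrow> sum_list K = sum_list I + sum_list (J :: 'a::comm_monoid_add list)"
  by (induction I J arbitrary: K rule: qshuffle.induct) (auto simp: ac_simps)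

lemma vec_add_eq_0_iff: "a + b = 0 \<longleftrightarrow> a = 0 \<and> b = (0 :: nat ^ 'l::finite)"
  by (auto simp: vec_eq_iff)

lemma zero_notin_qshuffle:
  assumes "0 \<notin> set I" "0 \<notin> set J" "K \<in> set (qshuffle I J)"
  shows "0 \<notin> set (K :: (nat ^ 'l::finite) list)"
  using assms
proof (induction I J arbitrary: K rule: qshuffle.induct)
  case (3 a I b J)
  have ab: "0 \<noteq> a" "0 \<noteq> b" "0 \<noteq> a + b"
    using 3(4,5) vec_add_eq_0_iff[of a b] by force+
  from 3(6) consider K' where "K = a # K'" "K' \<in> set (qshuffle I (b # J))"
    | K' where "K = b # K'" "K' \<in> set (qshuffle (a # I) J)"
    | K' where "K = (a + b) # K'" "K' \<in> set (qshuffle I J)"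
    by auto
  then show ?case
  proof cases
    case 1
    have "0 \<notin> set K'" by (rule 3(1)) (use 3(4,5) 1 in simp_all)
    with 1 ab show ?thesis by simp
  next
    case 2
    have "0 \<notin> set K'" by (rule 3(2)) (use 3(4,5) 2 in simp_all)
    with 2 ab show ?thesis by simp
  next
    case c: 3
    have "0 \<notin> set K'" by (rule 3(3)) (use 3(4,5) c in simp_all)
    with c ab show ?thesis by simp
  qed
qed simp_all

lemma qshuffle_length: "K \<in> set (qshuffle I J) \<Longrightarrow> length I \<le> length K \<and> length J \<le> length K"
  by (induction I J arbitrary: K rule: qshuffle.induct) fastforce+

text \<open>The signed count of the merged branch is opposite to that of each of the two unmerged
  ones and cancels one of them. This identity makes the inverse of \<open>zetaQ\<close>
  multiplicative.\<close>

lemma qshuffle_sign: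
  "(\<Sum>K\<leftarrow>qshuffle I J. (- 1) ^ length K) = (- 1) ^ length I * ((- 1) ^ length J :: rat)"
proof (induction I J rule: qshuffle.induct)
  case (3 a I b J)
  have "(\<Sum>K\<leftarrow>qshuffle (a # I) (b # J). (- 1) ^ length K :: rat) =
      - (\<Sum>K\<leftarrow>qshuffle I (b # J). (- 1) ^ length K) - (\<Sum>K\<leftarrow>qshuffle (a # I) J. (- 1) ^ length K)
      - (\<Sum>K\<leftarrow>qshuffle I J. (- 1) ^ length K)"
    by (simp add: o_def uminus_sum_list_map[unfolded o_def])
  then show ?case unfolding 3 by simp
qed auto

lemma sum_list_zero: "(\<And>x. x \<in> set xs \<Longrightarrow> f x = 0) \<Longrightarrow> (\<Sum>x\<leftarrow>xs. f x) = (0 :: 'b::monoid_add)"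
  by (induction xs) auto

lemma qshuffle_counit:
  "(\<Sum>K\<leftarrow>qshuffle I J. if K = [] then 1 else 0) =
   (if I = [] then 1 else 0) * (if J = [] then 1 else 0 :: rat)"
  by (cases "(I, J)" rule: qshuffle.cases) (auto simp: o_def)

text \<open>For two nonempty words the unmerged branches only contain words of length at least two,
  and a merged word has length one exactly when both words are single letters.\<close>

lemma qshuffle_zeta:
  "(\<Sum>K\<leftarrow>qshuffle I J. if length K \<le> 1 then 1 else 0) =
   (if length I \<le> 1 then 1 else 0) * (if length J \<le> 1 then 1 else 0 :: rat)"
proof (cases "(I, J)" rule: qshuffle.cases)
  case (3 a I' b J')
  have "(\<Sum>K\<leftarrow>qshuffle I' (b # J'). if length K = 0 then 1 else 0 :: rat) = 0"
    "(\<Sum>K\<leftarrow>qshuffle (a # I') J'. if length K = 0 then 1 else 0 :: rat) = 0"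
    by (rule sum_list_zero, use qshuffle_length in force)+
  then show ?thesis
    using 3 qshuffle_counit[of I' J'] by (auto simp: o_def)
qed auto

section \<open>Monomial quasisymmetric functions\<close>

lemma lookup_xpow: "Poly_Mapping.lookup (xpow j n) (j', i) = (if j = j' then n $ i else 0)"
  unfolding xpow_def lookup_sum lookup_single by (cases "j = j'") (auto simp: when_def)

lemma xpow_add: "xpow j (m + n) = xpow j m + xpow j n"
  by (simp add: xpow_def single_add sum.distrib)

definition word_monomial :: "nat list \<Rightarrow> (nat ^ 'l::finite) list \<Rightarrow> 'l monomial" where
  "word_monomial js I = (\<Sum>(j, n)\<leftarrow>zip js I. xpow j n)"

lemma word_monomial_simps [simp]:
  "word_monomial [] I = 0" "word_monomial js [] = 0"
  "word_monomial (j # js) (n # I) = xpow j n + word_monomial js I"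
  by (simp_all add: word_monomial_def)

text \<open>The polynomial obtained from \<open>M I\<close> by keeping only the variables \<open>x\<^sub>v\<close> with \<open>v\<close> in a list.\<close>

fun M_trunc :: "nat list \<Rightarrow> (nat ^ 'l::finite) list \<Rightarrow> 'l monomial \<Rightarrow>\<^sub>0 rat" where
  "M_trunc vs [] = 1"
| "M_trunc [] (a # I) = 0"
| "M_trunc (v # vs) (a # I) =
     M_trunc vs (a # I) + Poly_Mapping.single (xpow v a) 1 * M_trunc vs I"

text \<open>For a variable \<open>v\<close> the product of the two recursions has four terms:
  \<open>v\<close> occurs in neither factor, in one of them, or in both. In the last case the two
  powers combine to the exponent \<open>a + b\<close>, and the three terms with \<open>v\<close>
  match the three branches of the quasi-shuffle.\<close>

lemma M_trunc_mult: "M_trunc vs I * M_trunc vs J = (\<Sum>K\<leftarrow>qshuffle I J. M_trunc vs K)"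
proof (induction vs arbitrary: I J)
  case Nil
  show ?case by (cases "(I, J)" rule: qshuffle.cases) (auto simp: o_def)
next
  case (Cons v vs)
  show ?case
  proof (cases "(I, J)" rule: qshuffle.cases)
    case (3 a I' b J')
    let ?X = "\<lambda>a. Poly_Mapping.single (xpow v a) (1 :: rat)"
    have X: "?X a * ?X b = ?X (a + b)" by (simp add: mult_single xpow_add)
    have "M_trunc (v # vs) I * M_trunc (v # vs) J =
        M_trunc vs (a # I') * M_trunc vs (b # J') + ?X a * (M_trunc vs I' * M_trunc vs (b # J')) +
        ?X b * (M_trunc vs (a # I') * M_trunc vs J') + (?X a * ?X b) * (M_trunc vs I' * M_trunc vs J')"
      using 3 by (simp add: algebra_simps)
    also have "\<dots> = (\<Sum>K\<leftarrow>qshuffle I J. M_trunc (v # vs) K)"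
      unfolding Cons.IH X using 3
      by (simp add: o_def sum_list_addf sum_list_const_mult add.assoc)
    finally show ?thesis .
  qed auto
qed

definition increasing_words :: "nat list \<Rightarrow> nat \<Rightarrow> nat list set" where
  "increasing_words vs m = {js. length js = m \<and> sorted_wrt (<) js \<and> set js \<subseteq> set vs}"

lemma finite_increasing_words: "finite (increasing_words vs m)"
  by (rule finite_subset[OF _ finite_lists_length_eq[of "set vs" m]]) (auto simp: increasing_words_def)

lemma increasing_words_Cons:
  assumes "sorted_wrt (<) (v # vs)"
  shows "increasing_words (v # vs) (Suc m) =
    increasing_words vs (Suc m) \<union> (#) v ` increasing_words vs m"
proof (intro set_eqI iffI)
  fix js assume js: "js \<in> increasing_words (v # vs) (Suc m)"
  then obtain j js' where j: "js = j # js'" by (cases js) (auto simp: increasing_words_def)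
  have j': "length js' = m" "sorted_wrt (<) js'" "\<forall>x\<in>set js'. j < x" "\<forall>x\<in>set js'. x = v \<or> x \<in> set vs"
    "j = v \<or> j \<in> set vs"
    using js by (auto simp: j increasing_words_def)
  have v: "\<forall>x\<in>set vs. v < x" using assms by simp
  have "\<forall>x\<in>set js'. v < x" using j'(3,5) v by force
  then have "set js' \<subseteq> set vs" using j'(4) by (metis less_irrefl subsetI)
  then show "js \<in> increasing_words vs (Suc m) \<union> (#) v ` increasing_words vs m"
    using j' by (auto simp: j increasing_words_def)
next
  fix js assume "js \<in> increasing_words vs (Suc m) \<union> (#) v ` increasing_words vs m"
  then show "js \<in> increasing_words (v # vs) (Suc m)"
    using assms by (auto simp: increasing_words_def subset_iff)
qed

lemma M_trunc_eq_sum: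
  "sorted_wrt (<) vs \<Longrightarrow>
   M_trunc vs I = (\<Sum>js\<in>increasing_words vs (length I). Poly_Mapping.single (word_monomial js I) 1)"
proof (induction vs I rule: M_trunc.induct)
  case (1 vs)
  have "increasing_words vs 0 = {[]}" by (auto simp: increasing_words_def)
  then show ?case by simp
next
  case (2 a I)
  have "increasing_words [] (Suc (length I)) = {}" by (auto simp: increasing_words_def)
  then show ?case by simp
next
  case (3 v vs a I)
  have disj: "increasing_words vs (Suc (length I)) \<inter> (#) v ` increasing_words vs (length I) = {}"
    using 3(3) by (auto simp: increasing_words_def)
  have "(\<Sum>js\<in>increasing_words (v # vs) (Suc (length I)). Poly_Mapping.single (word_monomial js (a # I)) (1::rat))
      = (\<Sum>js\<in>increasing_words vs (Suc (length I)). Poly_Mapping.single (word_monomial js (a # I)) 1) +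
        (\<Sum>js\<in>increasing_words vs (length I). Poly_Mapping.single (word_monomial (v # js) (a # I)) 1)"
    unfolding increasing_words_Cons[OF 3(3)]
    by (subst sum.union_disjoint) (auto simp: finite_increasing_words disj sum.reindex)
  also have "\<dots> = M_trunc (v # vs) (a # I)"
    using 3 by (simp add: sum_distrib_left mult_single)
  finally show ?case by simp
qed

text \<open>A nonzero letter leaves a trace of its variable in the monomial, so the monomial bounds
  the index words that can produce it. With a zero letter infinitely many index words could give the
  same monomial.\<close>

lemma keys_word_monomial:
  assumes "0 \<notin> set I" "length js = length I"
  shows "set js \<subseteq> fst ` Poly_Mapping.keys (word_monomial js I)"
  using assms
proof (induction I arbitrary: js)
  case (Cons n I)
  then obtain j js' where js: "js = j # js'" by (cases js) auto
  obtain i where "n $ i \<noteq> 0" using Cons.prems by (auto simp: vec_eq_iff)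
  then have "(j, i) \<in> Poly_Mapping.keys (word_monomial js (n # I))"
    by (simp add: js in_keys_iff lookup_add lookup_xpow)
  moreover have "Poly_Mapping.keys (word_monomial js' I) \<subseteq> Poly_Mapping.keys (word_monomial js (n # I))"
    by (auto simp: js in_keys_iff lookup_add)
  ultimately show ?case using Cons js by force
qed auto

section \<open>Truncation of power series to finitely many variables\<close>

definition vars_below :: "nat \<Rightarrow> 'l monomial \<Rightarrow> bool" where
  "vars_below N \<mu> \<longleftrightarrow> fst ` Poly_Mapping.keys \<mu> \<subseteq> {..<N}"

lemma vars_below_ex: "\<exists>N. vars_below N \<mu>"
  unfolding vars_below_def using finite_nat_iff_bounded[of "fst ` Poly_Mapping.keys \<mu>"] by simp

lemma vars_below_add: "vars_below N (\<alpha> + \<beta>) \<Longrightarrow> vars_below N \<alpha> \<and> vars_below N \<beta>"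
  unfolding vars_below_def by (auto simp: in_keys_iff lookup_add image_subset_iff)

lemma M_eq_lookup:
  assumes "0 \<notin> set I" "vars_below N \<mu>"
  shows "M I \<mu> = Poly_Mapping.lookup (M_trunc [0..<N] I) \<mu>"
proof -
  have "{js. length js = length I \<and> sorted_wrt (<) js \<and> word_monomial js I = \<mu>} =
      {js \<in> increasing_words [0..<N] (length I). word_monomial js I = \<mu>}"
    using keys_word_monomial[OF assms(1)] assms(2)
    by (auto simp: increasing_words_def vars_below_def subset_iff image_iff)
  then have "M I \<mu> = of_nat (card {js \<in> increasing_words [0..<N] (length I). word_monomial js I = \<mu>})"
    by (simp add: M_def word_monomial_def)
  also have "\<dots> = (\<Sum>js\<in>increasing_words [0..<N] (length I). if word_monomial js I = \<mu> then 1 else 0)"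
    by (simp add: sum.If_cases finite_increasing_words Int_def)
  also have "\<dots> = Poly_Mapping.lookup (M_trunc [0..<N] I) \<mu>"
    by (simp add: M_trunc_eq_sum lookup_sum lookup_single when_def)
  finally show ?thesis .
qed

lemma finite_monomial_splits: "finite {(\<alpha>, \<beta>). \<alpha> + \<beta> = (\<mu> :: 'l monomial)}"
proof -
  let ?B = "\<Union>x\<in>Poly_Mapping.keys \<mu>. {..Poly_Mapping.lookup \<mu> x}"
  let ?F = "{f. \<forall>x. (x \<in> Poly_Mapping.keys \<mu> \<longrightarrow> f x \<in> ?B) \<and> (x \<notin> Poly_Mapping.keys \<mu> \<longrightarrow> f x = 0)}"
  have "finite ?F" by (rule finite_set_of_finite_funs) auto
  moreover have "Poly_Mapping.lookup ` {\<alpha>. \<exists>\<beta>. \<alpha> + \<beta> = \<mu>} \<subseteq> ?F"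
  proof clarify
    fix \<alpha> \<beta> x assume \<mu>: "\<mu> = \<alpha> + \<beta>"
    then have "Poly_Mapping.lookup \<alpha> x \<le> Poly_Mapping.lookup \<mu> x" by (simp add: lookup_add)
    then show "(x \<in> Poly_Mapping.keys (\<alpha> + \<beta>) \<longrightarrow> Poly_Mapping.lookup \<alpha> x \<in>
          (\<Union>x\<in>Poly_Mapping.keys (\<alpha> + \<beta>). {..Poly_Mapping.lookup (\<alpha> + \<beta>) x})) \<and>
        (x \<notin> Poly_Mapping.keys (\<alpha> + \<beta>) \<longrightarrow> Poly_Mapping.lookup \<alpha> x = 0)"
      unfolding \<mu> by (auto simp: in_keys_iff)
  qed
  ultimately have "finite (Poly_Mapping.lookup ` {\<alpha>. \<exists>\<beta>. \<alpha> + \<beta> = \<mu>})" by (rule finite_subset[rotated])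
  then have fin: "finite {\<alpha>. \<exists>\<beta>. \<alpha> + \<beta> = \<mu>}"
    by (rule finite_imageD) (simp add: inj_on_def lookup_inject)
  show ?thesis
  proof (rule finite_subset[OF _ finite_cartesian_product[OF fin fin]])
    show "{(\<alpha>, \<beta>). \<alpha> + \<beta> = \<mu>} \<subseteq> {\<alpha>. \<exists>\<beta>. \<alpha> + \<beta> = \<mu>} \<times> {\<alpha>. \<exists>\<beta>. \<alpha> + \<beta> = \<mu>}"
      by clarsimp (metis add.commute)
  qed
qed

text \<open>The polynomial is prescribed only on monomials in the first \<open>N\<close> variables
  and is free elsewhere. Multiplication respects the relation because both factors of such a
  monomial are again of this kind.\<close>

definition truncates :: "nat \<Rightarrow> 'l pseries \<Rightarrow> ('l monomial \<Rightarrow>\<^sub>0 rat) \<Rightarrow> bool" where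
  "truncates N f p \<longleftrightarrow> (\<forall>\<mu>. vars_below N \<mu> \<longrightarrow> f \<mu> = Poly_Mapping.lookup p \<mu>)"

lemma lookup_mult_splits:
  fixes p q :: "'l monomial \<Rightarrow>\<^sub>0 rat"
  shows "Poly_Mapping.lookup (p * q) \<mu> =
    (\<Sum>(\<alpha>, \<beta>) | \<alpha> + \<beta> = \<mu>. Poly_Mapping.lookup p \<alpha> * Poly_Mapping.lookup q \<beta>)"
proof -
  have "Poly_Mapping.lookup (p * q) \<mu> =
      (\<Sum>(\<alpha>, \<beta>). Poly_Mapping.lookup p \<alpha> * Poly_Mapping.lookup q \<beta> when \<mu> = \<alpha> + \<beta>)"
    by (simp add: times_poly_mapping.rep_eq prod_fun_unfold_prod)
  also have "\<dots> = (\<Sum>(\<alpha>, \<beta>)\<in>{(\<alpha>, \<beta>). \<alpha> + \<beta> = \<mu>}.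
      Poly_Mapping.lookup p \<alpha> * Poly_Mapping.lookup q \<beta> when \<mu> = \<alpha> + \<beta>)"
    by (rule Sum_any.expand_superset[OF finite_monomial_splits]) (auto simp: when_def split: if_splits)
  also have "\<dots> = (\<Sum>(\<alpha>, \<beta>) | \<alpha> + \<beta> = \<mu>. Poly_Mapping.lookup p \<alpha> * Poly_Mapping.lookup q \<beta>)"
    by (rule sum.cong) (auto simp: when_def)
  finally show ?thesis .
qed

lemma truncates_mult:
  assumes "truncates N f p" "truncates N g q"
  shows "truncates N (pseries_mult f g) (p * q)"
  unfolding truncates_def pseries_mult_def lookup_mult_splits
  using assms vars_below_add unfolding truncates_def by (fastforce intro!: sum.cong)

lemma truncates_unique:
  assumes "\<And>N. \<exists>p. truncates N f p \<and> truncates N g p"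
  shows "f = (g :: 'l pseries)"
proof
  fix \<mu> :: "'l monomial"
  obtain N where "vars_below N \<mu>" using vars_below_ex by blast
  then show "f \<mu> = g \<mu>" using assms[of N] by (auto simp: truncates_def)
qed

lemma truncates_M: "0 \<notin> set I \<Longrightarrow> truncates N (M I) (M_trunc [0..<N] I)"
  by (simp add: truncates_def M_eq_lookup)

lemma truncates_add: "truncates N f p \<Longrightarrow> truncates N g q \<Longrightarrow> truncates N (f + g) (p + q)"
  by (simp add: truncates_def lookup_add)

lemma truncates_scale: "truncates N f p \<Longrightarrow> truncates N (c *\<^sub>Q f) (c *\<^sub>Q p)"
  by (simp add: truncates_def lookup_scaleQ scaleQ_fun_def)

lemma truncates_zero: "truncates N 0 0"
  by (simp add: truncates_def)

lemma M_mult: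
  assumes "0 \<notin> set I" "0 \<notin> set J"
  shows "pseries_mult (M I) (M J) = (\<Sum>K\<leftarrow>qshuffle I J. M K)"
proof (rule truncates_unique)
  fix N
  have "truncates N (\<Sum>K\<leftarrow>Ks. M K) (\<Sum>K\<leftarrow>Ks. M_trunc [0..<N] K)"
    if "\<And>K. K \<in> set Ks \<Longrightarrow> 0 \<notin> set K" for Ks :: "(nat ^ 'a) list list"
    using that by (induction Ks) (auto simp: truncates_zero truncates_add truncates_M)
  then have "truncates N (\<Sum>K\<leftarrow>qshuffle I J. M K) (\<Sum>K\<leftarrow>qshuffle I J. M_trunc [0..<N] K)"
    using zero_notin_qshuffle[OF assms] by blast
  then show "\<exists>p. truncates N (pseries_mult (M I) (M J)) p \<and> truncates N (\<Sum>K\<leftarrow>qshuffle I J. M K) p"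
    using truncates_mult[OF truncates_M[OF assms(1)] truncates_M[OF assms(2)], of N]
    unfolding M_trunc_mult by blast
qed

lemma pseries_one_eq: "pseries_one = M []"
proof
  fix \<mu> :: "'a monomial"
  have "{js. length js = length ([] :: (nat ^ 'a) list) \<and> sorted_wrt (<) js \<and>
      (\<Sum>(j, n)\<leftarrow>zip js ([] :: (nat ^ 'a) list). xpow j n) = \<mu>} = (if \<mu> = 0 then {[]} else {})"
    by auto
  then show "pseries_one \<mu> = M [] \<mu>" unfolding M_def pseries_one_def by simp
qed

lemma bilinear_pseries_mult: "bilinear_onQ S pseries_mult"
  by (intro bilinear_onQI linear_onQI)
    (auto simp: fun_eq_iff pseries_mult_def scaleQ_fun_def scaleQ_rat_def sum.distrib[symmetric]
      sum_distrib_left case_prod_beta' algebra_simps)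

subsection \<open>The monomial basis\<close>

definition nz_words :: "(nat ^ 'l::finite) list set" where
  "nz_words = {I. 0 \<notin> set I}"

text \<open>The letters of the word become the exponent vectors of the initial variables x_0, x_1
  and so on. Evaluation at this monomial is the functional dual to \<open>M I\<close>, which makes
  coefficients accessible without reference to a basis.\<close>

definition canonical_monomial :: "(nat ^ 'l::finite) list \<Rightarrow> 'l monomial" where
  "canonical_monomial I = word_monomial [0..<length I] I"

definition monomial_part :: "nat \<Rightarrow> 'l::finite monomial \<Rightarrow> nat ^ 'l" where
  "monomial_part j \<mu> = (\<chi> i. Poly_Mapping.lookup \<mu> (j, i))"

lemma monomial_part_add: "monomial_part j (\<mu> + \<nu>) = monomial_part j \<mu> + monomial_part j \<nu>"
  by (simp add: monomial_part_def vec_eq_iff lookup_add)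

lemma monomial_part_xpow: "monomial_part j (xpow j' n) = (if j = j' then n else 0)"
  by (simp add: monomial_part_def vec_eq_iff lookup_xpow)

lemma monomial_part_zero: "monomial_part j 0 = 0"
  by (simp add: monomial_part_def vec_eq_iff)

lemma monomial_part_word_notin:
  "j \<notin> set js \<Longrightarrow> monomial_part j (word_monomial js I) = 0"
proof (induction js arbitrary: I)
  case (Cons j' js)
  then show ?case
    by (cases I) (auto simp: monomial_part_add monomial_part_xpow monomial_part_zero)
qed (simp add: monomial_part_zero)

lemma monomial_part_word:
  "distinct js \<Longrightarrow> length js = length I \<Longrightarrow> r < length I \<Longrightarrow>
   monomial_part (js ! r) (word_monomial js I) = I ! r"
proof (induction js arbitrary: I r)
  case (Cons j js)
  then obtain a I' where I: "I = a # I'" by (cases I) auto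
  show ?case
  proof (cases r)
    case 0
    with Cons.prems show ?thesis
      by (simp add: I monomial_part_add monomial_part_xpow monomial_part_word_notin)
  next
    case (Suc r')
    have "js ! r' \<noteq> j" using Cons.prems Suc I by auto
    with Cons Suc show ?thesis by (simp add: I monomial_part_add monomial_part_xpow)
  qed
qed simp

lemma monomial_part_support:
  assumes "distinct js" "length js = length I" "0 \<notin> set I"
  shows "{j. monomial_part j (word_monomial js I) \<noteq> 0} = set js"
proof (intro set_eqI iffI)
  fix j assume "j \<in> set js"
  then obtain r where r: "r < length I" "j = js ! r"
    using assms(2) by (metis in_set_conv_nth)
  then show "j \<in> {j. monomial_part j (word_monomial js I) \<noteq> 0}"
    using monomial_part_word[OF assms(1,2) r(1)] assms(3) nth_mem[OF r(1)] r(2)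
    by (metis mem_Collect_eq)
qed (use monomial_part_word_notin in blast)

text \<open>A monomial determines the set of variable indices with nonzero exponent vector, hence
  the increasing word of indices, hence the letter attached to each index. So only
  \<open>I = J\<close> and the initial index word contribute.\<close>

lemma M_canonical_monomial:
  assumes "0 \<notin> set I" "0 \<notin> set J"
  shows "M I (canonical_monomial J) = (if I = J then 1 else 0)"
proof -
  have "js = [0..<length J] \<and> I = J"
    if js: "length js = length I" "sorted_wrt (<) js" "word_monomial js I = canonical_monomial J" for js
  proof -
    have d: "distinct js" using js(2) by (simp add: strict_sorted_iff)
    have "set js = set [0..<length J]"
      using monomial_part_support[OF d js(1) assms(1)]
        monomial_part_support[of "[0..<length J]" J] assms(2) js(3)
      by (simp add: canonical_monomial_def)
    then have eq: "js = [0..<length J]"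
      using js(2) by (intro strict_sorted_equal) auto
    then have len: "length I = length J" using js(1) by simp
    have "I ! r = J ! r" if "r < length I" for r
      using monomial_part_word[OF d js(1) that] monomial_part_word[of "[0..<length J]" J r] js(3) eq len that
      by (simp add: canonical_monomial_def)
    with eq len show ?thesis by (auto intro: nth_equalityI)
  qed
  then have "{js. length js = length I \<and> sorted_wrt (<) js \<and> word_monomial js I = canonical_monomial J} =
      (if I = J then {[0..<length J]} else {})"
    by (auto simp: canonical_monomial_def)
  then show ?thesis unfolding M_def word_monomial_def[symmetric] by simp
qed

lemma inj_on_M: "inj_on M nz_words"
  unfolding inj_on_def nz_words_def
  by (metis M_canonical_monomial mem_Collect_eq zero_neq_one)

lemma sum_fun_apply: "(\<Sum>x\<in>A. f x) y = (\<Sum>x\<in>A. f x y)"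
  by (induction A rule: infinite_finite_induct) auto

lemma linear_onQ_eval: "linear_onQ S (\<lambda>f. f x)"
  by (simp add: linear_onQ_def scaleQ_fun_def)

lemma independent_M: "qvs.independent (M ` nz_words)"
  unfolding qvs.independent_explicit_module
proof (intro allI impI)
  fix t and u :: "'a pseries \<Rightarrow> rat" and v
  assume t: "finite t" "t \<subseteq> M ` nz_words" "(\<Sum>v\<in>t. u v *\<^sub>Q v) = 0" "v \<in> t"
  then obtain I where I: "0 \<notin> set I" "v = M I" by (auto simp: nz_words_def)
  have "0 = (\<Sum>w\<in>t. u w *\<^sub>Q w) (canonical_monomial I)" by (simp add: t(3))
  also have "\<dots> = (\<Sum>w\<in>t. u w * w (canonical_monomial I))"
    by (simp add: sum_fun_apply scaleQ_fun_def scaleQ_rat_def)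
  also have "\<dots> = (\<Sum>w\<in>t. if w = v then u w else 0)"
  proof (rule sum.cong[OF refl])
    fix w assume "w \<in> t"
    then obtain J where "0 \<notin> set J" "w = M J" using t(2) by (auto simp: nz_words_def)
    then show "u w * w (canonical_monomial I) = (if w = v then u w else 0)"
      using I M_canonical_monomial[of J I] M_canonical_monomial[of I I] by auto
  qed
  also have "\<dots> = u v" using t by (simp add: sum.delta)
  finally show "u v = 0" by simp
qed

abbreviation QS :: "'l::finite pseries set" where
  "QS \<equiv> qvs.span (M ` nz_words)"

lemma M_in_QS: "0 \<notin> set I \<Longrightarrow> M I \<in> QS"
  by (rule qvs.span_base) (auto simp: nz_words_def)

text \<open>The abstract coordinate and the evaluation are both linear and agree on the basis. From
  here on every \<open>M_extend\<close> is computed by evaluations.\<close>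

lemma M_coeff_eq:
  assumes "f \<in> QS" "0 \<notin> set I"
  shows "M_coeff f I = f (canonical_monomial I)"
proof (rule linear_onQ_eq_on_span[OF _ linear_onQ_eval _ assms(1)])
  show "linear_onQ QS (\<lambda>f. M_coeff f I)"
    unfolding M_coeff_def nz_words_def[symmetric]
    by (rule linear_onQI)
      (simp_all add: qvs.representation_add[OF independent_M] qvs.representation_scale[OF independent_M]
        scaleQ_rat_def)
  fix x :: "'a pseries" assume "x \<in> M ` nz_words"
  then obtain J where J: "0 \<notin> set J" "x = M J" by (auto simp: nz_words_def)
  then have "M_coeff x I = (if M I = M J then 1 else 0)"
    unfolding M_coeff_def nz_words_def[symmetric]
    by (subst qvs.representation_basis[OF independent_M]) (auto simp: nz_words_def)
  moreover have "M I = M J \<longleftrightarrow> J = I"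
    using inj_on_M J(1) assms(2) by (auto simp: inj_on_def nz_words_def)
  ultimately show "M_coeff x I = x (canonical_monomial I)"
    using J assms(2) M_canonical_monomial[of J I] by simp
qed

lemma finite_coeffs:
  assumes "f \<in> QS"
  shows "finite {I. 0 \<notin> set I \<and> f (canonical_monomial I) \<noteq> 0}"
  using assms
proof (induction rule: qvs.span_induct_alt)
  case (step c x y)
  then obtain J where J: "0 \<notin> set J" "x = M J" by (auto simp: nz_words_def)
  then have "{I. 0 \<notin> set I \<and> (c *\<^sub>Q x + y) (canonical_monomial I) \<noteq> 0} \<subseteq>
      insert J {I. 0 \<notin> set I \<and> y (canonical_monomial I) \<noteq> 0}"
    by (auto simp: scaleQ_fun_def scaleQ_rat_def M_canonical_monomial)
  then show ?case by (rule finite_subset) (simp add: step)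
qed simp

lemma M_extend_eq:
  assumes "f \<in> QS" "finite A" "A \<subseteq> nz_words" "{I. 0 \<notin> set I \<and> f (canonical_monomial I) \<noteq> 0} \<subseteq> A"
  shows "M_extend g f = (\<Sum>I\<in>A. f (canonical_monomial I) *\<^sub>Q g I)"
proof -
  have "M_extend g f = (\<Sum>I | 0 \<notin> set I \<and> f (canonical_monomial I) \<noteq> 0. f (canonical_monomial I) *\<^sub>Q g I)"
    unfolding M_extend_def using M_coeff_eq[OF assms(1)] by (intro sum.cong) auto
  also have "\<dots> = (\<Sum>I\<in>A. f (canonical_monomial I) *\<^sub>Q g I)"
    using assms by (intro sum.mono_neutral_left) (auto simp: nz_words_def)
  finally show ?thesis .
qed

lemma linear_M_extend: "linear_onQ QS (M_extend g)"
proof (rule linear_onQI)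
  let ?S = "\<lambda>f. {I. 0 \<notin> set I \<and> f (canonical_monomial I) \<noteq> 0}"
  fix x y :: "'a pseries" assume xy: "x \<in> QS" "y \<in> QS"
  let ?A = "?S x \<union> ?S y"
  have A: "finite ?A" "?A \<subseteq> nz_words" using xy by (auto simp: finite_coeffs nz_words_def)
  show "M_extend g (x + y) = M_extend g x + M_extend g y"
    using xy by (subst (1 2 3) M_extend_eq[OF _ A])
      (auto simp: qvs.span_add scaleQ_add_left sum.distrib)
next
  let ?S = "\<lambda>f. {I. 0 \<notin> set I \<and> f (canonical_monomial I) \<noteq> 0}"
  fix c and x :: "'a pseries" assume x: "x \<in> QS"
  have A: "finite (?S x)" "?S x \<subseteq> nz_words" using x by (auto simp: finite_coeffs nz_words_def)
  show "M_extend g (c *\<^sub>Q x) = c *\<^sub>Q M_extend g x"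
    using x qvs.span_scale[OF x, of c] by (subst (1 2) M_extend_eq[OF _ A])
      (auto simp: scaleQ_fun_def scaleQ_rat_def qvs.scale_sum_right)
qed

lemma M_extend_M:
  assumes "0 \<notin> set I"
  shows "M_extend g (M I) = g I"
  using assms M_in_QS[OF assms] by (subst M_extend_eq[of _ "{I}"])
    (auto simp: nz_words_def M_canonical_monomial split: if_splits)

lemma QS_eq_0I:
  assumes "f \<in> QS" "\<And>I. 0 \<notin> set I \<Longrightarrow> f (canonical_monomial I) = 0"
  shows "f = 0"
proof -
  have "f = M_extend M f"
    by (rule linear_onQ_eq_on_span[OF linear_onQ_id linear_M_extend _ assms(1)])
      (auto simp: nz_words_def M_extend_M)
  also have "\<dots> = 0"
    using assms by (subst M_extend_eq[of _ "{}"]) auto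
  finally show ?thesis .
qed

section \<open>The bialgebra of quasisymmetric functions\<close>

lemma QSym_simps:
  "grade QSym n = qvs.span (M ` vector_comps n)"
  "cop QSym = M_extend (\<lambda>I. \<Sum>r\<le>length I. tens [M (take r I), M (drop r I)])"
  "counit QSym = M_extend (\<lambda>I. if I = [] then 1 else 0)"
  "mul QSym = pseries_mult"
  "one QSym = M []"
  by (simp_all add: QSym_def pseries_one_eq)

lemma vector_comps_nz: "I \<in> vector_comps n \<Longrightarrow> 0 \<notin> set I"
  by (simp add: vector_comps_def)

lemma hspace_QSym: "hspace QSym = (QS :: 'l::finite pseries set)"
proof (rule antisym)
  show "hspace QSym \<subseteq> QS"
    unfolding hspace_def QSym_simps
    by (intro qvs.span_minimal UN_least qvs.span_mono)
      (auto simp: vector_comps_def nz_words_def)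
  show "(QS :: 'l pseries set) \<subseteq> hspace QSym"
  proof (rule qvs.span_minimal[OF _ subspace_hspace])
    have "M I \<in> hspace QSym" if "0 \<notin> set I" for I :: "(nat ^ 'l) list"
    proof (rule grade_in_hspace)
      show "M I \<in> grade QSym (sum_list I)"
        using that by (auto simp: QSym_simps vector_comps_def intro!: qvs.span_base)
    qed
    then show "M ` nz_words \<subseteq> (hspace QSym :: 'l pseries set)" by (auto simp: nz_words_def)
  qed
qed

lemma QSym_eqI:
  assumes "linear_onQ (hspace QSym) f" "linear_onQ (hspace QSym) g"
    and "\<And>I. 0 \<notin> set I \<Longrightarrow> f (M I) = g (M I)" "h \<in> hspace QSym"
  shows "f h = g h"
  using linear_onQ_eq_on_span[of "M ` nz_words" f g h] assms
  by (auto simp: hspace_QSym nz_words_def)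

lemma QSym_grade_eqI:
  assumes "linear_onQ (hspace QSym) f" "linear_onQ (hspace QSym) g"
    and "\<And>I. I \<in> vector_comps n \<Longrightarrow> f (M I) = g (M I)" "h \<in> grade QSym n"
  shows "f h = g h"
proof -
  have sub: "qvs.span (M ` vector_comps n) \<subseteq> hspace QSym"
    using grade_in_hspace[of _ QSym n] by (auto simp: QSym_simps)
  show ?thesis
    by (rule linear_onQ_eq_on_span[OF linear_onQ_subset[OF assms(1) sub] linear_onQ_subset[OF assms(2) sub]])
      (use assms(3,4) in \<open>auto simp: QSym_simps\<close>)
qed

lemma QSym_bilinear_eqI:
  assumes "bilinear_onQ (hspace QSym) f" "bilinear_onQ (hspace QSym) g"
    and "\<And>I J. 0 \<notin> set I \<Longrightarrow> 0 \<notin> set J \<Longrightarrow> f (M I) (M J) = g (M I) (M J)"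
    and "x \<in> hspace QSym" "y \<in> hspace QSym"
  shows "f x y = g x y"
  using bilinear_onQ_eq_on_span[of "M ` nz_words" f g x y] assms
  by (auto simp: hspace_QSym nz_words_def)

lemma linear_M_extend_QSym: "linear_onQ (hspace QSym) (M_extend g)"
  by (simp add: hspace_QSym linear_M_extend)

lemma M_in_hspace: "0 \<notin> set I \<Longrightarrow> M I \<in> hspace QSym"
  by (simp add: hspace_QSym M_in_QS)

lemma M_in_grade: "0 \<notin> set I \<Longrightarrow> M I \<in> grade QSym (sum_list I)"
  by (auto simp: QSym_simps vector_comps_def intro!: qvs.span_base)

lemma graded_space_QSym: "graded_space QSym"
proof (rule graded_space_projections[where \<pi> = "\<lambda>n. M_extend (\<lambda>I. if sum_list I = n then M I else 0)"])
  show "qvs.subspace (grade QSym n)" for n :: "nat ^ 'a" by (simp add: QSym_simps)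
  show "linear_onQ (hspace QSym) (M_extend (\<lambda>I. if sum_list I = n then M I else 0))" for n :: "nat ^ 'a"
    by (rule linear_M_extend_QSym)
  show "M_extend (\<lambda>I. if sum_list I = n then M I else 0) h = h" if "h \<in> grade QSym n" for n :: "nat ^ 'a" and h
    by (rule QSym_grade_eqI[OF linear_M_extend_QSym linear_onQ_id _ that])
      (auto simp: vector_comps_def M_extend_M)
  show "M_extend (\<lambda>I. if sum_list I = n then M I else 0) h = 0" if "h \<in> grade QSym m" "m \<noteq> n"
    for m n :: "nat ^ 'a" and h
    by (rule QSym_grade_eqI[OF linear_M_extend_QSym linear_onQ_const_zero _ that(1)])
      (use that(2) in \<open>auto simp: vector_comps_def M_extend_M\<close>)
qed

lemma cop_M: "0 \<notin> set I \<Longrightarrow> cop QSym (M I) = (\<Sum>(A, B)\<leftarrow>splits I. tens [M A, M B])"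
  by (simp add: QSym_simps M_extend_M sum_splits)

lemma splits_nz: "0 \<notin> set I \<Longrightarrow> (A, B) \<in> set (splits I) \<Longrightarrow> 0 \<notin> set A \<and> 0 \<notin> set B"
  by (auto simp: set_splits)

interpretation QSym: linear_coproduct QSym
proof
  show lin: "linear_onQ (hspace QSym) (cop QSym)"
    unfolding QSym_simps by (rule linear_M_extend_QSym)
  fix h :: "'a pseries" assume "h \<in> hspace QSym"
  then have "h \<in> QS" by (simp add: hspace_QSym)
  then show "cop QSym h \<in> tensor_square (hspace QSym)"
  proof (rule linear_onQ_image_span[OF _ subspace_tensor_square, rotated -1])
    show "linear_onQ QS (cop QSym)" using lin by (simp add: hspace_QSym)
    fix x :: "'a pseries" assume "x \<in> M ` nz_words"
    then obtain I where I: "0 \<notin> set I" "x = M I" by (auto simp: nz_words_def)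
    show "cop QSym x \<in> tensor_square (hspace QSym)"
      unfolding I(2) cop_M[OF I(1)]
    proof (rule subspace_sum_list[OF subspace_tensor_square])
      fix p assume p: "p \<in> set (splits I)"
      obtain A B where AB: "p = (A, B)" by (cases p)
      then have "0 \<notin> set A" "0 \<notin> set B" using p splits_nz[OF I(1)] by blast+
      then show "(case p of (A, B) \<Rightarrow> tens [M A, M B]) \<in> tensor_square (hspace QSym)"
        by (simp add: AB tens_in_tensor_square M_in_hspace)
    qed
  qed
qed

lemma cop_lift_M:
  assumes "bilinear_onQ (hspace QSym) g" "0 \<notin> set I"
  shows "cop_lift QSym g (M I) = (\<Sum>(A, B)\<leftarrow>splits I. g (M A) (M B))"
proof -
  have "cop_lift QSym g (M I) = (\<Sum>(a, b)\<leftarrow>map (\<lambda>(A, B). (M A, M B)) (splits I). g a b)"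
  proof (rule cop_lift_sum_list[OF assms(1)])
    show "cop QSym (M I) = (\<Sum>(a, b)\<leftarrow>map (\<lambda>(A, B). (M A, M B)) (splits I). tens [a, b])"
      by (simp add: cop_M[OF assms(2)] o_def case_prod_beta')
    show "\<forall>(a, b)\<in>set (map (\<lambda>(A, B). (M A, M B)) (splits I)). a \<in> hspace QSym \<and> b \<in> hspace QSym"
    proof clarsimp
      fix A B assume "(A, B) \<in> set (splits I)"
      then show "M A \<in> hspace QSym \<and> M B \<in> hspace QSym"
        using splits_nz[OF assms(2)] M_in_hspace by blast
    qed
  qed
  then show ?thesis by (simp add: o_def case_prod_beta')
qed

lemma sum_splits_left_Nil: "(\<Sum>(A, B)\<leftarrow>splits I. if A = [] then f B else 0) = (f I :: 'b::comm_monoid_add)"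
  by (cases I) (auto simp: o_def case_prod_beta' intro!: sum_list_zero)

lemma sum_splits_right_Nil: "(\<Sum>(A, B)\<leftarrow>splits I. if B = [] then f A else 0) = (f I :: 'b::comm_monoid_add)"
proof (induction I arbitrary: f)
  case (Cons a I)
  from Cons[of "\<lambda>A. f (a # A)"] show ?case by (simp add: o_def case_prod_beta' cong: if_cong)
qed simp

lemma linear_counit_QSym: "linear_onQ (hspace QSym) (counit QSym)"
  unfolding QSym_simps by (rule linear_M_extend_QSym)

lemma counit_M: "0 \<notin> set I \<Longrightarrow> counit QSym (M I) = (if I = [] then 1 else 0)"
  by (simp add: QSym_simps M_extend_M)

lemma cop_QSym_grade:
  assumes "h \<in> grade QSym n"
  shows "cop QSym h \<in> qvs.span {tens [a, b] | a b i j. i + j = n \<and> a \<in> grade QSym i \<and> b \<in> grade QSym j}"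
    (is "_ \<in> ?T")
proof (rule linear_onQ_image_span[where B = "M ` vector_comps n"])
  show "h \<in> qvs.span (M ` vector_comps n)" using assms by (simp add: QSym_simps)
  show "linear_onQ (qvs.span (M ` vector_comps n)) (cop QSym)"
    by (rule linear_onQ_subset[OF QSym.linear_cop])
      (use grade_in_hspace[of _ QSym n] in \<open>auto simp: QSym_simps\<close>)
  fix x assume "x \<in> M ` vector_comps n"
  then obtain I where I: "0 \<notin> set I" "sum_list I = n" "x = M I" by (auto simp: vector_comps_def)
  have "tens [M A, M B] \<in> ?T" if "A @ B = I" for A B
  proof -
    have "sum_list A + sum_list B = n" using I(2) that by auto
    moreover have "M A \<in> grade QSym (sum_list A)" "M B \<in> grade QSym (sum_list B)"
      using I(1) that by (auto intro!: M_in_grade)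
    ultimately show ?thesis by (blast intro: qvs.span_base)
  qed
  then show "cop QSym x \<in> ?T"
    using I(1) by (auto simp: I(3) cop_M set_splits intro!: subspace_sum_list)
qed simp

lemma graded_coalgebra_QSym: "graded_coalgebra QSym"
  unfolding graded_coalgebra_def cop_lift_def[symmetric]
proof (intro conjI allI ballI impI)
  note T = trilinear_onQ_tens[of "hspace QSym"]
  show "graded_space QSym" by (rule graded_space_QSym)
  show "linear_onQ (hspace QSym) (cop QSym)" by (rule QSym.linear_cop)
  show "linear_onQ (hspace QSym) (counit QSym)" by (rule linear_counit_QSym)
  show "cop QSym h \<in> qvs.span {tens [a, b] | a b i j. i + j = n \<and> a \<in> grade QSym i \<and> b \<in> grade QSym j}"
    if "h \<in> grade QSym n" for n :: "nat ^ 'a" and h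
    using that by (rule cop_QSym_grade)
  show "counit QSym h = 0" if "n \<noteq> 0" "h \<in> grade QSym n" for n :: "nat ^ 'a" and h
    by (rule QSym_grade_eqI[OF linear_counit_QSym linear_onQ_const_zero _ that(2)])
      (use that(1) in \<open>auto simp: vector_comps_def counit_M\<close>)
  fix h :: "'a pseries" assume h: "h \<in> hspace QSym"
  show "cop_lift QSym (\<lambda>a b. cop_lift QSym (\<lambda>c d. tens [c, d, b]) a) h =
      cop_lift QSym (\<lambda>a b. cop_lift QSym (\<lambda>c d. tens [a, c, d]) b) h"
  proof (rule QSym_eqI[OF QSym.linear_cop_lift[OF QSym.bilinear_cop_lift_left[OF T]]
        QSym.linear_cop_lift[OF QSym.bilinear_cop_lift_right[OF T]] _ h])
    fix I :: "(nat ^ 'a) list" assume I: "0 \<notin> set I"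
    have "cop_lift QSym (\<lambda>a b. cop_lift QSym (\<lambda>c d. tens [c, d, b]) a) (M I) =
        (\<Sum>(A, B)\<leftarrow>splits I. \<Sum>(C, D)\<leftarrow>splits A. tens [M C, M D, M B])"
      unfolding cop_lift_M[OF QSym.bilinear_cop_lift_left[OF T] I]
      by (rule sum_list_cong_pairs)
        (drule splits_nz[OF I], intro cop_lift_M trilinear_onQD(5)[OF T] M_in_hspace, simp_all)
    also have "\<dots> = (\<Sum>(A, B)\<leftarrow>splits I. \<Sum>(C, D)\<leftarrow>splits B. tens [M A, M C, M D])"
      by (rule sum_splits_coassoc)
    also have "\<dots> = cop_lift QSym (\<lambda>a b. cop_lift QSym (\<lambda>c d. tens [a, c, d]) b) (M I)"
      unfolding cop_lift_M[OF QSym.bilinear_cop_lift_right[OF T] I]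
      by (rule sum_list_cong_pairs[symmetric])
        (drule splits_nz[OF I], intro cop_lift_M trilinear_onQD(4)[OF T] M_in_hspace, simp_all)
    finally show "cop_lift QSym (\<lambda>a b. cop_lift QSym (\<lambda>c d. tens [c, d, b]) a) (M I) =
        cop_lift QSym (\<lambda>a b. cop_lift QSym (\<lambda>c d. tens [a, c, d]) b) (M I)" .
  qed
  have bl: "bilinear_onQ (hspace QSym) (\<lambda>a b. counit QSym a *\<^sub>Q b)"
    "bilinear_onQ (hspace QSym) (\<lambda>a b. counit QSym b *\<^sub>Q a)"
    by (intro bilinear_onQI linear_onQ_scale_left linear_onQ_scaleQ linear_onQ_id linear_counit_QSym)+
  show "cop_lift QSym (\<lambda>a b. counit QSym a *\<^sub>Q b) h = h"
  proof (rule QSym_eqI[OF QSym.linear_cop_lift[OF bl(1)] linear_onQ_id _ h])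
    fix I :: "(nat ^ 'a) list" assume I: "0 \<notin> set I"
    have "cop_lift QSym (\<lambda>a b. counit QSym a *\<^sub>Q b) (M I) =
        (\<Sum>(A, B)\<leftarrow>splits I. if A = [] then M B else 0)"
      unfolding cop_lift_M[OF bl(1) I]
      by (rule sum_list_cong_pairs) (drule splits_nz[OF I], simp add: counit_M)
    then show "cop_lift QSym (\<lambda>a b. counit QSym a *\<^sub>Q b) (M I) = M I"
      by (simp only: sum_splits_left_Nil)
  qed
  show "cop_lift QSym (\<lambda>a b. counit QSym b *\<^sub>Q a) h = h"
  proof (rule QSym_eqI[OF QSym.linear_cop_lift[OF bl(2)] linear_onQ_id _ h])
    fix I :: "(nat ^ 'a) list" assume I: "0 \<notin> set I"
    have "cop_lift QSym (\<lambda>a b. counit QSym b *\<^sub>Q a) (M I) =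
        (\<Sum>(A, B)\<leftarrow>splits I. if B = [] then M A else 0)"
      unfolding cop_lift_M[OF bl(2) I]
      by (rule sum_list_cong_pairs) (drule splits_nz[OF I], simp add: counit_M)
    then show "cop_lift QSym (\<lambda>a b. counit QSym b *\<^sub>Q a) (M I) = M I"
      by (simp only: sum_splits_right_Nil)
  qed
qed

lemma truncates_ex:
  assumes "f \<in> hspace QSym"
  shows "\<exists>p. truncates N f p"
  using assms unfolding hspace_QSym
proof (induction rule: qvs.span_induct_alt)
  case base
  show ?case using truncates_zero by blast
next
  case (step c x y)
  then obtain J q where "0 \<notin> set J" "x = M J" "truncates N y q" by (auto simp: nz_words_def)
  then have "truncates N (c *\<^sub>Q x + y) (c *\<^sub>Q M_trunc [0..<N] J + q)"
    by (simp add: truncates_add truncates_scale truncates_M)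
  then show ?case by blast
qed

lemma bilinear_mul_QSym: "bilinear_onQ S (mul QSym)"
  unfolding QSym_simps by (rule bilinear_pseries_mult)

lemma mul_M: "0 \<notin> set I \<Longrightarrow> 0 \<notin> set J \<Longrightarrow> mul QSym (M I) (M J) = (\<Sum>K\<leftarrow>qshuffle I J. M K)"
  by (simp add: QSym_simps M_mult)

lemma mul_QSym_grade:
  assumes "a \<in> grade QSym m" "b \<in> grade QSym n"
  shows "mul QSym a b \<in> grade QSym (m + n)"
proof -
  have M: "mul QSym (M I) (M J) \<in> grade QSym (m + n)" if "I \<in> vector_comps m" "J \<in> vector_comps n" for I J
  proof -
    have "M K \<in> grade QSym (m + n)" if "K \<in> set (qshuffle I J)" for K
      using that sum_list_qshuffle[OF that] zero_notin_qshuffle[OF _ _ that] M_in_grade[of K]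
        \<open>I \<in> _\<close> \<open>J \<in> _\<close> by (simp add: vector_comps_def)
    then show ?thesis
      using that by (auto simp: mul_M vector_comps_nz QSym_simps(1) intro!: subspace_sum_list)
  qed
  have 1: "mul QSym (M I) b \<in> grade QSym (m + n)" if "I \<in> vector_comps m" for I
    by (rule linear_onQ_image_span[OF bilinear_onQ_right[OF bilinear_mul_QSym[of UNIV], THEN linear_onQ_subset]])
      (use that M assms(2) in \<open>auto simp: QSym_simps(1)\<close>)
  show ?thesis
    by (rule linear_onQ_image_span[OF bilinear_onQ_left[OF bilinear_mul_QSym[of UNIV], THEN linear_onQ_subset]])
      (use 1 assms(1) in \<open>auto simp: QSym_simps(1)\<close>)
qed

lemma graded_algebra_QSym: "graded_algebra QSym"
  unfolding graded_algebra_def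
proof (intro conjI allI ballI)
  show "graded_space QSym" by (rule graded_space_QSym)
  show "linear_onQ (hspace QSym) (mul QSym a)" "linear_onQ (hspace QSym) (\<lambda>b. mul QSym b a)" for a :: "'a pseries"
    using bilinear_mul_QSym[of UNIV] by (auto simp: bilinear_onQ_def intro: linear_onQ_subset)
  show "mul QSym a b \<in> grade QSym (m + n)" if "a \<in> grade QSym m" "b \<in> grade QSym n"
    for m n :: "nat ^ 'a" and a b
    using that by (rule mul_QSym_grade)
  show "one QSym \<in> grade QSym (0 :: nat ^ 'a)"
    using M_in_grade[of "[]"] by (simp add: QSym_simps)
  fix a :: "'a pseries" assume a: "a \<in> hspace QSym"
  show "mul QSym (one QSym) a = a"
    by (rule QSym_eqI[OF bilinear_onQ_right[OF bilinear_mul_QSym] linear_onQ_id _ a])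
      (auto simp: QSym_simps(5) mul_M M_in_hspace)
  show "mul QSym a (one QSym) = a"
    by (rule QSym_eqI[OF bilinear_onQ_left[OF bilinear_mul_QSym] linear_onQ_id _ a])
      (auto simp: QSym_simps(5) mul_M M_in_hspace)
  fix b c :: "'a pseries" assume bc: "b \<in> hspace QSym" "c \<in> hspace QSym"
  \<comment> \<open>Truncations of the two sides are \<open>p * q * r\<close> and
    \<open>p * (q * r)\<close>, so associativity is inherited from polynomials.\<close>
  show "mul QSym (mul QSym a b) c = mul QSym a (mul QSym b c)"
    unfolding QSym_simps
  proof (rule truncates_unique)
    fix N
    obtain p q r where "truncates N a p" "truncates N b q" "truncates N c r"
      using truncates_ex a bc by meson
    then have "truncates N (pseries_mult (pseries_mult a b) c) (p * q * r)"
      "truncates N (pseries_mult a (pseries_mult b c)) (p * (q * r))"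
      by (auto intro: truncates_mult)
    then show "\<exists>p. truncates N (pseries_mult (pseries_mult a b) c) p \<and>
        truncates N (pseries_mult a (pseries_mult b c)) p"
      by (auto simp: mult.assoc)
  qed
qed

interpretation QSym: alg_coalg QSym
  by (simp add: alg_coalg_def hom_convolution_def graded_coalg_def graded_alg_def
      graded_coalgebra_QSym graded_algebra_QSym)

lemma linear_sum_list_M:
  assumes "linear_onQ (hspace QSym) f" "0 \<notin> set I" "0 \<notin> set J"
  shows "f (mul QSym (M I) (M J)) = (\<Sum>K\<leftarrow>qshuffle I J. f (M K))"
  unfolding mul_M[OF assms(2,3)]
  by (rule linear_onQ_sum_list[OF assms(1) subspace_hspace])
    (use zero_notin_qshuffle[OF assms(2,3)] in \<open>auto intro: M_in_hspace\<close>)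

text \<open>Both sides are bilinear, so they may be compared on the basis, where the left side sums
  deconcatenations of quasi-shuffles and the right side quasi-shuffles of deconcatenations.\<close>

lemma cop_mul_QSym:
  assumes "a \<in> hspace QSym" "b \<in> hspace QSym"
  shows "cop QSym (mul QSym a b) = mul2 QSym (cop QSym a) (cop QSym b)"
proof -
  let ?t = "\<lambda>c d c' d'. tens [mul QSym c c', mul QSym d d']"
  have "cop QSym (mul QSym a b) = cop_lift QSym (\<lambda>c d. cop_lift QSym (?t c d) b) a"
  proof (rule QSym_bilinear_eqI[OF _ _ _ assms])
    show "bilinear_onQ (hspace QSym) (\<lambda>a b. cop QSym (mul QSym a b))"
      by (rule bilinear_onQ_compose[OF bilinear_mul_QSym QSym.linear_cop])
        (rule QSym.mul_in_hspace)
    show "bilinear_onQ (hspace QSym) (\<lambda>a b. cop_lift QSym (\<lambda>c d. cop_lift QSym (?t c d) b) a)"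
      by (intro bilinear_onQI QSym.linear_cop_lift QSym.linear_cop_lift_param subspace_hspace
          QSym.bilinear_cop_lift_mul[OF bilinear_onQ_tens] QSym.bilinear_mul_args[OF bilinear_onQ_tens])
    fix I J :: "(nat ^ 'a) list" assume I: "0 \<notin> set I" and J: "0 \<notin> set J"
    have tens: "(\<Sum>X\<leftarrow>qshuffle A C. \<Sum>Y\<leftarrow>qshuffle B D. tens [M X, M Y]) = ?t (M A) (M B) (M C) (M D)"
      if "0 \<notin> set A" "0 \<notin> set B" "0 \<notin> set C" "0 \<notin> set D" for A B C D :: "(nat ^ 'a) list"
    proof -
      note bt = bilinear_onQ_tens[of "hspace QSym :: 'a pseries set"]
      have in_hs: "mul QSym (M B) (M D) \<in> hspace QSym"
        using that by (intro QSym.mul_in_hspace M_in_hspace)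
      have "?t (M A) (M B) (M C) (M D) = (\<Sum>X\<leftarrow>qshuffle A C. tens [M X, mul QSym (M B) (M D)])"
        by (rule linear_sum_list_M[OF bilinear_onQ_left[OF bt in_hs] that(1,3)])
      also have "\<dots> = (\<Sum>X\<leftarrow>qshuffle A C. \<Sum>Y\<leftarrow>qshuffle B D. tens [M X, M Y])"
        using zero_notin_qshuffle[OF that(1,3)]
        by (intro arg_cong[where f = sum_list] map_cong refl
            linear_sum_list_M[OF bilinear_onQ_right[OF bt] that(2,4)] M_in_hspace)
      finally show ?thesis ..
    qed
    have "cop QSym (mul QSym (M I) (M J)) = (\<Sum>K\<leftarrow>qshuffle I J. cop QSym (M K))"
      by (rule linear_sum_list_M[OF QSym.linear_cop I J])
    also have "\<dots> = (\<Sum>K\<leftarrow>qshuffle I J. \<Sum>(X, Y)\<leftarrow>splits K. tens [M X, M Y])"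
      using zero_notin_qshuffle[OF I J]
      by (intro arg_cong[where f = sum_list] map_cong refl cop_M)
    also have "\<dots> = (\<Sum>(A, B)\<leftarrow>splits I. \<Sum>(C, D)\<leftarrow>splits J.
        \<Sum>X\<leftarrow>qshuffle A C. \<Sum>Y\<leftarrow>qshuffle B D. tens [M X, M Y])"
      by (rule sum_qshuffle_splits)
    also have "\<dots> = (\<Sum>(A, B)\<leftarrow>splits I. cop_lift QSym (?t (M A) (M B)) (M J))"
    proof (rule sum_list_cong_pairs)
      fix A B assume "(A, B) \<in> set (splits I)"
      then have AB: "0 \<notin> set A" "0 \<notin> set B" using splits_nz[OF I] by auto
      have "cop_lift QSym (?t (M A) (M B)) (M J) = (\<Sum>(C, D)\<leftarrow>splits J. ?t (M A) (M B) (M C) (M D))"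
        by (rule cop_lift_M[OF QSym.bilinear_mul_args[OF bilinear_onQ_tens] J])
          (auto simp: M_in_hspace AB)
      also have "\<dots> = (\<Sum>(C, D)\<leftarrow>splits J. \<Sum>X\<leftarrow>qshuffle A C. \<Sum>Y\<leftarrow>qshuffle B D. tens [M X, M Y])"
        by (rule sum_list_cong_pairs) (drule splits_nz[OF J], simp add: tens AB)
      finally show "(\<Sum>(C, D)\<leftarrow>splits J. \<Sum>X\<leftarrow>qshuffle A C. \<Sum>Y\<leftarrow>qshuffle B D. tens [M X, M Y]) =
          cop_lift QSym (?t (M A) (M B)) (M J)" ..
    qed
    also have "\<dots> = cop_lift QSym (\<lambda>c d. cop_lift QSym (?t c d) (M J)) (M I)"
      by (rule cop_lift_M[symmetric, OF QSym.bilinear_cop_lift_mul[OF bilinear_onQ_tens M_in_hspace[OF J]] I])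
    finally show "cop QSym (mul QSym (M I) (M J)) =
        cop_lift QSym (\<lambda>c d. cop_lift QSym (?t c d) (M J)) (M I)" .
  qed
  then show ?thesis by (simp add: mul2_def cop_lift_def)
qed

lemma multiplicative_QSymI:
  fixes f :: "'l::finite pseries \<Rightarrow> rat"
  assumes "linear_onQ (hspace QSym) f"
    and "\<And>I J. 0 \<notin> set I \<Longrightarrow> 0 \<notin> set J \<Longrightarrow> (\<Sum>K\<leftarrow>qshuffle I J. f (M K)) = f (M I) * f (M J)"
    and "a \<in> hspace QSym" "b \<in> hspace QSym"
  shows "f (mul QSym a b) = f a * f b"
  by (rule QSym_bilinear_eqI[OF bilinear_onQ_compose[OF bilinear_mul_QSym assms(1)]
        bilinear_onQ_mult[OF assms(1,1)] _ assms(3,4)])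
    (auto simp: QSym.mul_in_hspace linear_sum_list_M[OF assms(1)] assms(2))

lemma sum_list_map_cong: "(\<And>x. x \<in> set xs \<Longrightarrow> f x = g x) \<Longrightarrow> (\<Sum>x\<leftarrow>xs. f x) = (\<Sum>x\<leftarrow>xs. g x)"
  by (metis map_cong)

lemma graded_bialgebra_QSym: "graded_bialgebra QSym"
  unfolding graded_bialgebra_def
proof (intro conjI ballI)
  show "graded_algebra QSym" by (rule graded_algebra_QSym)
  show "graded_coalgebra QSym" by (rule graded_coalgebra_QSym)
  show "cop QSym (one QSym) = tens [one QSym, one QSym]" "counit QSym (one QSym) = 1"
    by (simp_all add: QSym_simps(5) cop_M counit_M)
  fix a b :: "'a pseries" assume ab: "a \<in> hspace QSym" "b \<in> hspace QSym"
  show "cop QSym (mul QSym a b) = mul2 QSym (cop QSym a) (cop QSym b)"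
    by (rule cop_mul_QSym[OF ab])
  show "counit QSym (mul QSym a b) = counit QSym a * counit QSym b"
  proof (rule multiplicative_QSymI[OF linear_counit_QSym _ ab])
    fix I J :: "(nat ^ 'a) list" assume IJ: "0 \<notin> set I" "0 \<notin> set J"
    have "(\<Sum>K\<leftarrow>qshuffle I J. counit QSym (M K)) = (\<Sum>K\<leftarrow>qshuffle I J. if K = [] then 1 else 0)"
      using zero_notin_qshuffle[OF IJ] by (intro sum_list_map_cong counit_M)
    then show "(\<Sum>K\<leftarrow>qshuffle I J. counit QSym (M K)) = counit QSym (M I) * counit QSym (M J)"
      by (simp only: qshuffle_counit counit_M IJ not_False_eq_True)
  qed
qed

interpretation QSym: graded_bialg QSym
  by standard (rule graded_bialgebra_QSym)

subsection \<open>The universal character\<close>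

lemma linear_zetaQ: "linear_onQ (hspace QSym) zetaQ"
  unfolding zetaQ_def by (rule linear_M_extend_QSym)

lemma zetaQ_M: "0 \<notin> set I \<Longrightarrow> zetaQ (M I) = (if length I \<le> 1 then 1 else 0)"
  by (simp add: zetaQ_def M_extend_M)

lemma zetaQ_mul:
  assumes "a \<in> hspace QSym" "b \<in> hspace QSym"
  shows "zetaQ (mul QSym a b) = zetaQ a * zetaQ b"
proof (rule multiplicative_QSymI[OF linear_zetaQ _ assms])
  fix I J :: "(nat ^ 'a) list" assume IJ: "0 \<notin> set I" "0 \<notin> set J"
  have "(\<Sum>K\<leftarrow>qshuffle I J. zetaQ (M K)) = (\<Sum>K\<leftarrow>qshuffle I J. if length K \<le> 1 then 1 else 0)"
    using zero_notin_qshuffle[OF IJ] by (intro sum_list_map_cong zetaQ_M)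
  then show "(\<Sum>K\<leftarrow>qshuffle I J. zetaQ (M K)) = zetaQ (M I) * zetaQ (M J)"
    by (simp only: qshuffle_zeta zetaQ_M IJ not_False_eq_True)
qed

lemma zetaQ_one: "zetaQ (one QSym) = 1"
  by (simp add: QSym_simps(5) zetaQ_M)

text \<open>On the basis \<open>zetaQ\<close> is the counit plus the indicator of words of length
  one, and the \<open>m\<close>-th convolution power of that indicator is the indicator of length
  \<open>m\<close>. The geometric series then gives the sign.\<close>

definition zetaQ_inv :: "'l::finite pseries \<Rightarrow> rat" where
  "zetaQ_inv = M_extend (\<lambda>I. (- 1) ^ length I)"

lemma linear_zetaQ_inv: "linear_onQ (hspace QSym) zetaQ_inv"
  unfolding zetaQ_inv_def by (rule linear_M_extend_QSym)

lemma zetaQ_inv_M: "0 \<notin> set I \<Longrightarrow> zetaQ_inv (M I) = (- 1) ^ length I"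
  by (simp add: zetaQ_inv_def M_extend_M)

lemma zetaQ_inv_mul:
  assumes "a \<in> hspace QSym" "b \<in> hspace QSym"
  shows "zetaQ_inv (mul QSym a b) = zetaQ_inv a * zetaQ_inv b"
proof (rule multiplicative_QSymI[OF linear_zetaQ_inv _ assms])
  fix I J :: "(nat ^ 'a) list" assume IJ: "0 \<notin> set I" "0 \<notin> set J"
  have "(\<Sum>K\<leftarrow>qshuffle I J. zetaQ_inv (M K)) = (\<Sum>K\<leftarrow>qshuffle I J. (- 1) ^ length K)"
    using zero_notin_qshuffle[OF IJ] by (intro sum_list_map_cong zetaQ_inv_M)
  then show "(\<Sum>K\<leftarrow>qshuffle I J. zetaQ_inv (M K)) = zetaQ_inv (M I) * zetaQ_inv (M J)"
    by (simp only: qshuffle_sign zetaQ_inv_M IJ not_False_eq_True)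
qed

text \<open>For a nonempty word only the prefixes of length 0 and 1 contribute, and the lengths of
  their complements differ by one, so the two signs cancel.\<close>

lemma sum_splits_zeta_sign:
  "(\<Sum>(A, B)\<leftarrow>splits I. (if length A \<le> 1 then 1 else 0) * (- 1) ^ length B) = (if I = [] then 1 else 0 :: rat)"
proof (cases I)
  case (Cons a I')
  have "(\<Sum>(A, B)\<leftarrow>splits I'. (if length (a # A) \<le> 1 then 1 else 0) * (- 1) ^ length B) =
      (\<Sum>(A, B)\<leftarrow>splits I'. if A = [] then (- 1) ^ length B else 0 :: rat)"
    by (rule sum_list_cong_pairs) auto
  then show ?thesis
    using sum_splits_left_Nil[of "\<lambda>B. (- 1) ^ length B :: rat" I']
    by (simp add: Cons o_def case_prod_beta')
qed simp

lemma sum_splits_sign_zeta: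
  "(\<Sum>(A, B)\<leftarrow>splits I. (- 1) ^ length A * (if length B \<le> 1 then 1 else 0)) = (if I = [] then 1 else 0 :: rat)"
proof (induction I)
  case (Cons a I)
  have "(\<Sum>(A, B)\<leftarrow>splits (a # I). (- 1) ^ length A * (if length B \<le> 1 then 1 else 0 :: rat)) =
      (if length (a # I) \<le> 1 then 1 else 0) -
      (\<Sum>(A, B)\<leftarrow>splits I. (- 1) ^ length A * (if length B \<le> 1 then 1 else 0))"
    by (simp add: o_def case_prod_beta' uminus_sum_list_map[unfolded o_def])
  then show ?case unfolding Cons by (cases I) auto
qed simp

lemma conv_M:
  assumes "linear_onQ (hspace QSym) \<phi>" "linear_onQ (hspace QSym) \<psi>" "0 \<notin> set I"
  shows "conv QSym \<phi> \<psi> (M I) = (\<Sum>(A, B)\<leftarrow>splits I. \<phi> (M A) * \<psi> (M B))"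
  unfolding conv_eq_cop_lift by (intro cop_lift_M bilinear_onQ_mult assms)

lemma is_conv_inverse_zetaQ: "is_conv_inverse QSym zetaQ zetaQ_inv"
  unfolding is_conv_inverse_def
proof (intro conjI ballI linear_zetaQ_inv)
  fix h :: "'a pseries" assume h: "h \<in> hspace QSym"
  note lin = QSym.linear_conv[OF linear_zetaQ linear_zetaQ_inv] QSym.linear_conv[OF linear_zetaQ_inv linear_zetaQ]
  show "conv QSym zetaQ zetaQ_inv h = counit QSym h"
  proof (rule QSym_eqI[OF lin(1) linear_counit_QSym _ h])
    fix I :: "(nat ^ 'a) list" assume I: "0 \<notin> set I"
    have "conv QSym zetaQ zetaQ_inv (M I) =
        (\<Sum>(A, B)\<leftarrow>splits I. (if length A \<le> 1 then 1 else 0) * (- 1) ^ length B)"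
      unfolding conv_M[OF linear_zetaQ linear_zetaQ_inv I]
      by (rule sum_list_cong_pairs) (drule splits_nz[OF I], simp add: zetaQ_M zetaQ_inv_M)
    then show "conv QSym zetaQ zetaQ_inv (M I) = counit QSym (M I)"
      by (simp only: sum_splits_zeta_sign counit_M[OF I])
  qed
  show "conv QSym zetaQ_inv zetaQ h = counit QSym h"
  proof (rule QSym_eqI[OF lin(2) linear_counit_QSym _ h])
    fix I :: "(nat ^ 'a) list" assume I: "0 \<notin> set I"
    have "conv QSym zetaQ_inv zetaQ (M I) =
        (\<Sum>(A, B)\<leftarrow>splits I. (- 1) ^ length A * (if length B \<le> 1 then 1 else 0))"
      unfolding conv_M[OF linear_zetaQ_inv linear_zetaQ I]
      by (rule sum_list_cong_pairs) (drule splits_nz[OF I], simp add: zetaQ_M zetaQ_inv_M)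
    then show "conv QSym zetaQ_inv zetaQ (M I) = counit QSym (M I)"
      by (simp only: sum_splits_sign_zeta counit_M[OF I])
  qed
qed

lemma conv_inverse_zetaQ: "h \<in> hspace QSym \<Longrightarrow> conv_inverse QSym zetaQ h = zetaQ_inv h"
  by (rule QSym.conv_inverse_eq[OF linear_zetaQ is_conv_inverse_zetaQ])

lemma linear_conv_inverse_zetaQ: "linear_onQ (hspace QSym) (conv_inverse QSym zetaQ)"
  by (rule linear_onQ_cong[OF linear_zetaQ_inv subspace_hspace conv_inverse_zetaQ])

section \<open>The odd subalgebra\<close>

lemma below_add: "below (m + n) k \<Longrightarrow> below m k \<and> below n k"
  unfolding below_def less_eq_vec_def
  by (auto intro: order_trans[rotated])

context graded_bialg
begin

context
  fixes \<phi> \<psi> :: "'h \<Rightarrow> rat" and k :: "enat ^ 'l"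
  assumes \<phi>: "linear_onQ (hspace H) \<phi>" and \<psi>: "linear_onQ (hspace H) \<psi>"
begin

lemma one_in_agreement:
  assumes "\<phi> (one H) = \<psi> (one H)"
  shows "one H \<in> agreement_subcoalgebra H k \<phi> \<psi>"
proof -
  have "qvs.span {one H} \<subseteq> agreement_subcoalgebra H k \<phi> \<psi>"
  proof (rule subset_agreement_subcoalgebra[OF \<phi> \<psi> graded_subcoalgebra_one])
    fix h assume h: "h \<in> qvs.span {one H}"
    have sub: "qvs.span {one H} \<subseteq> hspace H"
      by (rule qvs.span_minimal[OF _ subspace_hspace]) (simp add: one_in_hspace)
    show "\<phi> h = \<psi> h"
      by (rule linear_onQ_eq_on_span[OF linear_onQ_subset[OF \<phi> sub] linear_onQ_subset[OF \<psi> sub] _ h])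
        (simp add: assms)
  qed
  then show ?thesis by (auto intro: qvs.span_base)
qed

text \<open>The span of products is a graded subcoalgebra, and by maximality it suffices that the
  functionals agree on it in the relevant degrees. Multiplicativity is asked for homogeneous
  arguments, where \<open>bar\<close> is just a sign.\<close>

lemma mul_in_agreement:
  assumes mult: "\<And>m n a b. a \<in> grade H m \<Longrightarrow> b \<in> grade H n \<Longrightarrow> \<phi> (mul H a b) = \<phi> a * \<phi> b"
      "\<And>m n a b. a \<in> grade H m \<Longrightarrow> b \<in> grade H n \<Longrightarrow> \<psi> (mul H a b) = \<psi> a * \<psi> b"
    and ab: "a \<in> agreement_subcoalgebra H k \<phi> \<psi>" "b \<in> agreement_subcoalgebra H k \<phi> \<psi>"
  shows "mul H a b \<in> agreement_subcoalgebra H k \<phi> \<psi>"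
proof -
  let ?C = "agreement_subcoalgebra H k \<phi> \<psi>"
  interpret C: graded_subcoalg H ?C
    by unfold_locales (rule graded_subcoalgebra_agreement[OF \<phi> \<psi>])
  let ?B = "\<Union>n. ?C \<inter> grade H n"
  let ?D = "qvs.span {mul H a b | a b. a \<in> ?C \<and> b \<in> ?C}"
  have D: "graded_subcoalgebra H ?D"
    by (rule graded_subcoalgebra_products[OF C.graded_subcoalgebra])
  then have D_sub: "?D \<subseteq> hspace H" by (simp add: graded_subcoalgebra_def)
  have "?D \<subseteq> ?C"
  proof (rule subset_agreement_subcoalgebra[OF \<phi> \<psi> D])
    fix n h assume n: "below n k" and h: "h \<in> ?D" "h \<in> grade H n"
    have "\<phi> (component H n h) = \<psi> (component H n h)"
    proof (rule linear_onQ_eq_on_span[OF linear_onQ_subset[OF linear_on_component[OF \<phi>] D_sub]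
          linear_onQ_subset[OF linear_on_component[OF \<psi>] D_sub] _ h(1)])
      fix x assume "x \<in> {mul H a b | a b. a \<in> ?C \<and> b \<in> ?C}"
      then obtain a b where x: "x = mul H a b" and ab: "a \<in> qvs.span ?B" "b \<in> qvs.span ?B"
        using C.C_span by blast
      have bil: "bilinear_onQ (qvs.span ?B) (\<lambda>a b. f (component H n (mul H a b)))"
        if "linear_onQ (hspace H) f" for f :: "'h \<Rightarrow> rat"
        using bilinear_onQ_subset[OF bilinear_onQ_compose[OF bilinear_mul linear_on_component[OF that]]
            C.C_subset] mul_in_hspace
        by (simp only: C.C_span[symmetric])
      show "\<phi> (component H n x) = \<psi> (component H n x)"
        unfolding x
      proof (rule bilinear_onQ_eq_on_span[OF bil[OF \<phi>] bil[OF \<psi>] _ ab])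
        fix a b assume "a \<in> ?B" "b \<in> ?B"
        then obtain p q where pq: "a \<in> ?C" "a \<in> grade H p" "b \<in> ?C" "b \<in> grade H q" by blast
        show "\<phi> (component H n (mul H a b)) = \<psi> (component H n (mul H a b))"
        proof (cases "n = p + q")
          case True
          \<comment> \<open>Degrees are nonnegative, so a sum bounded by \<open>k\<close> has both
            summands bounded by \<open>k\<close>; agreement is thus available for each
            factor.\<close>
          then have "below p k" "below q k" using below_add n by blast+
          then have "\<phi> a = \<psi> a" "\<phi> b = \<psi> b"
            using agreement_subcoalgebra_eqD[OF \<phi> \<psi>] pq by blast+
          with True show ?thesis
            using pq by (simp add: component_grade[OF mul_in_grade[OF pq(2,4)]] mult[OF pq(2,4)])
        next
          case False
          then show ?thesis
            by (simp add: component_grade[OF mul_in_grade[OF pq(2,4)]]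
                linear_onQ_zero[OF \<phi> subspace_hspace] linear_onQ_zero[OF \<psi> subspace_hspace])
        qed
      qed
    qed
    then show "\<phi> h = \<psi> h" by (simp add: component_grade[OF h(2)])
  qed
  moreover have "mul H a b \<in> ?D" using ab by (intro qvs.span_base) blast
  ultimately show ?thesis by blast
qed

end

end

section \<open>Convolution inverses and \<open>bar\<close> on subcoalgebras\<close>

context graded_subcoalg
begin

lemma is_conv_inverse_restrict_grade:
  assumes "linear_onQ (hspace H) \<phi>" "is_conv_inverse H \<phi> \<psi>"
  shows "is_conv_inverse (restrict_grade H C) \<phi> \<psi>"
proof -
  have \<psi>: "linear_onQ (hspace H) \<psi>" using assms(2) by (simp add: is_conv_inverse_def)
  have "conv (restrict_grade H C) \<phi> \<psi> h = conv H \<phi> \<psi> h"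
    "conv (restrict_grade H C) \<psi> \<phi> h = conv H \<psi> \<phi> h" if "h \<in> C" for h
    unfolding conv_eq_cop_lift
    by (intro cop_lift_restrict_grade bilinear_onQ_mult assms(1) \<psi> that)+
  then show ?thesis
    using assms(2) C_subset linear_onQ_subset[OF _ C_subset]
    by (auto simp: is_conv_inverse_def restrict_grade_simps)
qed

lemma bar_restrict_grade: "h \<in> C \<Longrightarrow> bar (restrict_grade H C) \<phi> h = bar H \<phi> h"
  by (simp add: bar_def component_restrict_grade)

end

section \<open>The odd part as a connected Hopf algebra\<close>

lemma linear_bar_zetaQ: "linear_onQ (hspace QSym) (bar QSym zetaQ)"
  by (rule QSym.linear_bar[OF linear_zetaQ])

lemma bar_zetaQ_mul:
  assumes "a \<in> grade QSym m" "b \<in> grade QSym n"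
  shows "bar QSym zetaQ (mul QSym a b) = bar QSym zetaQ a * bar QSym zetaQ b"
  using assms grade_in_hspace[OF assms(1)] grade_in_hspace[OF assms(2)]
  by (simp add: QSym.bar_grade[OF linear_zetaQ] QSym.bar_grade[OF linear_zetaQ QSym.mul_in_grade]
      zetaQ_mul weight_add power_add)

lemma conv_inverse_zetaQ_mul:
  assumes "a \<in> grade QSym m" "b \<in> grade QSym n"
  shows "conv_inverse QSym zetaQ (mul QSym a b) = conv_inverse QSym zetaQ a * conv_inverse QSym zetaQ b"
  using grade_in_hspace[OF assms(1)] grade_in_hspace[OF assms(2)]
  by (simp add: conv_inverse_zetaQ QSym.mul_in_hspace zetaQ_inv_mul)

lemma graded_subcoalgebra_odd_part: "graded_subcoalgebra QSym (odd_part k)"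
  unfolding odd_part_def
  by (rule QSym.graded_subcoalgebra_agreement[OF linear_bar_zetaQ linear_conv_inverse_zetaQ])

lemma one_in_odd_part: "one QSym \<in> odd_part k"
  unfolding odd_part_def
proof (rule QSym.one_in_agreement[OF linear_bar_zetaQ linear_conv_inverse_zetaQ])
  show "bar QSym zetaQ (one QSym) = conv_inverse QSym zetaQ (one QSym)"
    by (simp add: QSym.bar_grade[OF linear_zetaQ QSym.one_in_grade] conv_inverse_zetaQ
        QSym.one_in_hspace zetaQ_one weight_eq_0_iff[THEN iffD2])
      (simp add: QSym_simps(5) zetaQ_inv_M)
qed

lemma mul_in_odd_part: "a \<in> odd_part k \<Longrightarrow> b \<in> odd_part k \<Longrightarrow> mul QSym a b \<in> odd_part k"
  unfolding odd_part_def
  by (rule QSym.mul_in_agreement[OF linear_bar_zetaQ linear_conv_inverse_zetaQ bar_zetaQ_mul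
        conv_inverse_zetaQ_mul])

lemma odd_QSym_eq: "odd_QSym k = restrict_grade QSym (odd_part k)"
  by (simp add: odd_QSym_def restrict_grade_def)

interpretation odd: graded_subcoalg QSym "odd_part k" for k
  by unfold_locales (rule graded_subcoalgebra_odd_part)

lemma odd_QSym_simps:
  "hspace (odd_QSym k) = odd_part k" "grade (odd_QSym k) n = odd_part k \<inter> grade QSym n"
  "cop (odd_QSym k) = cop QSym" "counit (odd_QSym k) = counit QSym"
  "mul (odd_QSym k) = mul QSym" "one (odd_QSym k) = one QSym"
  unfolding odd_QSym_eq by (simp_all add: odd.restrict_grade_simps) (simp_all add: restrict_grade_def)

lemma graded_bialgebra_odd_QSym: "graded_bialgebra (odd_QSym k)"
  unfolding odd_QSym_eq
  by (rule QSym.graded_bialgebra_restrict_grade[OF graded_subcoalgebra_odd_part one_in_odd_part mul_in_odd_part])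

lemma vector_comps_0: "vector_comps 0 = {[]}"
proof -
  have "I = []" if "I \<in> vector_comps 0" for I :: "(nat ^ 'l::finite) list"
  proof (cases I)
    case (Cons a J)
    then show ?thesis using that vec_add_eq_0_iff[of a "sum_list J"] by (auto simp: vector_comps_def)
  qed simp
  then show ?thesis by (auto simp: vector_comps_def)
qed

lemma grade_QSym_0: "grade QSym 0 = range (\<lambda>c. c *\<^sub>Q one QSym)"
  by (simp add: QSym_simps vector_comps_0 qvs.span_singleton)

lemma connected_odd_QSym: "grade (odd_QSym k) 0 = range (\<lambda>c. c *\<^sub>Q one (odd_QSym k))"
  unfolding odd_QSym_simps grade_QSym_0
  using qvs.subspace_scale[OF odd.subspace_C one_in_odd_part] by blast

lemma graded_connected_hopf_odd_QSym: "graded_connected_hopf (odd_QSym k)"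
proof -
  interpret connected_bialg "odd_QSym k"
    by unfold_locales (rule graded_bialgebra_odd_QSym, rule connected_odd_QSym)
  show ?thesis
    unfolding graded_connected_hopf_def
    using graded_bialgebra_odd_QSym is_antipode_takeuchi connected_odd_QSym by blast
qed

lemma comb_hopf_odd_QSym: "comb_hopf (odd_QSym k) zetaQ"
  using graded_connected_hopf_odd_QSym odd.C_subset linear_onQ_subset[OF linear_zetaQ odd.C_subset]
  by (auto simp: comb_hopf_def character_def odd_QSym_simps zetaQ_one subset_iff intro!: zetaQ_mul)

text \<open>The inverses chosen over \<open>QSym\<close> and over the odd part are separate choices;
  each equals \<open>zetaQ_inv\<close> on the odd part, and \<open>bar\<close> is unchanged because
  components are. Oddness is then the defining agreement.\<close>

lemma odd_functional_odd_QSym: "odd_functional (odd_QSym k) k zetaQ"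
proof -
  interpret K: graded_coalg "odd_QSym k"
    by unfold_locales (use graded_bialgebra_odd_QSym[of k] in \<open>simp add: graded_bialgebra_def\<close>)
  have inv: "is_conv_inverse (odd_QSym k) zetaQ zetaQ_inv"
    unfolding odd_QSym_eq by (rule odd.is_conv_inverse_restrict_grade[OF linear_zetaQ is_conv_inverse_zetaQ])
  have lin: "linear_onQ (hspace (odd_QSym k)) zetaQ"
    using linear_onQ_subset[OF linear_zetaQ odd.C_subset] by (simp add: odd_QSym_simps)
  have "bar (odd_QSym k) zetaQ h = conv_inverse (odd_QSym k) zetaQ h"
    if "below n k" "h \<in> grade (odd_QSym k) n" for n h
  proof -
    have h: "h \<in> odd_part k" "h \<in> grade QSym n" using that by (auto simp: odd_QSym_simps)
    have "bar (odd_QSym k) zetaQ h = bar QSym zetaQ h"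
      using h by (simp add: odd_QSym_eq odd.bar_restrict_grade)
    also have "\<dots> = conv_inverse QSym zetaQ h"
      using QSym.agreement_subcoalgebra_eqD[OF linear_bar_zetaQ linear_conv_inverse_zetaQ that(1)] h
      by (simp add: odd_part_def)
    also have "\<dots> = zetaQ_inv h"
      using h grade_in_hspace by (intro conv_inverse_zetaQ) blast
    also have "\<dots> = conv_inverse (odd_QSym k) zetaQ h"
      using K.conv_inverse_eq[OF lin inv] h by (simp add: odd_QSym_simps)
    finally show ?thesis .
  qed
  with lin inv show ?thesis by (auto simp: odd_functional_def)
qed

section \<open>Coefficients as convolution products\<close>

abbreviation coeff :: "(nat ^ 'l::finite) list \<Rightarrow> 'l pseries \<Rightarrow> rat" where
  "coeff I f \<equiv> f (canonical_monomial I)"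

lemma coeff_Nil:
  assumes "f \<in> hspace QSym"
  shows "coeff [] f = counit QSym f"
  by (rule QSym_eqI[OF linear_onQ_eval linear_counit_QSym _ assms])
    (simp add: counit_M M_canonical_monomial)

text \<open>Among words with nonzero sum \<open>i\<close>, the only one of length at most one is
  \<open>[i]\<close>, so in degree \<open>i\<close> both functionals single out the same basis
  element.\<close>

lemma coeff_singleton:
  assumes "f \<in> grade QSym p" "i \<noteq> 0"
  shows "coeff [i] f = (if p = i then zetaQ f else 0)"
proof (cases "p = i")
  case True
  have "coeff [i] f = zetaQ f"
  proof (rule QSym_grade_eqI[OF linear_onQ_eval linear_zetaQ _ assms(1)])
    fix I assume "I \<in> vector_comps p"
    then show "coeff [i] (M I) = zetaQ (M I)"
      using True assms(2)
      by (cases I rule: remdups_adj.cases) (auto simp: vector_comps_def zetaQ_M M_canonical_monomial)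
  qed
  with True show ?thesis by simp
next
  case False
  have "coeff [i] f = 0"
    by (rule QSym_grade_eqI[OF linear_onQ_eval linear_onQ_const_zero _ assms(1)])
      (use False assms(2) in \<open>auto simp: vector_comps_def M_canonical_monomial\<close>)
  with False show ?thesis by simp
qed

lemma coeff_Cons:
  assumes "f \<in> hspace QSym" "0 \<notin> set (i # I)"
  shows "coeff (i # I) f = conv QSym (coeff [i]) (coeff I) f"
proof (rule QSym_eqI[OF linear_onQ_eval QSym.linear_conv[OF linear_onQ_eval linear_onQ_eval] _ assms(1)])
  fix J :: "(nat ^ 'a) list" assume J: "0 \<notin> set J"
  have "conv QSym (coeff [i]) (coeff I) (M J) =
      (\<Sum>(A, B)\<leftarrow>splits J. (if A = [i] then 1 else 0) * (if B = I then 1 else 0))"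
    unfolding conv_M[OF linear_onQ_eval linear_onQ_eval J]
    by (rule sum_list_cong_pairs)
      (drule splits_nz[OF J], use assms(2) in \<open>simp add: M_canonical_monomial\<close>)
  also have "\<dots> = (if J = i # I then 1 else 0)"
  proof (cases J)
    case (Cons j J')
    have "(\<Sum>(A, B)\<leftarrow>splits J'. (if j # A = [i] then 1 else 0) * (if B = I then 1 else 0)) =
        (\<Sum>(A, B)\<leftarrow>splits J'. if A = [] then if j = i \<and> B = I then 1 else 0 else (0 :: rat))"
      by (rule sum_list_cong_pairs) auto
    also have "\<dots> = (if j = i \<and> J' = I then 1 else 0)"
      by (rule sum_splits_left_Nil)
    finally show ?thesis
      by (simp add: Cons o_def case_prod_beta')
  qed simp
  finally show "coeff (i # I) (M J) = conv QSym (coeff [i]) (coeff I) (M J)"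
    using J assms(2) by (simp add: M_canonical_monomial)
qed

lemma QSym_coeff_eqI:
  assumes "f \<in> hspace QSym" "g \<in> hspace QSym" "\<And>I. 0 \<notin> set I \<Longrightarrow> coeff I f = coeff I g"
  shows "f = g"
proof -
  have "f - g = 0"
    by (rule QS_eq_0I) (use assms in \<open>auto simp: hspace_QSym[symmetric] qvs.subspace_diff[OF subspace_hspace]\<close>)
  then show ?thesis by simp
qed

lemma coalgebra_hom_unique:
  assumes H: "graded_coalgebra H"
    and \<Psi>: "graded_coalgebra_hom H QSym \<Psi>" and \<Psi>': "graded_coalgebra_hom H QSym \<Psi>'"
    and eq: "\<And>h. h \<in> hspace H \<Longrightarrow> zetaQ (\<Psi> h) = zetaQ (\<Psi>' h)" and h: "h \<in> hspace H"
  shows "\<Psi> h = \<Psi>' h"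
proof -
  interpret H: graded_coalg H by standard (rule H)
  interpret \<Psi>: coalg_hom H QSym \<Psi> by unfold_locales (rule \<Psi>)
  interpret \<Psi>': coalg_hom H QSym \<Psi>' by unfold_locales (rule \<Psi>')
  note lin = \<Psi>.linear_comp_\<Psi>[OF linear_onQ_eval] \<Psi>'.linear_comp_\<Psi>[OF linear_onQ_eval]
  have single: "coeff [i] (\<Psi> h) = coeff [i] (\<Psi>' h)" if "i \<noteq> 0" "h \<in> hspace H" for i h
    by (rule linear_onQ_eq_hspace[OF lin _ that(2)])
      (use that(1) eq grade_in_hspace in \<open>auto simp: coeff_singleton[OF \<Psi>.\<Psi>_grade] coeff_singleton[OF \<Psi>'.\<Psi>_grade]\<close>)
  have "coeff I (\<Psi> h) = coeff I (\<Psi>' h)" if "0 \<notin> set I" "h \<in> hspace H" for I h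
    using that
  proof (induction I arbitrary: h)
    case Nil
    then show ?case
      by (simp add: coeff_Nil \<Psi>.\<Psi>_hspace \<Psi>'.\<Psi>_hspace \<Psi>.counit_\<Psi> \<Psi>'.counit_\<Psi>)
  next
    case (Cons i I)
    have "coeff (i # I) (\<Psi> h) = conv QSym (coeff [i]) (coeff I) (\<Psi> h)"
      by (rule coeff_Cons[OF \<Psi>.\<Psi>_hspace[OF Cons.prems(2)] Cons.prems(1)])
    also have "\<dots> = conv H (\<lambda>x. coeff [i] (\<Psi> x)) (\<lambda>x. coeff I (\<Psi> x)) h"
      by (rule \<Psi>.conv_\<Psi>[OF linear_onQ_eval linear_onQ_eval Cons.prems(2)])
    also have "\<dots> = conv H (\<lambda>x. coeff [i] (\<Psi>' x)) (\<lambda>x. coeff I (\<Psi>' x)) h"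
      by (rule conv_cong) (use Cons single in auto)
    also have "\<dots> = conv QSym (coeff [i]) (coeff I) (\<Psi>' h)"
      by (rule \<Psi>'.conv_\<Psi>[symmetric, OF linear_onQ_eval linear_onQ_eval Cons.prems(2)])
    also have "\<dots> = coeff (i # I) (\<Psi>' h)"
      by (rule coeff_Cons[symmetric, OF \<Psi>'.\<Psi>_hspace[OF Cons.prems(2)] Cons.prems(1)])
    finally show ?case .
  qed
  then show ?thesis
    using h by (intro QSym_coeff_eqI \<Psi>.\<Psi>_hspace \<Psi>'.\<Psi>_hspace) auto
qed

text \<open>The coefficient at \<open>i # I\<close> is a Sweedler sum. It is pulled back to
  \<open>H\<close>, expanded there by multiplicativity of the coproduct, and pushed forward once per
  factor. The left entries are handled by \<open>single\<close>, the right ones by the induction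
  hypothesis, which must therefore hold for arbitrary pairs of elements.\<close>

lemma coalgebra_hom_mul:
  assumes H: "graded_bialgebra H" and \<Psi>: "graded_coalgebra_hom H QSym \<Psi>"
    and mult: "\<And>a b. a \<in> hspace H \<Longrightarrow> b \<in> hspace H \<Longrightarrow> zetaQ (\<Psi> (mul H a b)) = zetaQ (\<Psi> a) * zetaQ (\<Psi> b)"
    and ab: "a \<in> hspace H" "b \<in> hspace H"
  shows "\<Psi> (mul H a b) = mul QSym (\<Psi> a) (\<Psi> b)"
proof -
  interpret H: graded_bialg H by standard (rule H)
  interpret \<Psi>: coalg_hom H QSym \<Psi> by unfold_locales (rule \<Psi>)
  have bilin: "bilinear_onQ (hspace H) (\<lambda>x y. f (\<Psi> (mul H x y)))"
      "bilinear_onQ (hspace H) (\<lambda>x y. f (mul QSym (\<Psi> x) (\<Psi> y)))"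
    if "linear_onQ (hspace QSym) f" for f :: "'b pseries \<Rightarrow> rat"
    using bilinear_onQ_compose[OF H.bilinear_mul \<Psi>.linear_comp_\<Psi>[OF that]] H.mul_in_hspace
      \<Psi>.bilinear_\<Psi>[OF bilinear_onQ_compose[OF QSym.bilinear_mul that]] QSym.mul_in_hspace
    by blast+
  have single: "coeff [i] (\<Psi> (mul H x y)) = coeff [i] (mul QSym (\<Psi> x) (\<Psi> y))"
    if i: "i \<noteq> 0" and xy: "x \<in> hspace H" "y \<in> hspace H" for i x y
  proof (rule bilinear_onQ_eq_on_span[where B = "\<Union>n. grade H n", folded hspace_def,
        OF bilin[OF linear_onQ_eval] _ xy])
    fix x y assume "x \<in> (\<Union>n. grade H n)" "y \<in> (\<Union>n. grade H n)"
    then obtain p q where pq: "x \<in> grade H p" "y \<in> grade H q" by auto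
    then have "x \<in> hspace H" "y \<in> hspace H" by (auto intro: grade_in_hspace)
    then show "coeff [i] (\<Psi> (mul H x y)) = coeff [i] (mul QSym (\<Psi> x) (\<Psi> y))"
      using coeff_singleton[OF \<Psi>.\<Psi>_grade[OF H.mul_in_grade[OF pq]] i]
        coeff_singleton[OF QSym.mul_in_grade[OF \<Psi>.\<Psi>_grade[OF pq(1)] \<Psi>.\<Psi>_grade[OF pq(2)]] i]
      by (simp add: mult zetaQ_mul \<Psi>.\<Psi>_hspace)
  qed
  have "coeff I (\<Psi> (mul H a b)) = coeff I (mul QSym (\<Psi> a) (\<Psi> b))"
    if "0 \<notin> set I" "a \<in> hspace H" "b \<in> hspace H" for I a b
    using that
  proof (induction I arbitrary: a b)
    case Nil
    then show ?case
      by (simp add: coeff_Nil \<Psi>.\<Psi>_hspace H.mul_in_hspace QSym.mul_in_hspace \<Psi>.counit_\<Psi>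
          H.counit_mul QSym.counit_mul)
  next
    case (Cons i I)
    let ?g = "\<lambda>x y. coeff [i] x * coeff I y"
    have g: "bilinear_onQ (hspace QSym) ?g"
      by (rule bilinear_onQ_mult[OF linear_onQ_eval linear_onQ_eval])
    note g\<Psi> = \<Psi>.bilinear_\<Psi>[OF g]
    have hs: "\<Psi> (mul H a b) \<in> hspace QSym" "mul QSym (\<Psi> a) (\<Psi> b) \<in> hspace QSym"
      using Cons.prems by (simp_all add: \<Psi>.\<Psi>_hspace H.mul_in_hspace QSym.mul_in_hspace)
    have "coeff (i # I) (\<Psi> (mul H a b)) = cop_lift QSym ?g (\<Psi> (mul H a b))"
      by (simp only: coeff_Cons[OF hs(1) Cons.prems(1)] conv_eq_cop_lift)
    also have "\<dots> = cop_lift H (\<lambda>x y. ?g (\<Psi> x) (\<Psi> y)) (mul H a b)"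
      by (rule \<Psi>.cop_lift_\<Psi>[OF g]) (simp add: H.mul_in_hspace Cons.prems)
    also have "\<dots> = cop_lift H (\<lambda>c d. cop_lift H (\<lambda>c' d'. ?g (\<Psi> (mul H c c')) (\<Psi> (mul H d d'))) b) a"
      by (rule H.cop_lift_mul[OF g\<Psi> Cons.prems(2,3)])
    also have "\<dots> = cop_lift H (\<lambda>c d. cop_lift QSym (\<lambda>c' d'. ?g (mul QSym (\<Psi> c) c') (mul QSym (\<Psi> d) d')) (\<Psi> b)) a"
    proof (rule cop_lift_cong)
      fix c d assume cd: "c \<in> hspace H" "d \<in> hspace H"
      have "cop_lift H (\<lambda>c' d'. ?g (\<Psi> (mul H c c')) (\<Psi> (mul H d d'))) b =
          cop_lift H (\<lambda>c' d'. ?g (mul QSym (\<Psi> c) (\<Psi> c')) (mul QSym (\<Psi> d) (\<Psi> d'))) b"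
        by (rule cop_lift_cong)
          (use Cons.prems(1) in \<open>simp add: single Cons.IH cd\<close>)
      also have "\<dots> = cop_lift QSym (\<lambda>c' d'. ?g (mul QSym (\<Psi> c) c') (mul QSym (\<Psi> d) d')) (\<Psi> b)"
        by (rule \<Psi>.cop_lift_\<Psi>[symmetric, OF QSym.bilinear_mul_args[OF g]])
          (simp_all add: \<Psi>.\<Psi>_hspace cd Cons.prems)
      finally show "cop_lift H (\<lambda>c' d'. ?g (\<Psi> (mul H c c')) (\<Psi> (mul H d d'))) b =
          cop_lift QSym (\<lambda>c' d'. ?g (mul QSym (\<Psi> c) c') (mul QSym (\<Psi> d) d')) (\<Psi> b)" .
    qed
    also have "\<dots> = cop_lift QSym (\<lambda>c d. cop_lift QSym (\<lambda>c' d'. ?g (mul QSym c c') (mul QSym d d')) (\<Psi> b)) (\<Psi> a)"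
      by (rule \<Psi>.cop_lift_\<Psi>[symmetric, OF QSym.bilinear_cop_lift_mul[OF g]])
        (simp_all add: \<Psi>.\<Psi>_hspace Cons.prems)
    also have "\<dots> = cop_lift QSym ?g (mul QSym (\<Psi> a) (\<Psi> b))"
      by (rule QSym.cop_lift_mul[symmetric, OF g]) (simp_all add: \<Psi>.\<Psi>_hspace Cons.prems)
    also have "\<dots> = coeff (i # I) (mul QSym (\<Psi> a) (\<Psi> b))"
      by (simp only: coeff_Cons[OF hs(2) Cons.prems(1)] conv_eq_cop_lift)
    finally show ?case .
  qed
  then show ?thesis
    using ab by (intro QSym_coeff_eqI) (simp_all add: \<Psi>.\<Psi>_hspace H.mul_in_hspace QSym.mul_in_hspace)
qed

section \<open>The universal morphism\<close>

text \<open>Each nonzero letter has weight at least one. Together with the coordinatewise bound on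
  letters this leaves finitely many compositions of a vector.\<close>

lemma length_le_weight: "0 \<notin> set I \<Longrightarrow> length I \<le> weight (sum_list I)"
proof (induction I)
  case (Cons a I)
  then have "weight a \<noteq> 0" by (simp add: weight_eq_0_iff)
  with Cons show ?case by (simp add: weight_add)
qed simp

lemma nth_le_sum_list: "v \<in> set I \<Longrightarrow> v $ i \<le> (sum_list I :: nat ^ 'l::finite) $ i"
  by (induction I) (auto intro: trans_le_add2)

lemma finite_vector_comps: "finite (vector_comps n)"
proof (rule finite_subset)
  show "vector_comps n \<subseteq> {I. set I \<subseteq> {v. \<forall>i. v $ i \<le> n $ i} \<and> length I \<le> weight n}"
    using length_le_weight nth_le_sum_list by (auto simp: vector_comps_def)
  show "finite {I. set I \<subseteq> {v. \<forall>i. v $ i \<le> n $ i} \<and> length I \<le> weight n}"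
    by (rule finite_lists_length_le[OF finite_vec_le])
qed

lemma distinct_splits: "distinct (splits I)"
  by (induction I) (auto simp: distinct_map inj_on_def)

lemma sum_list_sum_swap: "(\<Sum>(a, b)\<leftarrow>xs. \<Sum>t\<in>T. f a b t) = (\<Sum>t\<in>T. \<Sum>(a, b)\<leftarrow>xs. (f a b t :: 'b::comm_monoid_add))"
  by (induction xs) (auto simp: sum.distrib)

lemma sum_list_scaleQ_left: "(\<Sum>(a, b)\<leftarrow>xs. f a b *\<^sub>Q v) = (\<Sum>(a, b)\<leftarrow>xs. f a b) *\<^sub>Q v"
  by (induction xs) (auto simp: scaleQ_add_left)

section \<open>Iterated coproducts and the functionals attached to compositions\<close>

context graded_coalg
begin

definition conv_list :: "('h \<Rightarrow> rat) list \<Rightarrow> 'h \<Rightarrow> rat" where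
  "conv_list fs = foldr (conv H) fs (counit H)"

lemma conv_list_simps [simp]:
  "conv_list [] = counit H" "conv_list (f # fs) = conv H f (conv_list fs)"
  by (simp_all add: conv_list_def)

lemma linear_conv_list: "(\<And>f. f \<in> set fs \<Longrightarrow> linear_onQ (hspace H) f) \<Longrightarrow> linear_onQ (hspace H) (conv_list fs)"
  by (induction fs) (auto simp: linear_counit linear_conv)

lemma conv_list_append:
  assumes "\<And>f. f \<in> set (fs @ gs) \<Longrightarrow> linear_onQ (hspace H) f" "h \<in> hspace H"
  shows "conv_list (fs @ gs) h = conv H (conv_list fs) (conv_list gs) h"
  using assms
proof (induction fs arbitrary: h)
  case Nil
  then show ?case by (simp add: conv_counit_left linear_conv_list)
next
  case (Cons f fs)
  have lin: "linear_onQ (hspace H) f" "linear_onQ (hspace H) (conv_list (fs @ gs))"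
    "linear_onQ (hspace H) (conv_list fs)" "linear_onQ (hspace H) (conv_list gs)"
    using Cons.prems by (auto intro!: linear_conv_list)
  have "conv_list ((f # fs) @ gs) h = conv H f (conv H (conv_list fs) (conv_list gs)) h"
    unfolding append_Cons conv_list_simps
    by (rule conv_cong) (use Cons in auto)
  also have "\<dots> = conv H (conv_list (f # fs)) (conv_list gs) h"
    using conv_assoc[OF lin(1,3,4) Cons.prems(2)] by simp
  finally show ?case .
qed

text \<open>The last clause of \<open>iterated_cop\<close> lifts this map, which splits the first
  tensor factor; multilinearity is what pins down the lift on pure tensors.\<close>

lemma multilinear_cop_head:
  "multilinear_onQ (hspace H) (\<lambda>xs. case xs of [] \<Rightarrow> 0
     | a # ys \<Rightarrow> cop_lift H (\<lambda>c d. tens (c # d # ys)) a)"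
proof -
  have bil: "bilinear_onQ (hspace H) (\<lambda>c d. tens (c # d # ys))" for ys :: "'h list"
    using linear_onQ_tens[of "hspace H" "[]"] linear_onQ_tens[of "hspace H" "[_]"]
    by (simp add: bilinear_onQ_def)
  show ?thesis
    unfolding multilinear_onQ_def
  proof (intro allI impI)
    fix xs ys assume xs: "set xs \<subseteq> hspace H"
    show "linear_onQ (hspace H) (\<lambda>a. case xs @ a # ys of [] \<Rightarrow> 0
        | a # ys \<Rightarrow> cop_lift H (\<lambda>c d. tens (c # d # ys)) a)"
    proof (cases xs)
      case Nil
      then show ?thesis by (simp add: linear_cop_lift bil)
    next
      case (Cons x xs')
      have "linear_onQ (hspace H) (\<lambda>a. cop_lift H (\<lambda>c d. tens (c # d # xs' @ a # ys)) x)"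
        by (rule linear_cop_lift_param[OF subspace_hspace bil])
          (use xs Cons linear_onQ_tens[of "hspace H" "_ # _ # xs'" ys] in auto)
      then show ?thesis by (simp add: Cons)
    qed
  qed
qed

text \<open>The iterated coproduct is obtained by splitting the first factor of the shorter one.
  Composing \<open>L\<close> with that splitting merges the first two functionals into their
  convolution, so the induction passes to a shorter list with a different \<open>L\<close>;
  associativity restores the bracketing of \<open>conv_list\<close>.\<close>

lemma iterated_cop_eval:
  assumes "\<And>f. f \<in> set fs \<Longrightarrow> linear_onQ (hspace H) f" "linear_onQ UNIV L" "h \<in> hspace H"
    and "\<And>xs. set xs \<subseteq> hspace H \<Longrightarrow> length xs = length fs \<Longrightarrow>
      L (tens xs) = prod_list (map2 (\<lambda>f x. f x) fs xs)"
  shows "L (iterated_cop H (length fs) h) = conv_list fs h"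
  using assms(1,2,4)
proof (induction "length fs" arbitrary: fs L rule: less_induct)
  case less
  consider "fs = []" | f where "fs = [f]" | f g gs where "fs = f # g # gs"
    by (cases fs rule: remdups_adj.cases) auto
  then show ?case
  proof cases
    case 1
    then show ?thesis
      using less.prems(3)[of "[]"] by (simp add: linear_onQ_scale[OF less.prems(2)] scaleQ_rat_def)
  next
    case 2
    then show ?thesis
      using less.prems(1) less.prems(3)[of "[h]"] assms(3) by (simp add: conv_counit_right)
  next
    case 3
    have lin: "linear_onQ (hspace H) f" "linear_onQ (hspace H) g" "\<And>k. k \<in> set gs \<Longrightarrow> linear_onQ (hspace H) k"
      using less.prems(1) by (auto simp: 3)
    define D where "D = tensor_lift (hspace H) (\<lambda>xs. case xs of [] \<Rightarrow> 0
      | a # ys \<Rightarrow> cop_lift H (\<lambda>c d. tens (c # d # ys)) a)"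
    note D = tensor_lift[OF subspace_hspace multilinear_cop_head, folded D_def]
    have "L (iterated_cop H (length fs) h) = L (D (iterated_cop H (length (conv H f g # gs)) h))"
      unfolding 3 D_def cop_lift_def by simp
    also have "\<dots> = conv_list (conv H f g # gs) h"
    proof (rule less.hyps[where L = "\<lambda>t. L (D t)"])
      show "length (conv H f g # gs) < length fs" by (simp add: 3)
      show "linear_onQ (hspace H) k" if "k \<in> set (conv H f g # gs)" for k
        using that lin linear_conv by auto
      show "linear_onQ UNIV (\<lambda>t. L (D t))"
        by (rule linear_onQ_compose[OF less.prems(2) D(1)]) simp
      fix xs assume xs: "set xs \<subseteq> hspace H" "length xs = length (conv H f g # gs)"
      then obtain a ys where a: "xs = a # ys" "a \<in> hspace H" "set ys \<subseteq> hspace H" "length ys = length gs"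
        by (cases xs) auto
      let ?P = "prod_list (map2 (\<lambda>f x. f x) gs ys)"
      have bil: "bilinear_onQ (hspace H) (\<lambda>c d. tens (c # d # ys))"
        using linear_onQ_tens[of "hspace H" "[]"] linear_onQ_tens[of "hspace H" "[_]"]
        by (simp add: bilinear_onQ_def)
      have "L (D (tens xs)) = L (cop_lift H (\<lambda>c d. tens (c # d # ys)) a)"
        using D(2)[OF xs(1)] by (simp add: a(1))
      also have "\<dots> = cop_lift H (\<lambda>c d. L (tens (c # d # ys))) a"
        by (rule cop_lift_compose[OF bil less.prems(2)]) (auto simp: a)
      also have "\<dots> = cop_lift H (\<lambda>c d. f c * g d * ?P) a"
      proof (rule cop_lift_cong)
        fix c d assume "c \<in> hspace H" "d \<in> hspace H"
        then show "L (tens (c # d # ys)) = f c * g d * ?P"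
          using less.prems(3)[of "c # d # ys"] a by (simp add: 3 mult.assoc)
      qed
      also have "\<dots> = conv H f g a * ?P"
        unfolding conv_eq_cop_lift
        by (rule cop_lift_compose[symmetric, OF bilinear_onQ_mult[OF lin(1,2)]
              linear_onQ_times_left[OF linear_onQ_id] qvs.subspace_UNIV]) (auto simp: a)
      finally show "L (D (tens xs)) = prod_list (map2 (\<lambda>f x. f x) (conv H f g # gs) xs)"
        by (simp add: a(1))
    qed
    also have "\<dots> = conv_list fs h"
      using conv_assoc[OF lin(1,2) linear_conv_list[OF lin(3)] assms(3)] by (simp add: 3)
    finally show ?thesis .
  qed
qed

text \<open>The convolution product of the truncations of \<phi> to the degrees in the word. It will
  coincide with \<open>comp_functional\<close>, and in this form concatenation of words is visibly
  convolution.\<close>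

definition word_functional :: "('h \<Rightarrow> rat) \<Rightarrow> (nat ^ 'l) list \<Rightarrow> 'h \<Rightarrow> rat" where
  "word_functional \<phi> I = conv_list (map (\<lambda>i h. \<phi> (component H i h)) I)"

context
  fixes \<phi> :: "'h \<Rightarrow> rat"
  assumes \<phi>: "linear_onQ (hspace H) \<phi>"
begin

lemma linear_word_functional: "linear_onQ (hspace H) (word_functional \<phi> I)"
  unfolding word_functional_def by (rule linear_conv_list) (auto intro: linear_on_component[OF \<phi>])

lemma word_functional_append:
  "h \<in> hspace H \<Longrightarrow> word_functional \<phi> (A @ B) h = conv H (word_functional \<phi> A) (word_functional \<phi> B) h"
  unfolding word_functional_def map_append
  by (rule conv_list_append) (auto intro: linear_on_component[OF \<phi>])

lemma word_functional_grade:
  "h \<in> grade H n \<Longrightarrow> sum_list I \<noteq> n \<Longrightarrow> word_functional \<phi> I h = 0"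
proof (induction I arbitrary: h n)
  case Nil
  then show ?case by (simp add: word_functional_def counit_grade)
next
  case (Cons i I)
  have "word_functional \<phi> (i # I) h = cop_lift H (\<lambda>a b. \<phi> (component H i a) * word_functional \<phi> I b) h"
    by (simp add: word_functional_def conv_eq_cop_lift)
  also have "\<dots> \<in> {0}"
  proof (rule cop_lift_in_grade[OF bilinear_onQ_mult[OF linear_on_component[OF \<phi>] linear_word_functional]
        qvs.subspace_single_0 Cons.prems(1)])
    fix p q a b assume pq: "p + q = n" and a: "a \<in> grade H p" and b: "b \<in> grade H q"
    show "\<phi> (component H i a) * word_functional \<phi> I b \<in> {0}"
    proof (cases "i = p")
      case True
      then have "sum_list I \<noteq> q" using pq Cons.prems(2) by auto
      then show ?thesis using Cons.IH[OF b] by simp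
    next
      case False
      then show ?thesis
        by (simp add: component_grade[OF a] linear_onQ_zero[OF \<phi> subspace_hspace])
    qed
  qed
  finally show ?case by simp
qed

text \<open>The projection, the tensor power of \<phi> and the multiplication compose to one linear
  map, whose value on a pure tensor is the product of the truncated functionals.\<close>

lemma comp_functional_eq:
  assumes "h \<in> hspace H"
  shows "comp_functional H \<phi> I h = word_functional \<phi> I h"
proof -
  let ?c = "\<lambda>xs. if length xs = length I then tens (map2 (component H) I xs) else 0"
  have comp_ml: "multilinear_onQ (hspace H) ?c"
    unfolding multilinear_onQ_def
  proof (intro allI impI)
    fix xs ys :: "'h list"
    show "linear_onQ (hspace H) (\<lambda>a. ?c (xs @ a # ys))"
    \<comment> \<open>The length does not depend on the inserted letter, so \<open>undefined\<close>
      stands in for it.\<close>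
    proof (cases "length (xs @ undefined # ys) = length I")
      case True
      then have "map2 (component H) I (xs @ a # ys) =
          map2 (component H) (take (length xs) I) xs @ component H (I ! length xs) a #
          map2 (component H) (drop (Suc (length xs)) I) ys" for a
        by (subst id_take_nth_drop[of "length xs" I]) (auto simp: zip_append1)
      then show ?thesis
        using True linear_onQ_compose[OF linear_onQ_tens[of UNIV] linear_component]
        by simp
    qed (simp add: linear_onQ_const_zero)
  qed
  have \<phi>_ml: "multilinear_onQ (hspace H) (\<lambda>xs. tens (map \<phi> xs))"
    unfolding multilinear_onQ_def using linear_onQ_compose[OF linear_onQ_tens[of UNIV] \<phi>] by simp
  have prod_ml: "multilinear_onQ UNIV (prod_list :: rat list \<Rightarrow> rat)"
    unfolding multilinear_onQ_def linear_onQ_def by (simp add: scaleQ_rat_def algebra_simps)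
  note T1 = tensor_lift[OF subspace_hspace comp_ml, folded tensor_component_def]
  note T2 = tensor_lift[OF subspace_hspace \<phi>_ml]
  note T3 = tensor_lift[OF qvs.subspace_UNIV prod_ml]
  let ?L = "\<lambda>t. tensor_lift UNIV prod_list (tensor_lift (hspace H) (\<lambda>xs. tens (map \<phi> xs))
      (tensor_component H I t))"
  have "?L (iterated_cop H (length (map (\<lambda>i h. \<phi> (component H i h)) I)) h) =
      conv_list (map (\<lambda>i h. \<phi> (component H i h)) I) h"
  proof (rule iterated_cop_eval[OF _ _ assms])
    show "linear_onQ (hspace H) f" if "f \<in> set (map (\<lambda>i h. \<phi> (component H i h)) I)" for f
      using that by (auto intro: linear_on_component[OF \<phi>])
    show "linear_onQ UNIV ?L"
      by (intro linear_onQ_compose[OF T3(1)] linear_onQ_compose[OF T2(1)] T1(1)) auto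
    fix xs assume xs: "set xs \<subseteq> hspace H" "length xs = length (map (\<lambda>i h. \<phi> (component H i h)) I)"
    have "set (map2 (component H) I xs) \<subseteq> hspace H"
      using xs(1) by (auto dest: set_zip_rightD intro: component_in_hspace)
    then have "?L (tens xs) = prod_list (map \<phi> (map2 (component H) I xs))"
      using xs by (simp add: T1(2) T2(2) T3(2))
    also have "\<dots> = prod_list (map2 (\<lambda>f x. f x) (map (\<lambda>i h. \<phi> (component H i h)) I) xs)"
      by (simp add: zip_map1 o_def case_prod_beta')
    finally show "?L (tens xs) = prod_list (map2 (\<lambda>f x. f x) (map (\<lambda>i h. \<phi> (component H i h)) I) xs)" .
  qed
  then show ?thesis by (simp add: comp_functional_def word_functional_def)
qed

section \<open>Construction of the universal morphism\<close>

definition universal_grade :: "nat ^ 'l \<Rightarrow> 'h \<Rightarrow> 'l pseries" where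
  "universal_grade n h = (\<Sum>I\<in>vector_comps n. word_functional \<phi> I h *\<^sub>Q M I)"

definition universal_map :: "'h \<Rightarrow> 'l pseries" where
  "universal_map h = (\<Sum>n | component H n h \<noteq> 0. universal_grade n (component H n h))"

lemma linear_universal_grade: "linear_onQ (hspace H) (universal_grade n)"
  unfolding universal_grade_def[abs_def]
  by (intro linear_onQ_setsum linear_onQ_scale_left linear_word_functional)

lemma linear_universal_map: "linear_onQ (hspace H) universal_map"
  unfolding universal_map_def[abs_def] by (rule linear_sum_components[OF linear_universal_grade])

lemma universal_map_grade: "h \<in> grade H n \<Longrightarrow> universal_map h = universal_grade n h"
  unfolding universal_map_def
  by (rule sum_components_grade) (rule linear_onQ_zero[OF linear_universal_grade subspace_hspace])

lemma universal_grade_in: "universal_grade n h \<in> grade QSym n"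
  unfolding universal_grade_def QSym_simps
  by (intro qvs.span_sum qvs.span_scale qvs.span_base) auto

lemma universal_map_in: "h \<in> hspace H \<Longrightarrow> universal_map h \<in> hspace QSym"
  by (rule linear_onQ_image_hspace[OF linear_universal_map subspace_hspace])
    (auto simp: universal_map_grade intro!: grade_in_hspace[OF universal_grade_in])

lemma linear_universal_grade_sum:
  fixes f :: "'l pseries \<Rightarrow> 'v::rat_vector"
  assumes "linear_onQ (hspace QSym) f"
  shows "f (universal_grade n h) = (\<Sum>I\<in>vector_comps n. word_functional \<phi> I h *\<^sub>Q f (M I))"
proof -
  have "f (universal_grade n h) = (\<Sum>I\<in>vector_comps n. f (word_functional \<phi> I h *\<^sub>Q M I))"
    unfolding universal_grade_def
    by (rule linear_onQ_sum[OF assms subspace_hspace])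
      (auto intro!: qvs.subspace_scale subspace_hspace M_in_hspace dest: vector_comps_nz)
  also have "\<dots> = (\<Sum>I\<in>vector_comps n. word_functional \<phi> I h *\<^sub>Q f (M I))"
    by (intro sum.cong refl linear_onQ_scale[OF assms]) (auto intro: M_in_hspace dest: vector_comps_nz)
  finally show ?thesis .
qed

lemma counit_universal_map:
  assumes "h \<in> hspace H"
  shows "counit QSym (universal_map h) = counit H h"
proof (rule linear_onQ_eq_hspace[OF linear_onQ_compose[OF linear_counit_QSym linear_universal_map] linear_counit _ assms])
  fix n x assume x: "x \<in> grade H n"
  show "counit QSym (universal_map x) = counit H x"
  proof (cases "n = 0")
    case True
    have "word_functional \<phi> [] x = counit H x" by (simp add: word_functional_def)
    then show ?thesis
      using True by (simp add: universal_map_grade[OF x] linear_universal_grade_sum[OF linear_counit_QSym]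
          vector_comps_0 counit_M scaleQ_rat_def)
  next
    case False
    then have Nil: "[] \<notin> vector_comps n" by (simp add: vector_comps_def)
    show ?thesis
      unfolding universal_map_grade[OF x] linear_universal_grade_sum[OF linear_counit_QSym] counit_grade[OF False x]
    proof (rule sum.neutral, rule ballI)
      fix I assume "I \<in> vector_comps n"
      then have "0 \<notin> set I" "I \<noteq> []" using Nil vector_comps_nz by blast+
      then show "word_functional \<phi> I x *\<^sub>Q counit QSym (M I) = 0" by (simp add: counit_M)
    qed
  qed
qed (rule universal_map_in)

text \<open>Both sides give the tensor of \<open>M A\<close> and \<open>M B\<close> the same
  coefficient, the functional of the word \<open>A @ B\<close> at \<open>h\<close>: deconcatenation
  produces it on the left, and concatenation as convolution on the right.\<close>

lemma cop_universal_grade: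
  assumes h: "h \<in> grade H n"
  shows "cop QSym (universal_grade n h) = cop_lift H (\<lambda>a b. tens [universal_map a, universal_map b]) h"
proof -
  let ?w = "word_functional \<phi>"
  \<comment> \<open>One index set for all bidegrees: pairs whose sums differ from the degrees of the
    two tensor factors contribute 0, so the coefficient can be summed over the whole coproduct
    before degrees matter.\<close>
  let ?T = "{(A, B). A @ B \<in> vector_comps n}"
  have T: "?T = (\<Union>I\<in>vector_comps n. set (splits I))" by (auto simp: set_splits)
  have fin: "finite ?T" unfolding T using finite_vector_comps by auto
  have h': "h \<in> hspace H" by (rule grade_in_hspace[OF h])
  have bil: "bilinear_onQ (hspace H) (\<lambda>a b. tens [universal_map a, universal_map b])"
    by (rule bilinear_onQ_args[OF bilinear_onQ_tens[of UNIV] linear_universal_map linear_universal_map]) auto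
  obtain xs where xs: "cop H h = (\<Sum>(a, b)\<leftarrow>xs. tens [a, b])"
    "\<forall>(a, b)\<in>set xs. \<exists>i j. i + j = n \<and> a \<in> grade H i \<and> b \<in> grade H j"
    by (rule cop_grade_sum_list[OF h])
  have xs': "\<forall>(a, b)\<in>set xs. a \<in> hspace H \<and> b \<in> hspace H"
    using xs(2) grade_in_hspace by blast
  have tens_eq: "tens [universal_map a, universal_map b] = (\<Sum>(A, B)\<in>?T. (?w A a * ?w B b) *\<^sub>Q tens [M A, M B])"
    if ij: "i + j = n" and a: "a \<in> grade H i" and b: "b \<in> grade H j" for i j a b
  proof -
    have "tens [universal_map a, universal_map b] =
        (\<Sum>A\<in>vector_comps i. ?w A a *\<^sub>Q tens [M A, universal_grade j b])"
      unfolding universal_map_grade[OF a] universal_map_grade[OF b]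
      by (rule linear_universal_grade_sum[OF bilinear_onQ_left[OF bilinear_onQ_tens]])
        (rule grade_in_hspace[OF universal_grade_in])
    also have "\<dots> = (\<Sum>A\<in>vector_comps i. ?w A a *\<^sub>Q (\<Sum>B\<in>vector_comps j. ?w B b *\<^sub>Q tens [M A, M B]))"
      by (intro sum.cong refl arg_cong[where f = "scaleQ _"]
          linear_universal_grade_sum[OF bilinear_onQ_right[OF bilinear_onQ_tens]] M_in_hspace)
        (rule vector_comps_nz)
    also have "\<dots> = (\<Sum>(A, B)\<in>vector_comps i \<times> vector_comps j. (?w A a * ?w B b) *\<^sub>Q tens [M A, M B])"
      by (simp add: qvs.scale_sum_right sum.cartesian_product)
    also have "\<dots> = (\<Sum>(A, B)\<in>?T. (?w A a * ?w B b) *\<^sub>Q tens [M A, M B])"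
    proof (rule sum.mono_neutral_left[OF fin])
      show "vector_comps i \<times> vector_comps j \<subseteq> ?T" using ij by (auto simp: vector_comps_def)
      show "\<forall>p\<in>?T - vector_comps i \<times> vector_comps j. (case p of (A, B) \<Rightarrow> (?w A a * ?w B b) *\<^sub>Q tens [M A, M B]) = 0"
      proof
        fix p assume p: "p \<in> ?T - vector_comps i \<times> vector_comps j"
        obtain A B where AB: "p = (A, B)" by (cases p)
        with p have "A @ B \<in> vector_comps n" "(A, B) \<notin> vector_comps i \<times> vector_comps j" by auto
        then have "sum_list A \<noteq> i \<or> sum_list B \<noteq> j" by (auto simp: vector_comps_def)
        then have "?w A a * ?w B b = 0"
          using word_functional_grade[OF a] word_functional_grade[OF b] by auto
        then show "(case p of (A, B) \<Rightarrow> (?w A a * ?w B b) *\<^sub>Q tens [M A, M B]) = 0" by (simp add: AB)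
      qed
    qed
    finally show ?thesis .
  qed
  have "cop_lift H (\<lambda>a b. tens [universal_map a, universal_map b]) h =
      (\<Sum>(a, b)\<leftarrow>xs. tens [universal_map a, universal_map b])"
    by (rule cop_lift_sum_list[OF bil xs(1) xs'])
  also have "\<dots> = (\<Sum>(a, b)\<leftarrow>xs. \<Sum>p\<in>?T. (?w (fst p) a * ?w (snd p) b) *\<^sub>Q tens [M (fst p), M (snd p)])"
    by (rule sum_list_cong_pairs) (use xs(2) tens_eq in \<open>force simp: case_prod_beta'\<close>)
  also have "\<dots> = (\<Sum>p\<in>?T. (\<Sum>(a, b)\<leftarrow>xs. ?w (fst p) a * ?w (snd p) b) *\<^sub>Q tens [M (fst p), M (snd p)])"
    by (simp only: sum_list_sum_swap sum_list_scaleQ_left)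
  also have "\<dots> = (\<Sum>p\<in>?T. ?w (fst p @ snd p) h *\<^sub>Q tens [M (fst p), M (snd p)])"
  proof (intro sum.cong refl arg_cong2[where f = scaleQ])
    fix p
    show "(\<Sum>(a, b)\<leftarrow>xs. ?w (fst p) a * ?w (snd p) b) = ?w (fst p @ snd p) h"
      unfolding word_functional_append[OF h'] conv_eq_cop_lift
      by (rule cop_lift_sum_list[symmetric, OF bilinear_onQ_mult xs(1) xs']) (rule linear_word_functional)+
  qed
  \<comment> \<open>The pairs are grouped by their concatenation; each group consists of the
    deconcatenations of one composition.\<close>
  also have "\<dots> = (\<Sum>I\<in>vector_comps n. \<Sum>p\<in>{p \<in> ?T. fst p @ snd p = I}.
      ?w (fst p @ snd p) h *\<^sub>Q tens [M (fst p), M (snd p)])"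
    by (rule sum.group[symmetric, OF fin finite_vector_comps]) auto
  also have "\<dots> = (\<Sum>I\<in>vector_comps n. ?w I h *\<^sub>Q cop QSym (M I))"
  proof (rule sum.cong[OF refl])
    fix I assume I: "I \<in> vector_comps n"
    have "{p \<in> ?T. fst p @ snd p = I} = set (splits I)" using I by (auto simp: set_splits)
    then have "(\<Sum>p\<in>{p \<in> ?T. fst p @ snd p = I}. ?w (fst p @ snd p) h *\<^sub>Q tens [M (fst p), M (snd p)]) =
        (\<Sum>p\<in>set (splits I). ?w I h *\<^sub>Q tens [M (fst p), M (snd p)])"
      by (intro sum.cong) auto
    also have "\<dots> = ?w I h *\<^sub>Q cop QSym (M I)"
      unfolding cop_M[OF vector_comps_nz[OF I]] qvs.scale_sum_right[symmetric]
      by (simp add: sum_list_distinct_conv_sum_set[OF distinct_splits] case_prod_beta')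
    finally show "(\<Sum>p\<in>{p \<in> ?T. fst p @ snd p = I}. ?w (fst p @ snd p) h *\<^sub>Q tens [M (fst p), M (snd p)]) =
        ?w I h *\<^sub>Q cop QSym (M I)" .
  qed
  also have "\<dots> = cop QSym (universal_grade n h)"
    by (rule linear_universal_grade_sum[symmetric, OF QSym.linear_cop])
  finally show ?thesis ..
qed

lemma graded_coalgebra_hom_universal_map: "graded_coalgebra_hom H QSym universal_map"
  unfolding graded_coalgebra_hom_def cop_lift_def[symmetric]
proof (intro conjI allI ballI)
  have bil: "bilinear_onQ (hspace H) (\<lambda>a b. tens [universal_map a, universal_map b])"
    by (rule bilinear_onQ_args[OF bilinear_onQ_tens[of UNIV] linear_universal_map linear_universal_map]) auto
  show "linear_onQ (hspace H) universal_map" by (rule linear_universal_map)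
  show "universal_map ` grade H n \<subseteq> grade QSym n" for n
    using universal_grade_in by (auto simp: universal_map_grade)
  fix h assume h: "h \<in> hspace H"
  show "counit QSym (universal_map h) = counit H h" by (rule counit_universal_map[OF h])
  show "cop QSym (universal_map h) = cop_lift H (\<lambda>a b. tens [universal_map a, universal_map b]) h"
    by (rule linear_onQ_eq_hspace[OF linear_onQ_compose[OF QSym.linear_cop linear_universal_map universal_map_in]
          linear_cop_lift[OF bil] _ h])
      (simp_all only: universal_map_grade cop_universal_grade)
qed

text \<open>Only words of length at most one survive \<open>zetaQ\<close>. In degree
  \<open>n\<close> other than 0 this leaves \<open>[n]\<close> with coefficient \<phi>; in degree 0
  it leaves the empty word with the counit, which is where the first assumption enters.\<close>

lemma zetaQ_universal_map:
  assumes \<phi>_0: "\<And>h. h \<in> grade H 0 \<Longrightarrow> \<phi> h = counit H h" and h: "h \<in> hspace H"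
  shows "zetaQ (universal_map h) = \<phi> h"
proof (rule linear_onQ_eq_hspace[OF linear_onQ_compose[OF linear_zetaQ linear_universal_map universal_map_in] \<phi> _ h])
  fix n x assume x: "x \<in> grade H n"
  have x': "x \<in> hspace H" by (rule grade_in_hspace[OF x])
  have eq: "zetaQ (universal_map x) = (\<Sum>I\<in>vector_comps n. word_functional \<phi> I x * zetaQ (M I))"
    using linear_universal_grade_sum[OF linear_zetaQ] by (simp add: universal_map_grade[OF x] scaleQ_rat_def)
  show "zetaQ (universal_map x) = \<phi> x"
  proof (cases "n = 0")
    case True
    then show ?thesis
      using x \<phi>_0 unfolding eq by (simp add: vector_comps_0 zetaQ_M word_functional_def)
  next
    case False
    have "word_functional \<phi> I x * zetaQ (M I) = (if I = [n] then \<phi> x else 0)" if I: "I \<in> vector_comps n" for I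
    proof (cases I rule: remdups_adj.cases)
      case 1
      then show ?thesis using I False by (simp add: vector_comps_def)
    next
      case (2 i)
      then have "i = n" "n \<noteq> 0" using I by (auto simp: vector_comps_def)
      moreover have "word_functional \<phi> [n] x = \<phi> x"
        using conv_counit_right[OF linear_on_component[OF \<phi>] x'] component_grade[OF x, of n]
        by (simp add: word_functional_def)
      ultimately show ?thesis using 2 by (simp add: zetaQ_M)
    next
      case (3 i j I')
      then show ?thesis using vector_comps_nz[OF I] by (simp add: zetaQ_M)
    qed
    moreover have "[n] \<in> vector_comps n" using False by (simp add: vector_comps_def)
    ultimately show ?thesis
      unfolding eq using finite_vector_comps[of n] by (simp add: sum.delta)
  qed
qed

end

end

section \<open>The image of the morphism and its multiplicativity\<close>

lemma hom_image_in_odd_part: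
  assumes H: "graded_coalgebra H" and \<Psi>: "graded_coalgebra_hom H QSym \<Psi>"
    and \<phi>: "odd_functional H k \<phi>" and \<zeta>: "\<And>h. h \<in> hspace H \<Longrightarrow> zetaQ (\<Psi> h) = \<phi> h"
  shows "\<Psi> ` hspace H \<subseteq> odd_part k"
  unfolding odd_part_def
proof -
  interpret H: graded_coalg H by standard (rule H)
  interpret \<Psi>: coalg_hom H QSym \<Psi> by unfold_locales (rule \<Psi>)
  have lin: "linear_onQ (hspace H) \<phi>" using \<phi> by (simp add: odd_functional_def)
  have lin': "linear_onQ (hspace H) (\<lambda>x. zetaQ_inv (\<Psi> x))"
    by (rule \<Psi>.linear_comp_\<Psi>[OF linear_zetaQ_inv])
  have conv: "conv H \<phi> (\<lambda>x. zetaQ_inv (\<Psi> x)) h = conv H (\<lambda>x. zetaQ (\<Psi> x)) (\<lambda>x. zetaQ_inv (\<Psi> x)) h"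
    "conv H (\<lambda>x. zetaQ_inv (\<Psi> x)) \<phi> h = conv H (\<lambda>x. zetaQ_inv (\<Psi> x)) (\<lambda>x. zetaQ (\<Psi> x)) h"
    if "h \<in> hspace H" for h
    by (rule conv_cong; simp add: lin lin' that \<zeta>)+
  have inv: "is_conv_inverse H \<phi> (\<lambda>x. zetaQ_inv (\<Psi> x))"
    using \<Psi>.is_conv_inverse_\<Psi>[OF linear_zetaQ is_conv_inverse_zetaQ] conv
    by (simp add: is_conv_inverse_def)
  show "\<Psi> ` hspace H \<subseteq> agreement_subcoalgebra QSym k (bar QSym zetaQ) (conv_inverse QSym zetaQ)"
  proof (rule QSym.subset_agreement_subcoalgebra[OF linear_bar_zetaQ linear_conv_inverse_zetaQ
        \<Psi>.graded_subcoalgebra_image])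
    fix n x assume n: "below n k" and x: "x \<in> \<Psi> ` hspace H" "x \<in> grade QSym n"
    then obtain h where h: "h \<in> hspace H" "x = \<Psi> h" by blast
    \<comment> \<open>The chosen preimage of a homogeneous \<open>x\<close> may be inhomogeneous.
      Since \<Psi> commutes with components, the degree \<open>n\<close> part of \<open>h\<close> is
      a preimage too, and oddness of \<phi> applies to it.\<close>
    have "component QSym n (\<Psi> h) = \<Psi> (component H n h)"
    proof (rule linear_onQ_eq_hspace[OF \<Psi>.linear_comp_\<Psi>[OF QSym.linear_component]
          H.linear_on_component[OF \<Psi>.linear_\<Psi>] _ h(1)])
      fix m y assume y: "y \<in> grade H m"
      then show "component QSym n (\<Psi> y) = \<Psi> (component H n y)"
        using linear_onQ_zero[OF \<Psi>.linear_\<Psi> subspace_hspace]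
        by (simp add: H.component_grade[OF y] QSym.component_grade[OF \<Psi>.\<Psi>_grade[OF y]])
    qed
    then have x_eq: "x = \<Psi> (component H n h)"
      using QSym.component_grade[OF x(2), of n] h(2) by simp
    let ?y = "component H n h"
    have y: "?y \<in> grade H n" "?y \<in> hspace H"
      using H.component_in_grade[OF h(1)] grade_in_hspace by blast+
    have "bar QSym zetaQ x = bar H \<phi> ?y"
      using QSym.bar_grade[OF linear_zetaQ x(2)] H.bar_grade[OF lin y(1)] \<zeta>[OF y(2)] by (simp add: x_eq)
    also have "\<dots> = conv_inverse H \<phi> ?y"
      using \<phi> n y(1) by (simp add: odd_functional_def)
    also have "\<dots> = zetaQ_inv (\<Psi> ?y)"
      by (rule H.conv_inverse_eq[OF lin inv y(2)])
    also have "\<dots> = conv_inverse QSym zetaQ x"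
      unfolding x_eq by (rule conv_inverse_zetaQ[symmetric, OF \<Psi>.\<Psi>_hspace[OF y(2)]])
    finally show "bar QSym zetaQ x = conv_inverse QSym zetaQ x" .
  qed
qed

lemma graded_hopf_hom_QSym:
  assumes H: "graded_bialgebra H" and \<Psi>: "graded_coalgebra_hom H QSym \<Psi>"
    and \<phi>: "character H \<phi>" and \<zeta>: "\<And>h. h \<in> hspace H \<Longrightarrow> zetaQ (\<Psi> h) = \<phi> h"
  shows "graded_hopf_hom H QSym \<Psi>"
proof -
  interpret H: graded_bialg H by standard (rule H)
  interpret \<Psi>: coalg_hom H QSym \<Psi> by unfold_locales (rule \<Psi>)
  have mul: "\<Psi> (mul H a b) = mul QSym (\<Psi> a) (\<Psi> b)" if "a \<in> hspace H" "b \<in> hspace H" for a b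
    by (rule coalgebra_hom_mul[OF H \<Psi> _ that]) (use \<phi> in \<open>simp add: \<zeta> H.mul_in_hspace character_def\<close>)
  \<comment> \<open>The unit lands in degree zero, which is a line in \<open>QSym\<close>; comparing
    counits shows that the scalar is 1.\<close>
  obtain c where c: "\<Psi> (one H) = c *\<^sub>Q one QSym"
    using \<Psi>.\<Psi>_grade[OF H.one_in_grade] grade_QSym_0 by auto
  then have "c = counit QSym (\<Psi> (one H))"
    by (simp add: linear_onQ_scale[OF linear_counit_QSym QSym.one_in_hspace] QSym.counit_one scaleQ_rat_def)
  also have "\<dots> = 1" by (simp add: \<Psi>.counit_\<Psi>[OF H.one_in_hspace] H.counit_one)
  finally have one: "\<Psi> (one H) = one QSym" using c by simp
  show ?thesis
    unfolding graded_hopf_hom_def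
    using \<Psi> one mul hom_antipode[OF H graded_bialgebra_QSym \<Psi> one mul] by blast
qed

lemma graded_coalgebra_hom_odd_QSym:
  "graded_coalgebra_hom H (odd_QSym k) \<Psi> \<longleftrightarrow>
   graded_coalgebra_hom H QSym \<Psi> \<and> (\<forall>n. \<Psi> ` grade H n \<subseteq> odd_part k)"
  unfolding graded_coalgebra_hom_def odd_QSym_simps by blast

theorem theorem4p13:
  fixes H :: "('h::rat_vector, 'l::finite) ghopf" and k :: "enat ^ 'l"
  assumes "graded_connected_hopf H"
  shows
    "(\<forall>\<phi>. odd_functional H k \<phi> \<and> \<phi> (one H) = 1 \<longrightarrow>
        (\<exists>\<Psi> :: 'h \<Rightarrow> 'l pseries.
           (graded_coalgebra_hom H QSym \<Psi> \<and> (\<forall>h\<in>hspace H. zetaQ (\<Psi> h) = \<phi> h)) \<and>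
           (\<forall>\<Psi>'. graded_coalgebra_hom H QSym \<Psi>' \<and> (\<forall>h\<in>hspace H. zetaQ (\<Psi>' h) = \<phi> h) \<longrightarrow>
              (\<forall>h\<in>hspace H. \<Psi>' h = \<Psi> h)) \<and>
           \<Psi> ` hspace H \<subseteq> odd_part k \<and>
           (\<forall>n. \<forall>h\<in>grade H n. \<Psi> h = (\<Sum>I\<in>vector_comps n. comp_functional H \<phi> I h *\<^sub>Q M I)) \<and>
           (character H \<phi> \<longrightarrow> graded_hopf_hom H QSym \<Psi>))) \<and>
     (comb_hopf (odd_QSym k) zetaQ \<and> odd_functional (odd_QSym k) k zetaQ) \<and>
     (\<forall>\<phi>. comb_hopf H \<phi> \<and> odd_functional H k \<phi> \<longrightarrow>
        (\<exists>\<Psi>. comb_hopf_hom H \<phi> (odd_QSym k) zetaQ \<Psi> \<and>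
           (\<forall>\<Psi>'. comb_hopf_hom H \<phi> (odd_QSym k) zetaQ \<Psi>' \<longrightarrow> (\<forall>h\<in>hspace H. \<Psi>' h = \<Psi> h))))"
proof -
  have bialg: "graded_bialgebra H" and conn: "grade H 0 = range (\<lambda>c. c *\<^sub>Q one H)"
    using assms by (auto simp: graded_connected_hopf_def)
  interpret H: graded_bialg H by standard (rule bialg)
  have coalg: "graded_coalgebra H" by (rule H.graded_coalgebra)
  have universal: "\<exists>\<Psi> :: 'h \<Rightarrow> 'l pseries.
      graded_coalgebra_hom H QSym \<Psi> \<and> (\<forall>h\<in>hspace H. zetaQ (\<Psi> h) = \<phi> h) \<and>
      (\<forall>n. \<forall>h\<in>grade H n. \<Psi> h = (\<Sum>I\<in>vector_comps n. comp_functional H \<phi> I h *\<^sub>Q M I))"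
    if odd: "odd_functional H k \<phi>" and one: "\<phi> (one H) = 1" for \<phi>
  proof -
    have lin: "linear_onQ (hspace H) \<phi>" using odd by (simp add: odd_functional_def)
    \<comment> \<open>By connectedness degree zero is spanned by \<open>one H\<close>, where both
      functionals take the value 1.\<close>
    have \<phi>_0: "\<phi> h = counit H h" if "h \<in> grade H 0" for h
      using that conn one
      by (auto simp: linear_onQ_scale[OF lin H.one_in_hspace]
          linear_onQ_scale[OF H.linear_counit H.one_in_hspace] H.counit_one)
    have "H.universal_map \<phi> h = (\<Sum>I\<in>vector_comps n. comp_functional H \<phi> I h *\<^sub>Q M I)"
      if "h \<in> grade H n" for n h
      using H.universal_map_grade[OF lin that] H.comp_functional_eq[OF lin grade_in_hspace[OF that]]
      by (simp add: H.universal_grade_def[OF lin])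
    then show ?thesis
      using H.graded_coalgebra_hom_universal_map[OF lin] H.zetaQ_universal_map[OF lin \<phi>_0] by blast
  qed
  have unique: "\<forall>h\<in>hspace H. \<Psi>' h = \<Psi> h"
    if "graded_coalgebra_hom H QSym \<Psi>" "\<forall>h\<in>hspace H. zetaQ (\<Psi> h) = \<phi> h"
      "graded_coalgebra_hom H QSym \<Psi>'" "\<forall>h\<in>hspace H. zetaQ (\<Psi>' h) = \<phi> h"
    for \<phi> and \<Psi> \<Psi>' :: "'h \<Rightarrow> 'l pseries"
    using coalgebra_hom_unique[OF coalg that(3,1)] that(2,4) by simp
  have part1: "\<exists>\<Psi> :: 'h \<Rightarrow> 'l pseries.
           (graded_coalgebra_hom H QSym \<Psi> \<and> (\<forall>h\<in>hspace H. zetaQ (\<Psi> h) = \<phi> h)) \<and>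
           (\<forall>\<Psi>'. graded_coalgebra_hom H QSym \<Psi>' \<and> (\<forall>h\<in>hspace H. zetaQ (\<Psi>' h) = \<phi> h) \<longrightarrow>
              (\<forall>h\<in>hspace H. \<Psi>' h = \<Psi> h)) \<and>
           \<Psi> ` hspace H \<subseteq> odd_part k \<and>
           (\<forall>n. \<forall>h\<in>grade H n. \<Psi> h = (\<Sum>I\<in>vector_comps n. comp_functional H \<phi> I h *\<^sub>Q M I)) \<and>
           (character H \<phi> \<longrightarrow> graded_hopf_hom H QSym \<Psi>)"
    if odd: "odd_functional H k \<phi>" and one: "\<phi> (one H) = 1" for \<phi>
  proof -
    obtain \<Psi> :: "'h \<Rightarrow> 'l pseries" where \<Psi>: "graded_coalgebra_hom H QSym \<Psi>"
      "\<forall>h\<in>hspace H. zetaQ (\<Psi> h) = \<phi> h"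
      "\<forall>n. \<forall>h\<in>grade H n. \<Psi> h = (\<Sum>I\<in>vector_comps n. comp_functional H \<phi> I h *\<^sub>Q M I)"
      using universal[OF odd one] by blast
    have "\<Psi> ` hspace H \<subseteq> odd_part k"
      by (rule hom_image_in_odd_part[OF coalg \<Psi>(1) odd]) (use \<Psi>(2) in blast)
    moreover have "graded_hopf_hom H QSym \<Psi>" if "character H \<phi>"
      by (rule graded_hopf_hom_QSym[OF bialg \<Psi>(1) that]) (use \<Psi>(2) in blast)
    ultimately show ?thesis
      using \<Psi> unique[OF \<Psi>(1,2)] by blast
  qed
  have part3: "\<exists>\<Psi>. comb_hopf_hom H \<phi> (odd_QSym k) zetaQ \<Psi> \<and>
      (\<forall>\<Psi>'. comb_hopf_hom H \<phi> (odd_QSym k) zetaQ \<Psi>' \<longrightarrow> (\<forall>h\<in>hspace H. \<Psi>' h = \<Psi> h))"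
    if comb: "comb_hopf H \<phi>" and odd: "odd_functional H k \<phi>" for \<phi>
  proof -
    have char: "character H \<phi>" using comb by (simp add: comb_hopf_def)
    then have one: "\<phi> (one H) = 1" by (simp add: character_def)
    obtain \<Psi> :: "'h \<Rightarrow> 'l pseries" where \<Psi>: "graded_coalgebra_hom H QSym \<Psi>"
      "\<forall>h\<in>hspace H. zetaQ (\<Psi> h) = \<phi> h" "\<Psi> ` hspace H \<subseteq> odd_part k" "graded_hopf_hom H QSym \<Psi>"
      using part1[OF odd one] char by blast
    have hom: "graded_coalgebra_hom H (odd_QSym k) \<Psi>"
      unfolding graded_coalgebra_hom_odd_QSym using \<Psi>(1,3) grade_in_hspace by blast
    have one': "\<Psi> (one H) = one (odd_QSym k)"
      using \<Psi>(4) by (simp add: graded_hopf_hom_def odd_QSym_simps)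
    have mul: "\<Psi> (mul H a b) = mul (odd_QSym k) (\<Psi> a) (\<Psi> b)" if "a \<in> hspace H" "b \<in> hspace H" for a b
      using \<Psi>(4) that by (simp add: graded_hopf_hom_def odd_QSym_simps)
    have "graded_hopf_hom H (odd_QSym k) \<Psi>"
      unfolding graded_hopf_hom_def
      using hom one' mul hom_antipode[OF bialg graded_bialgebra_odd_QSym hom one' mul] by blast
    then have "comb_hopf_hom H \<phi> (odd_QSym k) zetaQ \<Psi>"
      using \<Psi>(2) by (simp add: comb_hopf_hom_def)
    \<comment> \<open>A morphism into the odd part is also a coalgebra morphism into
      \<open>QSym\<close> with the same values of \<open>zetaQ\<close>, so uniqueness there settles
      terminality.\<close>
    moreover have "\<forall>h\<in>hspace H. \<Psi>' h = \<Psi> h" if "comb_hopf_hom H \<phi> (odd_QSym k) zetaQ \<Psi>'" for \<Psi>'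
      using that unfolding comb_hopf_hom_def graded_hopf_hom_def graded_coalgebra_hom_odd_QSym
      by (intro unique[OF \<Psi>(1,2)]) blast+
    ultimately show ?thesis by blast
  qed
  show ?thesis
    by (intro conjI allI impI; (elim conjE)?)
      (rule part1 part3 comb_hopf_odd_QSym odd_functional_odd_QSym; assumption)+
qed

end
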